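(* Let $A=(a_{ij})$ be a real symmetric $N\times N$ matrix and $M=(M_1,\dots,M_N)^T\in\mathbb{R}^N$. For any $\mathbb{R}^N$-valued $u_0\in\dot H^1(\mathbb{S}^2)$ and $u_1\in L^2(\mathbb{S}^2)$ with every component of $u_1$ having integral zero over $\mathbb{S}^2$, there exists $T>0$, depending only on $A$, $M$, $\|u_0\|_{\dot H^1}$ and $\|u_1\|_{L^2}$, and $u\colon[0,T]\times\mathbb{S}^2\to\mathbb{R}^N$ in $C^0_t\dot H^1_x\cap C^1_tL^2_x$ solving $$\partial_t^2 u_i-\Delta_g u_i=\sum_{j=1}^N a_{ij}M_j\left(\frac{e^{2u_j}}{\fint_{\mathbb{S}^2}e^{2u_j}}-1\right),\quad i=1,\dots,N,$$ with $u(0)=u_0$, $\partial_tu(0)=u_1$. Moreover $\int_{\mathbb{S}^2}u(t)=\int_{\mathbb{S}^2}u_0$ (componentwise) for all $t\in[0,T]$.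
   Context: $\mathbb{S}^2$ carries the standard round metric $g$; $\Delta_g$ is its (negative semidefinite) Laplacian acting componentwise; $\nabla$ is the gradient for $g$; integrals are with respect to surface measure and $\fint_{\mathbb{S}^2}=\frac1{4\pi}\int_{\mathbb{S}^2}$. For $\mathbb{R}^N$-valued maps, $\|u_0\|_{\dot H^1}^2=\int_{\mathbb{S}^2}|\nabla u_0|^2$ (sum over components), $\|u_1\|_{L^2}^2=\int_{\mathbb{S}^2}|u_1|^2$. Solutions are understood in the Duhamel sense: $u(t)=\cos(t\sqrt{-\Delta_g})u_0+\frac{\sin(t\sqrt{-\Delta_g})}{\sqrt{-\Delta_g}}u_1+\int_0^t\frac{\sin((t-s)\sqrt{-\Delta_g})}{\sqrt{-\Delta_g}}f(s)\,ds$ with $f$ the (zero-mean) right-hand side. *)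

theory Defs
  imports "HOL-Analysis.Analysis"
begin

text \<open>Surface measure: push forward of 3 times Lebesgue measure on the unit ball under
  radial projection x / |x|.  Total mass 4 pi; concentrated on sphere 0 1.\<close>
definition sphere_measure :: "(real^3) measure" where
  "sphere_measure =
     distr (density lborel (\<lambda>x. ennreal (3 * indicator (ball (0::real^3) 1) x))) lborel
           (\<lambda>x. x /\<^sub>R norm x)"

definition sfint :: "(real^3 \<Rightarrow> real) \<Rightarrow> real" where
  "sfint f = integral\<^sup>L sphere_measure f / (4 * pi)"

definition L2S :: "(real^3 \<Rightarrow> real) \<Rightarrow> bool" where
  "L2S f \<longleftrightarrow> f \<in> borel_measurable sphere_measure \<and>
              integrable sphere_measure (\<lambda>x. (f x)^2)"

definition ipS :: "(real^3 \<Rightarrow> real) \<Rightarrow> (real^3 \<Rightarrow> real) \<Rightarrow> real" where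
  "ipS f g = integral\<^sup>L sphere_measure (\<lambda>x. f x * g x)"

text \<open>Test functions: C^1 functions on R^3 (their restrictions to S^2).\<close>
definition test_fun :: "(real^3 \<Rightarrow> real) \<Rightarrow> bool" where
  "test_fun \<phi> \<longleftrightarrow> (\<exists>g. continuous_on UNIV g \<and>
                       (\<forall>x. (\<phi> has_derivative (\<lambda>h. g x \<bullet> h)) (at x)))"

text \<open>k-th ambient component of the tangential gradient (I - x x^T) grad phi.\<close>
definition Dtan :: "(real^3 \<Rightarrow> real) \<Rightarrow> 3 \<Rightarrow> real^3 \<Rightarrow> real" where
  "Dtan \<phi> k x = frechet_derivative \<phi> (at x) (axis k 1)
                 - x $ k * frechet_derivative \<phi> (at x) x"

text \<open>G is a weak (tangential) gradient of u on S^2: for every test function phi,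
  int u D_k phi = - int G_k phi + 2 int x_k u phi (integration by parts on S^2).\<close>
definition is_wgrad :: "(real^3 \<Rightarrow> real) \<Rightarrow> (real^3 \<Rightarrow> real^3) \<Rightarrow> bool" where
  "is_wgrad u G \<longleftrightarrow> (\<forall>k. L2S (\<lambda>x. G x $ k)) \<and>
     (\<forall>\<phi>. test_fun \<phi> \<longrightarrow> (\<forall>k.
        integral\<^sup>L sphere_measure (\<lambda>x. u x * Dtan \<phi> k x)
        = - integral\<^sup>L sphere_measure (\<lambda>x. G x $ k * \<phi> x)
          + 2 * integral\<^sup>L sphere_measure (\<lambda>x. x $ k * u x * \<phi> x)))"

definition wgrad :: "(real^3 \<Rightarrow> real) \<Rightarrow> real^3 \<Rightarrow> real^3" where
  "wgrad u = (SOME G. is_wgrad u G)"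

definition H1S :: "(real^3 \<Rightarrow> real) \<Rightarrow> bool" where
  "H1S u \<longleftrightarrow> L2S u \<and> (\<exists>G. is_wgrad u G)"

definition h1sq :: "(real^3 \<Rightarrow> real) \<Rightarrow> real" where
  "h1sq u = integral\<^sup>L sphere_measure (\<lambda>x. \<Sum>k\<in>UNIV. (wgrad u x $ k)^2)"

definition H1vnorm :: "(real^3 \<Rightarrow> real^'n::finite) \<Rightarrow> real" where
  "H1vnorm w = sqrt (\<Sum>i\<in>UNIV. h1sq (\<lambda>x. w x $ i))"

definition L2vnorm :: "(real^3 \<Rightarrow> real^'n::finite) \<Rightarrow> real" where
  "L2vnorm w = sqrt (\<Sum>i\<in>UNIV. integral\<^sup>L sphere_measure (\<lambda>x. (w x $ i)^2))"

text \<open>Weak eigenfunction: -Delta_g Y = lam Y, i.e. int grad Y . grad phi = lam int Y phi.\<close>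
definition eigenS :: "real \<Rightarrow> (real^3 \<Rightarrow> real) \<Rightarrow> bool" where
  "eigenS lam Y \<longleftrightarrow> H1S Y \<and> (\<exists>G. is_wgrad Y G \<and>
     (\<forall>\<phi>. test_fun \<phi> \<longrightarrow>
        integral\<^sup>L sphere_measure (\<lambda>x. \<Sum>k\<in>UNIV. G x $ k * Dtan \<phi> k x)
        = lam * integral\<^sup>L sphere_measure (\<lambda>x. Y x * \<phi> x)))"

text \<open>Symbols of cos(t sqrt(-Delta)) and sin(t sqrt(-Delta))/sqrt(-Delta) on eigenvalue lam.\<close>
definition cosw :: "real \<Rightarrow> real \<Rightarrow> real" where
  "cosw t lam = cos (t * sqrt lam)"

definition sinw :: "real \<Rightarrow> real \<Rightarrow> real" where
  "sinw t lam = (if lam = 0 then t else sin (t * sqrt lam) / sqrt lam)"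

definition NL :: "real^'n^'n \<Rightarrow> real^'n \<Rightarrow> (real^3 \<Rightarrow> real^'n) \<Rightarrow> 'n \<Rightarrow> real^3 \<Rightarrow> real"
  where
  "NL A M w i x = (\<Sum>j\<in>UNIV. A $ i $ j * M $ j *
       (exp (2 * w x $ j) / sfint (\<lambda>y. exp (2 * w y $ j)) - 1))"

text \<open>u solves the system on [0,T] in C^0 Hdot^1 cap C^1 L^2, in the Duhamel sense
  (the Duhamel formula is tested against every eigenfunction of -Delta_g, which
  is the definition of the spectral functional calculus).\<close>
definition is_solution ::
  "real^'n^'n \<Rightarrow> real^'n \<Rightarrow> real \<Rightarrow> (real^3 \<Rightarrow> real^'n) \<Rightarrow> (real^3 \<Rightarrow> real^'n)
   \<Rightarrow> (real \<Rightarrow> real^3 \<Rightarrow> real^'n::finite) \<Rightarrow> bool" where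
  "is_solution A M T u0 u1 u \<longleftrightarrow>
     (\<forall>t\<in>{0..T}. \<forall>i. H1S (\<lambda>x. u t x $ i)) \<and>
     (\<forall>t\<in>{0..T}. ((\<lambda>s. H1vnorm (\<lambda>x. u s x - u t x)) \<longlongrightarrow> 0) (at t within {0..T})) \<and>
     (\<exists>v. (\<forall>t\<in>{0..T}. \<forall>i. L2S (\<lambda>x. v t x $ i)) \<and>
          (\<forall>t\<in>{0..T}. ((\<lambda>s. L2vnorm (\<lambda>x. v s x - v t x)) \<longlongrightarrow> 0) (at t within {0..T})) \<and>
          (\<forall>t\<in>{0..T}. ((\<lambda>s. L2vnorm (\<lambda>x. (u s x - u t x) /\<^sub>R (s - t) - v t x))
                            \<longlongrightarrow> 0) (at t within {0..T})) \<and>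
          (AE x in sphere_measure. v 0 x = u1 x)) \<and>
     (AE x in sphere_measure. u 0 x = u0 x) \<and>
     (\<forall>t\<in>{0..T}. \<forall>j. integrable sphere_measure (\<lambda>x. exp (2 * u t x $ j))) \<and>
     (\<forall>t\<in>{0..T}. \<forall>i. L2S (NL A M (u t) i)) \<and>
     (\<forall>t\<in>{0..T}. \<forall>i lam Y. eigenS lam Y \<longrightarrow>
        set_integrable lborel {0..t} (\<lambda>\<tau>. sinw (t - \<tau>) lam * ipS (NL A M (u \<tau>) i) Y) \<and>
        ipS (\<lambda>x. u t x $ i) Y =
          cosw t lam * ipS (\<lambda>x. u0 x $ i) Y + sinw t lam * ipS (\<lambda>x. u1 x $ i) Y
          + (LINT \<tau>:{0..t}|lborel. sinw (t - \<tau>) lam * ipS (NL A M (u \<tau>) i) Y))"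

end

theory Submission
  imports Defs "HOL-Library.Discrete_Functions"
begin

text \<open>
  Restrictions of polynomials of degree at most \<open>l\<close> to the sphere are invariant under the Laplacian,
  which acts on them as \<open>- l (l + 1)\<close> up to polynomials of lower degree. Gram-Schmidt
  orthonormalisation of the monomials, ordered by degree, therefore yields eigenfunctions; they are
  complete by the Stone-Weierstrass theorem, and in terms of the expansion coefficients
  \<open>L\<^sup>2\<close> and the homogeneous \<open>H\<^sup>1\<close> space are (weighted) sequence spaces. The only integration by
  parts needed is the derivative of the rotation invariance of the surface measure.

  Rotation invariance also makes the reproducing kernel of the polynomials of bounded degree constant
  on the diagonal. Hence the part of degree below \<open>2 ^ M\<close> of a zero-mean function \<open>v\<close> is bounded by
  \<open>sqrt M\<close> times the norm of its gradient, while the remainder has \<open>L\<^sup>2\<close> norm \<open>O(2 ^ (- M))\<close>. This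
  gives \<open>\<integral> exp (8 \<bar>v\<bar>) \<le> K(R)\<close> whenever \<open>\<parallel>\<nabla>v\<parallel> \<le> R\<close>, and so the nonlinearity is a locally
  Lipschitz map from \<open>H\<^sup>1\<close> to \<open>L\<^sup>2\<close> with constants depending on the gradient norm only. After the free
  wave evolution is undone, the system is an ordinary differential equation in a Hilbert space, to
  which the Picard-Lindeloef theorem applies.
\<close>

section \<open>Ordinary differential equations in Banach spaces; square-summable sequences\<close>

text \<open>The energy space is critical: on a surface H^1 just fails to embed into L^\<infinity>,
  but the failure is only logarithmic in the degree at which an expansion is cut
  (\<open>kernel_log_bound\<close>), and an exponential can absorb a logarithmic loss. Two features
  of the right-hand side make the lifespan depend on the two norms alone. Adding a constant to u_j
  does not change the quotient of exp(2 u_j) by its average, so the mean of u_0, which the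
  homogeneous norm does not see, drops out. And each bracket has integral zero, so the constant mode
  is not forced; as u_1 has mean zero, the mean of u is conserved. Division by the average costs
  nothing, because it is at least 1 for functions of mean zero. Passing from u to w =
  sqrt(-\<Delta>) u turns both norms into plain \<open>l2\<close> norms, and the free evolution into
  a rotation of (w, v) by multipliers bounded by 1. An eigenspace involves only finitely many
  \<open>Y k\<close>, so the Duhamel formula tested against an arbitrary eigenfunction reduces to
  finitely many coefficients.\<close>

lemma picard_lindeloef:
  fixes G :: "real \<Rightarrow> 'a::banach \<Rightarrow> 'a"
  assumes T: "0 < T" and r: "0 \<le> r"
    and cont: "\<And>f. continuous_on {0..T} f \<Longrightarrow> (\<And>t. t \<in> {0..T} \<Longrightarrow> f t \<in> cball y0 r)
                 \<Longrightarrow> continuous_on {0..T} (\<lambda>s. G s (f s))"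
    and bound: "\<And>t y. t \<in> {0..T} \<Longrightarrow> y \<in> cball y0 r \<Longrightarrow> norm (G t y) \<le> B"
    and lip: "\<And>t y z. t \<in> {0..T} \<Longrightarrow> y \<in> cball y0 r \<Longrightarrow> z \<in> cball y0 r
                 \<Longrightarrow> norm (G t y - G t z) \<le> L * norm (y - z)"
    and TB: "T * B \<le> r" and TL: "T * L < 1" and L: "0 \<le> L"
  shows "\<exists>y. continuous_on {0..T} y \<and> (\<forall>t\<in>{0..T}. y t \<in> cball y0 r) \<and>
             (\<forall>t\<in>{0..T}. y t = y0 + integral {0..t} (\<lambda>s. G s (y s)))"
proof -
  \<comment> \<open>Clamping the upper limit of integration makes every iterate a bounded continuous
    function on the whole line, and the space of these functions is complete.\<close>
  define c where "c = (\<lambda>t::real. max 0 (min T t))"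
  have c_in: "c t \<in> {0..T}" for t using T by (auto simp: c_def)
  have c_id: "c t = t" if "t \<in> {0..T}" for t using that by (auto simp: c_def)
  have c_cont: "continuous_on UNIV c" unfolding c_def by (intro continuous_intros)
  define X where "X = {f :: real \<Rightarrow>\<^sub>C 'a. \<forall>t. f t \<in> cball y0 r}"
  define J where "J = (\<lambda>f :: real \<Rightarrow>\<^sub>C 'a. \<lambda>t. y0 + integral {0..c t} (\<lambda>s. G s (f s)))"
  define P where "P = (\<lambda>f. Bcontfun (J f))"
  have contG: "continuous_on {0..T} (\<lambda>s. G s (apply_bcontfun f s))" if "f \<in> X" for f
    using that by (intro cont) (auto simp: X_def)
  have intG: "(\<lambda>s. G s (apply_bcontfun f s)) integrable_on {0..c t}" if "f \<in> X" for f t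
  proof -
    have "{0..c t} \<subseteq> {0..T}" using c_in[of t] by auto
    then show ?thesis
      by (intro integrable_continuous_real continuous_on_subset[OF contG[OF that]])
  qed
  have J_near: "J f t \<in> cball y0 r" if "f \<in> X" for f t
  proof -
    have "norm (integral {0..c t} (\<lambda>s. G s (f s))) \<le> B * (c t - 0)"
    proof (rule integral_bound)
      show "0 \<le> c t" using c_in[of t] by simp
      show "continuous_on {0..c t} (\<lambda>s. G s (f s))"
        using contG[OF that] c_in[of t] by (elim continuous_on_subset) auto
      show "\<And>s. s \<in> {0..c t} \<Longrightarrow> norm (G s (f s)) \<le> B"
        using c_in[of t] that by (intro bound) (auto simp: X_def)
    qed
    also have "\<dots> \<le> r"
    proof -
      have "0 \<le> B" using order_trans[OF norm_ge_zero bound[of 0 y0]] T r by simp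
      then have "B * c t \<le> B * T" using c_in[of t] by (intro mult_left_mono) auto
      then show ?thesis using TB by (simp add: mult.commute)
    qed
    finally show ?thesis by (simp add: J_def dist_norm)
  qed
  have J_bc: "J f \<in> bcontfun" if "f \<in> X" for f
  proof (rule bcontfun_normI)
    show "continuous_on UNIV (J f)"
    proof -
      have "continuous_on {0..T} (\<lambda>x. integral {0..x} (\<lambda>s. G s (f s)))"
        by (rule indefinite_integral_continuous_1) (rule integrable_continuous_real[OF contG[OF that]])
      then have "continuous_on UNIV (\<lambda>t. integral {0..c t} (\<lambda>s. G s (f s)))"
        by (rule continuous_on_compose2[OF _ c_cont]) (use c_in in auto)
      then show ?thesis unfolding J_def by (intro continuous_intros)
    qed
    show "norm (J f t) \<le> norm y0 + r" for t
      using J_near[OF that, of t] norm_triangle_sub[of "J f t" y0] by (simp add: dist_norm norm_minus_commute)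
  qed
  have P_app: "apply_bcontfun (P f) t = J f t" if "f \<in> X" for f t
    using J_bc[OF that] by (simp add: P_def Bcontfun_inverse)
  have "\<exists>!f. f \<in> X \<and> P f = f"
  proof (rule Banach_fix[where c = "T * L"])
    show "complete X"
    proof -
      have "closed X"
      proof -
        have "X = (\<Inter>t. (\<lambda>f. apply_bcontfun f t) -` cball y0 r)" by (auto simp: X_def)
        moreover have "closed ((\<lambda>f :: real \<Rightarrow>\<^sub>C 'a. apply_bcontfun f t) -` cball y0 r)" for t
        proof (rule closed_vimage)
          show "closed (cball y0 r)" by simp
          show "continuous_on UNIV (\<lambda>f :: real \<Rightarrow>\<^sub>C 'a. apply_bcontfun f t)"
            proof (rule continuous_onI)
            fix f :: "real \<Rightarrow>\<^sub>C 'a" and e :: real assume "0 < e"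
            then show "\<exists>d>0. \<forall>g\<in>UNIV. dist g f < d \<longrightarrow> dist (apply_bcontfun g t) (apply_bcontfun f t) \<le> e"
              using dist_bounded order_trans less_imp_le by blast
          qed
        qed
        ultimately show ?thesis by (simp add: closed_INT)
      qed
      then show ?thesis by (simp add: complete_eq_closed)
    qed
    show "X \<noteq> {}"
      using r by (auto simp: X_def intro!: exI[of _ "const_bcontfun y0"])
    show "0 \<le> T * L" using T L by simp
    show "T * L < 1" by fact
    show "P ` X \<subseteq> X" using J_near P_app by (auto simp: X_def)
    fix f g assume fg: "f \<in> X" "g \<in> X"
    show "dist (P f) (P g) \<le> T * L * dist f g"
    proof (rule dist_bound)
      fix t
      have "dist (apply_bcontfun (P f) t) (apply_bcontfun (P g) t) =
            norm (integral {0..c t} (\<lambda>s. G s (f s)) - integral {0..c t} (\<lambda>s. G s (g s)))"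
        using fg by (simp add: P_app J_def dist_norm)
      also have "\<dots> = norm (integral {0..c t} (\<lambda>s. G s (f s) - G s (g s)))"
        using fg by (subst Henstock_Kurzweil_Integration.integral_diff) (auto intro: intG)
      also have "\<dots> \<le> (L * dist f g) * (c t - 0)"
      proof (rule integral_bound)
        show "0 \<le> c t" using c_in[of t] by simp
        have sub: "{0..c t} \<subseteq> {0..T}" using c_in[of t] by auto
        show "continuous_on {0..c t} (\<lambda>s. G s (f s) - G s (g s))"
          using fg sub by (intro continuous_on_diff) (auto intro: continuous_on_subset[OF contG])
        fix s assume s: "s \<in> {0..c t}"
        have "norm (G s (f s) - G s (g s)) \<le> L * norm (f s - g s)"
          using fg s sub by (intro lip) (auto simp: X_def)
        also have "\<dots> \<le> L * dist f g"
          using L dist_bounded[of f s g] by (intro mult_left_mono) (auto simp: dist_norm)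
        finally show "norm (G s (f s) - G s (g s)) \<le> L * dist f g" .
      qed
      also have "\<dots> \<le> (L * dist f g) * T"
        using L c_in[of t] by (intro mult_left_mono) auto
      finally show "dist (apply_bcontfun (P f) t) (apply_bcontfun (P g) t) \<le> T * L * dist f g"
        by (simp add: ac_simps)
    qed
  qed
  then obtain f where f: "f \<in> X" "P f = f" by auto
  have "f t \<in> cball y0 r" for t using f by (auto simp: X_def)
  moreover have "f t = y0 + integral {0..t} (\<lambda>s. G s (f s))" if "t \<in> {0..T}" for t
    using P_app[OF f(1), of t] that by (simp add: f(2) J_def c_id)
  ultimately show ?thesis
    using continuous_on_apply_bcontfun by blast
qed

section \<open>Square-summable sequences as a Hilbert space\<close>

lemma summable_mult_squares:
  fixes f g :: "nat \<Rightarrow> real"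
  assumes "summable (\<lambda>k. (f k)\<^sup>2)" "summable (\<lambda>k. (g k)\<^sup>2)"
  shows "summable (\<lambda>k. f k * g k)"
proof (rule summable_comparison_test_ev)
  show "summable (\<lambda>k. (f k)\<^sup>2 + (g k)\<^sup>2)" using assms by (rule summable_add)
  have "\<bar>f k * g k\<bar> \<le> (f k)\<^sup>2 + (g k)\<^sup>2" for k
  proof -
    have "2 * (\<bar>f k\<bar> * \<bar>g k\<bar>) \<le> (f k)\<^sup>2 + (g k)\<^sup>2"
      using sum_squares_bound[of "\<bar>f k\<bar>" "\<bar>g k\<bar>"] by simp
    moreover have "0 \<le> \<bar>f k\<bar> * \<bar>g k\<bar>" by simp
    ultimately show ?thesis unfolding abs_mult by linarith
  qed
  then show "\<forall>\<^sub>F k in sequentially. norm (f k * g k) \<le> (f k)\<^sup>2 + (g k)\<^sup>2" by simp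
qed

lemma summable_square_add:
  fixes f g :: "nat \<Rightarrow> real"
  assumes "summable (\<lambda>k. (f k)\<^sup>2)" "summable (\<lambda>k. (g k)\<^sup>2)"
  shows "summable (\<lambda>k. (f k + g k)\<^sup>2)"
proof -
  have "summable (\<lambda>k. (f k)\<^sup>2 + (g k)\<^sup>2 + 2 * (f k * g k))"
    by (intro summable_add summable_mult assms summable_mult_squares)
  then show ?thesis by (simp add: power2_sum ac_simps)
qed

text \<open>A type rather than a set of sequences, so that \<open>l2 ^ 'n\<close> and products of
  such spaces are Banach spaces by type class instances.\<close>

typedef l2 = "{f :: nat \<Rightarrow> real. summable (\<lambda>k. (f k)\<^sup>2)}" morphisms l2_nth Abs_l2
  by (rule exI[of _ "\<lambda>_. 0"]) simp

lemma l2_nth_Abs: "summable (\<lambda>k. (f k)\<^sup>2) \<Longrightarrow> l2_nth (Abs_l2 f) = f"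
  by (simp add: Abs_l2_inverse)

lemma summable_l2: "summable (\<lambda>k. (l2_nth x k)\<^sup>2)"
  using l2_nth[of x] by simp

lemma summable_l2_mult: "summable (\<lambda>k. l2_nth x k * l2_nth y k)"
  by (intro summable_mult_squares summable_l2)

lemma l2_eqI: "(\<And>k. l2_nth x k = l2_nth y k) \<Longrightarrow> x = y"
  by (simp add: l2_nth_inject[symmetric] ext)

instantiation l2 :: real_inner
begin

definition "0 = Abs_l2 (\<lambda>_. 0)"
definition "x + y = Abs_l2 (\<lambda>k. l2_nth x k + l2_nth y k)"
definition "- x = Abs_l2 (\<lambda>k. - l2_nth x k)"
definition "x - y = x + - (y :: l2)"
definition "a *\<^sub>R x = Abs_l2 (\<lambda>k. a * l2_nth x k)"
definition "inner x y = (\<Sum>k. l2_nth x k * l2_nth y k)"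
definition "norm (x :: l2) = sqrt (inner x x)"
definition "sgn (x :: l2) = inverse (norm x) *\<^sub>R x"
definition "dist x y = norm (x - y :: l2)"
definition [code del]: "(uniformity :: (l2 \<times> l2) filter) = (INF e\<in>{0<..}. principal {(x, y). dist x y < e})"
definition [code del]: "open (U :: l2 set) \<longleftrightarrow>
  (\<forall>x\<in>U. eventually (\<lambda>(x', y). x' = x \<longrightarrow> y \<in> U) uniformity)"

lemma l2_nth_0 [simp]: "l2_nth 0 k = 0"
  by (simp add: zero_l2_def l2_nth_Abs)

lemma l2_nth_add [simp]: "l2_nth (x + y) k = l2_nth x k + l2_nth y k"
  by (simp add: plus_l2_def l2_nth_Abs summable_square_add summable_l2)

lemma l2_nth_uminus [simp]: "l2_nth (- x) k = - l2_nth x k"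
  by (simp add: uminus_l2_def l2_nth_Abs summable_l2)

lemma l2_nth_diff [simp]: "l2_nth (x - y) k = l2_nth x k - l2_nth y k"
  by (simp add: minus_l2_def)

lemma l2_nth_scaleR [simp]: "l2_nth (a *\<^sub>R x) k = a * l2_nth x k"
  by (simp add: scaleR_l2_def l2_nth_Abs summable_l2 power_mult_distrib summable_mult)

instance
proof
  fix x y z :: l2 and a b :: real
  show "inner x y = inner y x" by (simp add: inner_l2_def mult.commute)
  show "inner (x + y) z = inner x z + inner y z"
    by (simp add: inner_l2_def distrib_right suminf_add summable_l2_mult)
  show "inner (a *\<^sub>R x) y = a * inner x y"
    by (simp add: inner_l2_def mult.assoc suminf_mult summable_l2_mult)
  show "0 \<le> inner x x"
    by (simp add: inner_l2_def suminf_nonneg summable_l2_mult)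
  show "inner x x = 0 \<longleftrightarrow> x = 0"
  proof
    assume "inner x x = 0"
    then have "\<forall>k. l2_nth x k * l2_nth x k = 0"
      using suminf_eq_zero_iff[OF summable_l2_mult[of x x]] by (auto simp: inner_l2_def)
    then show "x = 0" by (intro l2_eqI) simp
  qed (simp add: inner_l2_def)
qed (auto intro!: l2_eqI simp: algebra_simps norm_l2_def sgn_l2_def dist_l2_def uniformity_l2_def
       open_l2_def)

end

lemma norm_l2_square: "(norm x)\<^sup>2 = (\<Sum>k. (l2_nth x k)\<^sup>2)"
  unfolding power2_norm_eq_inner by (simp add: inner_l2_def power2_eq_square)

lemma sum_l2_le: "finite K \<Longrightarrow> (\<Sum>k\<in>K. (l2_nth x k)\<^sup>2) \<le> (norm x)\<^sup>2"
  unfolding norm_l2_square by (rule sum_le_suminf[OF summable_l2]) auto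

lemma abs_l2_nth_le: "\<bar>l2_nth x k\<bar> \<le> norm x"
  using sum_l2_le[of "{k}" x] by (simp add: abs_le_square_iff[symmetric])

lemma bounded_linear_l2_nth: "bounded_linear (\<lambda>x. l2_nth x k)"
  by (rule bounded_linear_intro[where K = 1]) (auto simp: abs_l2_nth_le)

lemma norm_l2_leI:
  assumes "\<And>n. (\<Sum>k<n. (l2_nth x k)\<^sup>2) \<le> b\<^sup>2" "0 \<le> b"
  shows "norm x \<le> b"
proof -
  have "(norm x)\<^sup>2 \<le> b\<^sup>2"
    unfolding norm_l2_square by (rule suminf_le_const[OF summable_l2]) (use assms in auto)
  then show ?thesis using assms(2) by (simp add: power2_le_iff_abs_le)
qed

instance l2 :: complete_space
proof
  fix X :: "nat \<Rightarrow> l2"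
  assume C: "Cauchy X"
  have Ck: "Cauchy (\<lambda>n. l2_nth (X n) k)" for k
    using bounded_linear.Cauchy[OF bounded_linear_l2_nth C] .
  define f where "f = (\<lambda>k. lim (\<lambda>n. l2_nth (X n) k))"
  have f: "(\<lambda>n. l2_nth (X n) k) \<longlonglongrightarrow> f k" for k
    using Ck[of k] by (simp add: f_def Cauchy_convergent_iff convergent_LIMSEQ_iff)
  \<comment> \<open>Fatou-type step: in a finite partial sum the limit in m can be taken termwise,
    and the bound obtained does not depend on the number of terms.\<close>
  have key: "\<exists>N. \<forall>n\<ge>N. \<forall>K. (\<Sum>k<K. (f k - l2_nth (X n) k)\<^sup>2) \<le> e\<^sup>2" if e: "e > 0" for e
  proof -
    obtain N where N: "\<And>m n. m \<ge> N \<Longrightarrow> n \<ge> N \<Longrightarrow> norm (X m - X n) < e"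
      using C e unfolding Cauchy_def dist_norm by blast
    have "(\<Sum>k<K. (f k - l2_nth (X n) k)\<^sup>2) \<le> e\<^sup>2" if n: "n \<ge> N" for n K
    proof (rule tendsto_upperbound)
      show "(\<lambda>m. \<Sum>k<K. (l2_nth (X m) k - l2_nth (X n) k)\<^sup>2) \<longlonglongrightarrow> (\<Sum>k<K. (f k - l2_nth (X n) k)\<^sup>2)"
        by (intro tendsto_intros f)
      show "\<forall>\<^sub>F m in sequentially. (\<Sum>k<K. (l2_nth (X m) k - l2_nth (X n) k)\<^sup>2) \<le> e\<^sup>2"
        using eventually_ge_at_top[of N]
      proof eventually_elim
        case (elim m)
        have "(\<Sum>k<K. (l2_nth (X m - X n) k)\<^sup>2) \<le> (norm (X m - X n))\<^sup>2" by (rule sum_l2_le) simp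
        also have "\<dots> \<le> e\<^sup>2" using N[OF elim n] by (intro power_mono) auto
        finally show ?case by simp
      qed
    qed simp
    then show ?thesis by blast
  qed
  have sm: "summable (\<lambda>k. (f k)\<^sup>2)"
  proof -
    obtain N where N: "\<And>K. (\<Sum>k<K. (f k - l2_nth (X N) k)\<^sup>2) \<le> 1"
      using key[of 1] by auto
    have "summable (\<lambda>k. (f k - l2_nth (X N) k)\<^sup>2)"
      by (rule summableI_nonneg_bounded[where x = 1]) (use N in auto)
    from summable_square_add[OF this summable_l2[of "X N"]] show ?thesis by simp
  qed
  have "X \<longlonglongrightarrow> Abs_l2 f"
  proof (rule metric_LIMSEQ_I)
    fix e :: real assume e: "0 < e"
    obtain N where N: "\<And>n K. n \<ge> N \<Longrightarrow> (\<Sum>k<K. (f k - l2_nth (X n) k)\<^sup>2) \<le> (e/2)\<^sup>2"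
      using key[of "e/2"] e by auto
    have "dist (X n) (Abs_l2 f) < e" if "n \<ge> N" for n
    proof -
      have "norm (Abs_l2 f - X n) \<le> e/2"
        by (rule norm_l2_leI) (use N[OF that] e in \<open>auto simp: l2_nth_Abs sm\<close>)
      then show ?thesis using e by (simp add: dist_norm norm_minus_commute)
    qed
    then show "\<exists>N. \<forall>n\<ge>N. dist (X n) (Abs_l2 f) < e" by blast
  qed
  then show "convergent X" by (auto simp: convergent_def)
qed

instance l2 :: banach ..

section \<open>Diagonal multipliers bounded by 1\<close>

definition mlt :: "(nat \<Rightarrow> real) \<Rightarrow> l2 \<Rightarrow> l2" where
  "mlt m x = Abs_l2 (\<lambda>k. m k * l2_nth x k)"

lemma summable_square_mult:
  fixes m f :: "nat \<Rightarrow> real"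
  assumes m: "\<And>k. \<bar>m k\<bar> \<le> 1" and f: "summable (\<lambda>k. (f k)\<^sup>2)"
  shows "summable (\<lambda>k. (m k * f k)\<^sup>2)"
proof (rule summable_comparison_test_ev[OF _ f])
  have "(m k)\<^sup>2 * (f k)\<^sup>2 \<le> 1 * (f k)\<^sup>2" for k
    using m[of k] by (intro mult_right_mono) (auto simp: abs_square_le_1)
  then show "\<forall>\<^sub>F k in sequentially. norm ((m k * f k)\<^sup>2) \<le> (f k)\<^sup>2" by (simp add: power_mult_distrib)
qed

lemma l2_nth_mlt [simp]: "(\<And>k. \<bar>m k\<bar> \<le> 1) \<Longrightarrow> l2_nth (mlt m x) k = m k * l2_nth x k"
  by (simp add: mlt_def l2_nth_Abs summable_square_mult summable_l2)

lemma norm_mlt_le: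
  assumes m: "\<And>k. \<bar>m k\<bar> \<le> 1" shows "norm (mlt m x) \<le> norm x"
proof (rule norm_l2_leI)
  fix n
  have "(m k)\<^sup>2 * (l2_nth x k)\<^sup>2 \<le> 1 * (l2_nth x k)\<^sup>2" for k
    using m[of k] by (intro mult_right_mono) (auto simp: abs_square_le_1)
  then have "(\<Sum>k<n. (l2_nth (mlt m x) k)\<^sup>2) \<le> (\<Sum>k<n. (l2_nth x k)\<^sup>2)"
    using m by (intro sum_mono) (simp add: power_mult_distrib)
  also have "\<dots> \<le> (norm x)\<^sup>2" by (rule sum_l2_le) simp
  finally show "(\<Sum>k<n. (l2_nth (mlt m x) k)\<^sup>2) \<le> (norm x)\<^sup>2" .
qed simp

lemma mlt_diff: "(\<And>k. \<bar>m k\<bar> \<le> 1) \<Longrightarrow> mlt m (x - y) = mlt m x - mlt m y"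
  by (intro l2_eqI) (simp add: algebra_simps)

text \<open>Continuity holds only strongly: for frequencies tending to infinity, cos (t sqrt (lam
  k)) is not continuous in t uniformly in k. On a fixed vector the majorant 4 x_k^2 gives it by the
  Weierstrass test, and the motion of the vector is harmless because the multipliers are
  contractions. This is why \<open>picard_lindeloef\<close> asks for continuity along curves
  only.\<close>

lemma continuous_on_mlt:
  fixes m :: "real \<Rightarrow> nat \<Rightarrow> real"
  assumes m: "\<And>k. continuous_on S (\<lambda>t. m t k)" "\<And>t k. \<bar>m t k\<bar> \<le> 1"
    and x: "continuous_on S x"
  shows "continuous_on S (\<lambda>t. mlt (m t) (x t))"
  unfolding continuous_on_def
proof
  fix t0 assume t0: "t0 \<in> S"
  have A: "((\<lambda>t. x t - x t0) \<longlongrightarrow> 0) (at t0 within S)"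
    using x t0 by (auto simp: continuous_on_def intro: LIM_zero)
  let ?q = "\<lambda>k t. ((m t k - m t0 k) * l2_nth (x t0) k)\<^sup>2"
  have bd: "(m t k - m t0 k)\<^sup>2 \<le> 2\<^sup>2" for t k
  proof -
    have "\<bar>m t k - m t0 k\<bar> \<le> 2" using m(2)[of t k] m(2)[of t0 k] by linarith
    then show ?thesis by (rule abs_le_square_iff[THEN iffD1, OF order_trans]) simp
  qed
  have qb: "norm (?q k t) \<le> 4 * (l2_nth (x t0) k)\<^sup>2" for k t
    using mult_right_mono[OF bd[of t k], of "(l2_nth (x t0) k)\<^sup>2"] by (simp add: power_mult_distrib)
  have "continuous_on S (\<lambda>t. \<Sum>k. ?q k t)"
  proof (rule uniform_limit_theorem)
    show "uniform_limit S (\<lambda>n t. \<Sum>k<n. ?q k t) (\<lambda>t. \<Sum>k. ?q k t) sequentially"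
      by (rule Weierstrass_m_test[OF qb]) (simp add: summable_l2 summable_mult)
    show "\<forall>\<^sub>F n in sequentially. continuous_on S (\<lambda>t. \<Sum>k<n. ?q k t)"
      by (intro always_eventually allI continuous_intros m)
  qed simp
  then have "((\<lambda>t. \<Sum>k. ?q k t) \<longlongrightarrow> (\<Sum>k. ?q k t0)) (at t0 within S)"
    using t0 by (auto simp: continuous_on_def)
  moreover have "(\<Sum>k. ?q k t) = (norm (mlt (m t) (x t0) - mlt (m t0) (x t0)))\<^sup>2" for t
    by (simp add: norm_l2_square m algebra_simps)
  ultimately have "((\<lambda>t. (norm (mlt (m t) (x t0) - mlt (m t0) (x t0)))\<^sup>2) \<longlongrightarrow> 0) (at t0 within S)"
    by simp
  then have "((\<lambda>t. sqrt ((norm (mlt (m t) (x t0) - mlt (m t0) (x t0)))\<^sup>2)) \<longlongrightarrow> sqrt 0) (at t0 within S)"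
    by (rule tendsto_real_sqrt)
  then have B: "((\<lambda>t. mlt (m t) (x t0) - mlt (m t0) (x t0)) \<longlongrightarrow> 0) (at t0 within S)"
    by (simp add: tendsto_norm_zero_iff)
  have C: "((\<lambda>t. mlt (m t) (x t - x t0)) \<longlongrightarrow> 0) (at t0 within S)"
    by (rule Lim_null_comparison[OF _ tendsto_norm_zero[OF A]])
       (auto intro!: always_eventually norm_mlt_le m)
  have "((\<lambda>t. mlt (m t) (x t - x t0) + (mlt (m t) (x t0) - mlt (m t0) (x t0)) + mlt (m t0) (x t0))
          \<longlongrightarrow> 0 + 0 + mlt (m t0) (x t0)) (at t0 within S)"
    by (intro tendsto_add B C tendsto_const)
  then show "((\<lambda>t. mlt (m t) (x t)) \<longlongrightarrow> mlt (m t0) (x t0)) (at t0 within S)"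
    by (simp add: mlt_diff m)
qed

section \<open>The surface measure of the sphere\<close>

abbreviation radial :: "real^3 \<Rightarrow> real^3" where
  "radial \<equiv> \<lambda>x. x /\<^sub>R norm x"

lemma sets_sphere_measure [measurable_cong, simp]: "sets sphere_measure = sets borel"
  by (simp add: sphere_measure_def)

lemma space_sphere_measure [simp]: "space sphere_measure = UNIV"
  by (simp add: sphere_measure_def)

lemma radial_measurable [measurable]: "radial \<in> borel_measurable borel"
  by measurable

lemma emeasure_sphere_measure:
  assumes A: "A \<in> sets borel"
  shows "emeasure sphere_measure A = 3 * emeasure lborel (ball 0 1 \<inter> radial -` A)"
proof -
  have m: "radial -` A \<in> sets borel"
    using measurable_sets[OF radial_measurable A] by simp
  have "emeasure sphere_measure A =
      emeasure (density lborel (\<lambda>x. ennreal (3 * indicator (ball (0::real^3) 1) x))) (radial -` A)"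
    unfolding sphere_measure_def using A by (subst emeasure_distr) auto
  also have "\<dots> = (\<integral>\<^sup>+x. ennreal (3 * indicator (ball (0::real^3) 1) x) * indicator (radial -` A) x \<partial>lborel)"
    using m by (subst emeasure_density)
      (auto intro!: measurable_compose[OF _ measurable_ennreal] borel_measurable_times borel_measurable_indicator)
  also have "\<dots> = (\<integral>\<^sup>+x. 3 * indicator (ball 0 1 \<inter> radial -` A) x \<partial>lborel)"
    by (intro nn_integral_cong) (auto simp: indicator_def)
  also have "\<dots> = 3 * emeasure lborel (ball 0 1 \<inter> radial -` A)"
    using m by (subst nn_integral_cmult_indicator) auto
  finally show ?thesis .
qed

lemma emeasure_sphere_measure_UNIV: "emeasure sphere_measure UNIV = ennreal (4 * pi)"
proof -
  have "emeasure lborel (ball (0::real^3) 1) = ennreal (4 / 3 * pi)"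
    by (subst emeasure_ball) (simp_all add: unit_ball_vol_3)
  moreover have "(3::ennreal) * ennreal (4 / 3 * pi) = ennreal (4 * pi)"
    by (subst ennreal_numeral[symmetric], subst ennreal_mult[symmetric]) auto
  ultimately show ?thesis by (simp add: emeasure_sphere_measure)
qed

interpretation sphere: finite_measure sphere_measure
  by standard (simp add: emeasure_sphere_measure_UNIV)

lemma measure_sphere_measure_UNIV: "measure sphere_measure UNIV = 4 * pi"
  by (simp add: measure_def emeasure_sphere_measure_UNIV)

lemma AE_sphere: "AE x in sphere_measure. norm x = 1"
proof (rule AE_I[where N = "{x. norm x \<noteq> 1}"])
  have m: "{x :: real^3. norm x \<noteq> 1} \<in> sets borel" by measurable
  then show "{x. norm x \<noteq> 1} \<in> sets sphere_measure" by simp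
  \<comment> \<open>The projection sends \<open>0\<close> to \<open>0\<close>, because
    \<open>inverse 0 = 0\<close>; no other point of the ball lands off the sphere.\<close>
  have "ball 0 1 \<inter> radial -` {x. norm x \<noteq> 1} \<subseteq> {0}" by (auto simp: field_simps)
  then have "emeasure lborel (ball 0 1 \<inter> radial -` {x. norm x \<noteq> 1}) \<le> emeasure lborel {0::real^3}"
    by (intro emeasure_mono) auto
  then show "emeasure sphere_measure {x. norm x \<noteq> 1} = 0"
    by (simp add: emeasure_sphere_measure[OF m])
qed auto

lemma AE_sphere_sum: "AE x in sphere_measure. (\<Sum>k\<in>UNIV. x $ k * x $ k) = 1"
  using AE_sphere by eventually_elim (metis inner_vec_def inner_real_def norm_eq_1 sum.cong)

text \<open>The radial projection commutes with \<open>Q\<close>, so the preimage of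
  \<open>A\<close> under \<open>Q\<close> corresponds to a rotated copy of the cone over
  \<open>A\<close>, and Lebesgue measure is invariant under orthogonal maps.\<close>

lemma distr_sphere_measure_orthogonal:
  assumes Q: "orthogonal_transformation Q"
  shows "distr sphere_measure sphere_measure Q = sphere_measure"
proof (rule measure_eqI)
  have Qm [measurable]: "Q \<in> borel_measurable borel"
    using Q by (intro borel_measurable_continuous_onI linear_continuous_on)
      (simp add: orthogonal_transformation_linear linear_conv_bounded_linear[symmetric])
  have Q': "orthogonal_transformation (inv Q)" using Q by (rule orthogonal_transformation_inv)
  have bij: "bij Q" using Q by (rule orthogonal_transformation_bij)
  show "sets (distr sphere_measure sphere_measure Q) = sets sphere_measure" by simp
  fix A assume "A \<in> sets (distr sphere_measure sphere_measure Q)"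
  then have A: "A \<in> sets borel" by simp
  have QA: "Q -` A \<in> sets borel" using measurable_sets[OF Qm A] by simp
  define B where "B = ball 0 1 \<inter> radial -` A"
  have B: "B \<in> sets borel" unfolding B_def
    using measurable_sets[OF radial_measurable A] by (intro sets.Int) auto
  have Bl: "B \<in> lmeasurable"
    by (rule bounded_set_imp_lmeasurable) (use B in \<open>auto simp: B_def intro: bounded_Int\<close>)
  have eq: "ball 0 1 \<inter> radial -` (Q -` A) = inv Q ` B"
  proof -
    have "inv Q ` B = Q -` B" using bij by (simp add: bij_vimage_eq_inv_image)
    also have "\<dots> = ball 0 1 \<inter> radial -` (Q -` A)"
      using Q orthogonal_transformation_linear[OF Q]
      by (auto simp: B_def orthogonal_transformation_norm linear_scale)
    finally show ?thesis ..
  qed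
  have Bi: "inv Q ` B \<in> lmeasurable" by (rule measurable_orthogonal_image[OF Q' Bl])
  have bb: "inv Q ` B \<in> sets borel" unfolding eq[symmetric]
    using measurable_sets[OF radial_measurable QA] by (intro sets.Int) auto
  have "emeasure lborel (inv Q ` B) = emeasure lebesgue (inv Q ` B)" using bb by simp
  also have "\<dots> = ennreal (measure lebesgue (inv Q ` B))"
    by (rule emeasure_eq_measure2[OF Bi])
  also have "\<dots> = ennreal (measure lebesgue B)" by (simp only: measure_orthogonal_image[OF Q' Bl])
  also have "\<dots> = emeasure lebesgue B" by (rule emeasure_eq_measure2[OF Bl, symmetric])
  also have "\<dots> = emeasure lborel B" using B by simp
  finally have "emeasure lborel (inv Q ` B) = emeasure lborel B" .
  then show "emeasure (distr sphere_measure sphere_measure Q) A = emeasure sphere_measure A"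
    using A QA by (subst emeasure_distr) (auto simp: emeasure_sphere_measure eq B_def)
qed

lemma integral_sphere_orthogonal:
  fixes f :: "real^3 \<Rightarrow> real"
  assumes Q: "orthogonal_transformation Q" and f: "f \<in> borel_measurable borel"
  shows "(\<integral>x. f (Q x) \<partial>sphere_measure) = (\<integral>x. f x \<partial>sphere_measure)"
proof -
  have Qm [measurable]: "Q \<in> borel_measurable borel"
    using Q by (intro borel_measurable_continuous_onI linear_continuous_on)
      (simp add: orthogonal_transformation_linear linear_conv_bounded_linear[symmetric])
  have "(\<integral>x. f x \<partial>sphere_measure) = (\<integral>x. f x \<partial>distr sphere_measure sphere_measure Q)"
    by (simp add: distr_sphere_measure_orthogonal[OF Q])
  also have "\<dots> = (\<integral>x. f (Q x) \<partial>sphere_measure)"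
    by (rule integral_distr) (use f in measurable)
  finally show ?thesis ..
qed

text \<open>Composed with the radial projection, \<open>r\<close> is continuous on the punctured
  ball, so a non-zero value at \<open>x0\<close> persists on an open set around x0 / 2, which has
  positive volume. This turns almost everywhere identities between polynomials into pointwise ones
  on the sphere.\<close>

lemma AE_sphere_zero_imp:
  fixes r :: "real^3 \<Rightarrow> real"
  assumes c: "continuous_on UNIV r" and ae: "AE x in sphere_measure. r x = 0" and x0: "norm x0 = 1"
  shows "r x0 = 0"
proof (rule ccontr)
  assume n: "r x0 \<noteq> 0"
  define U where "U = (ball 0 1 - {0}) \<inter> (\<lambda>x. r (radial x)) -` (- {0})"
  have "open U" unfolding U_def
  proof (rule continuous_open_preimage)
    show "continuous_on (ball 0 1 - {0}) (\<lambda>x. r (radial x))"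
      by (rule continuous_on_compose2[OF c]) (auto intro!: continuous_intros)
  qed auto
  have cb [measurable]: "r \<in> borel_measurable borel" using c by (rule borel_measurable_continuous_onI)
  have m: "{x. r x \<noteq> 0} \<in> sets borel" by measurable
  have "emeasure sphere_measure {x. r x \<noteq> 0} = 0"
    using ae by (subst (asm) AE_iff_measurable[where N = "{x. r x \<noteq> 0}"]) (use m in auto)
  then have "emeasure lborel (ball 0 1 \<inter> radial -` {x. r x \<noteq> 0}) = 0"
    by (simp add: emeasure_sphere_measure[OF m])
  moreover have "U \<subseteq> ball 0 1 \<inter> radial -` {x. r x \<noteq> 0}" by (auto simp: U_def)
  moreover have "ball 0 1 \<inter> radial -` {x. r x \<noteq> 0} \<in> sets borel"
    using measurable_sets[OF radial_measurable m] by (intro sets.Int) auto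
  ultimately have "emeasure lborel U \<le> 0"
    using emeasure_mono[of U "ball 0 1 \<inter> radial -` {x. r x \<noteq> 0}" lborel] by simp
  then have "emeasure lborel U = 0" by simp
  then have "negligible U"
    using \<open>open U\<close> by (simp add: negligible_iff_null_sets null_sets_completionI null_sets_def)
  moreover have "(1/2) *\<^sub>R x0 \<in> U" using n x0 by (auto simp: U_def)
  ultimately show False using open_not_negligible[OF \<open>open U\<close>] by auto
qed

lemma measurable_sphere_continuous:
  fixes f :: "real^3 \<Rightarrow> real"
  shows "continuous_on UNIV f \<Longrightarrow> f \<in> borel_measurable sphere_measure"
  by (subst measurable_cong_sets[OF sets_sphere_measure refl]) (rule borel_measurable_continuous_onI)

lemma continuous_bounded_sphere:
  fixes f :: "real^3 \<Rightarrow> 'b::real_normed_vector"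
  assumes "continuous_on UNIV f"
  obtains B where "B \<ge> 0" "\<And>x. norm x = 1 \<Longrightarrow> norm (f x) \<le> B"
proof -
  have "compact (f ` sphere 0 1)"
    by (intro compact_continuous_image continuous_on_subset[OF assms]) auto
  then obtain B where "B > 0" "\<forall>y\<in>f ` sphere 0 1. norm y \<le> B"
    using compact_imp_bounded bounded_pos by blast
  then show ?thesis using that[of B] by auto
qed

lemma integrable_sphere_continuous:
  fixes f :: "real^3 \<Rightarrow> real"
  assumes c: "continuous_on UNIV f"
  shows "integrable sphere_measure f"
proof -
  obtain B where B: "\<And>x. norm x = 1 \<Longrightarrow> norm (f x) \<le> B"
    using continuous_bounded_sphere[OF c] by metis
  show ?thesis
  proof (rule sphere.integrable_const_bound)
    show "AE x in sphere_measure. norm (f x) \<le> B" using AE_sphere by eventually_elim (rule B)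
    show "f \<in> borel_measurable sphere_measure" using c by (rule measurable_sphere_continuous)
  qed
qed

text \<open>Invariance of the measure under the rotation by the angle \<open>\<theta>\<close> in the coordinate plane
  \<open>(i, j)\<close>, differentiated at \<open>\<theta> = 0\<close>.\<close>

lemma integral_rotation_field_zero:
  fixes \<psi> :: "real^3 \<Rightarrow> real"
  assumes gc: "continuous_on UNIV g"
    and g: "\<And>x. (\<psi> has_derivative (\<lambda>h. g x \<bullet> h)) (at x)" and ij: "i \<noteq> j"
  shows "(\<integral>x. x $ i * g x $ j - x $ j * g x $ i \<partial>sphere_measure) = 0"
proof -
  \<comment> \<open>Written as the identity plus a correction in the plane (i, j), which makes
    linearity, the derivative in t and the value at t = 0 immediate.\<close>
  define rot :: "real \<Rightarrow> real^3 \<Rightarrow> real^3" where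
    "rot = (\<lambda>t x. x + ((cos t - 1) * x $ i - sin t * x $ j) *\<^sub>R axis i 1
                     + (sin t * x $ i + (cos t - 1) * x $ j) *\<^sub>R axis j 1)"
  have lin: "linear (rot t)" for t
    by (rule linearI) (auto simp: rot_def vec_eq_iff algebra_simps)
  have nrm: "rot t x \<bullet> rot t x = x \<bullet> x" for t x
  proof -
    have aa: "axis i (1::real) \<bullet> axis i (1::real) = 1" "axis j (1::real) \<bullet> axis j (1::real) = 1"
      "axis i (1::real) \<bullet> axis j (1::real) = 0" "axis j (1::real) \<bullet> axis i (1::real) = 0"
      using ij by (auto simp: inner_axis_axis)
    define a b where "a = (cos t - 1) * x $ i - sin t * x $ j" and "b = sin t * x $ i + (cos t - 1) * x $ j"
    have "rot t x \<bullet> rot t x = x \<bullet> x + 2 * a * x $ i + 2 * b * x $ j + a\<^sup>2 + b\<^sup>2"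
      unfolding rot_def a_def[symmetric] b_def[symmetric]
      by (simp add: inner_add_left inner_add_right aa inner_axis inner_axis' power2_eq_square)
        (use ij in \<open>simp add: axis_def algebra_simps\<close>)
    also have "2 * a * x $ i + 2 * b * x $ j + a\<^sup>2 + b\<^sup>2
       = ((sin t)\<^sup>2 + (cos t)\<^sup>2 - 1) * ((x $ i)\<^sup>2 + (x $ j)\<^sup>2)"
      unfolding a_def b_def by algebra
    then have "x \<bullet> x + 2 * a * x $ i + 2 * b * x $ j + a\<^sup>2 + b\<^sup>2 = x \<bullet> x" by simp
    finally show ?thesis .
  qed
  have orth: "orthogonal_transformation (rot t)" for t
    using lin nrm by (auto simp: orthogonal_transformation norm_eq_sqrt_inner)
  have nr: "norm (rot t x) = norm x" for t x using nrm by (simp add: norm_eq_sqrt_inner)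
  define D where "D = (\<lambda>t x. (- sin t * x $ i - cos t * x $ j) * g (rot t x) $ i
                           + (cos t * x $ i - sin t * x $ j) * g (rot t x) $ j)"
  have der: "((\<lambda>t. \<psi> (rot t x)) has_real_derivative D t x) (at t)" for t x
  proof -
    have "((\<lambda>t. rot t x) has_derivative
            (\<lambda>h. ((- sin t * x $ i - cos t * x $ j) * h) *\<^sub>R axis i 1
               + ((cos t * x $ i - sin t * x $ j) * h) *\<^sub>R axis j 1)) (at t)"
      unfolding rot_def by (auto intro!: derivative_eq_intros simp: algebra_simps)
    from has_derivative_compose[OF this g]
    show ?thesis unfolding has_field_derivative_def
      by (rule has_derivative_eq_rhs) (auto simp: D_def inner_add_right inner_axis algebra_simps)
  qed
  have pc: "continuous_on UNIV \<psi>"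
    by (intro continuous_at_imp_continuous_on ballI has_derivative_continuous[OF g])
  obtain B where B: "B \<ge> 0" "\<And>x. norm x = 1 \<Longrightarrow> norm (g x) \<le> B"
    using continuous_bounded_sphere[OF gc] by metis
  have Db: "\<bar>D t x\<bar> \<le> 4 * B" if x: "norm x = 1" for t x
  proof -
    have gb: "\<bar>g (rot t x) $ k\<bar> \<le> B" for k
      using component_le_norm_cart[of "g (rot t x)" k] B(2)[of "rot t x"] x nr[of t x] by simp
    have xb: "\<bar>x $ k\<bar> \<le> 1" for k using component_le_norm_cart[of x k] x by simp
    have sc: "\<bar>sin t * x $ k\<bar> \<le> 1" "\<bar>cos t * x $ k\<bar> \<le> 1" for k
      using mult_mono[OF abs_sin_le_one[of t] xb[of k]] mult_mono[OF abs_cos_le_one[of t] xb[of k]]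
      by (auto simp: abs_mult)
    have "\<bar>- sin t * x $ i - cos t * x $ j\<bar> \<le> 2" "\<bar>cos t * x $ i - sin t * x $ j\<bar> \<le> 2"
      using sc[of i] sc[of j] by auto
    then have "\<bar>(- sin t * x $ i - cos t * x $ j) * g (rot t x) $ i\<bar> \<le> 2 * B"
      "\<bar>(cos t * x $ i - sin t * x $ j) * g (rot t x) $ j\<bar> \<le> 2 * B"
      using gb by (auto simp: abs_mult intro!: mult_mono)
    then show ?thesis unfolding D_def by linarith
  qed
  \<comment> \<open>Difference quotients of \<psi> along the rotation. Each has integral zero by
    invariance, and the mean value theorem identifies it with a value of \<open>D\<close>, so
    \<open>4 * B\<close> dominates all of them.\<close>
  define F where "F = (\<lambda>n x. (\<psi> (rot (1 / real (Suc n)) x) - \<psi> x) / (1 / real (Suc n)))"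
  have rotc: "continuous_on UNIV (rot t)" for t
    using lin by (intro linear_continuous_on) (simp add: linear_conv_bounded_linear[symmetric])
  have prc: "continuous_on UNIV (\<lambda>x. \<psi> (rot t x))" for t
    by (rule continuous_on_compose2[OF pc rotc]) auto
  have F0: "(\<integral>x. F n x \<partial>sphere_measure) = 0" for n
  proof -
    have "(\<integral>x. \<psi> (rot (1 / real (Suc n)) x) - \<psi> x \<partial>sphere_measure) = 0"
      using integral_sphere_orthogonal[OF orth borel_measurable_continuous_onI[OF pc]]
      by (subst Bochner_Integration.integral_diff)
         (auto intro!: integrable_sphere_continuous prc pc)
    then show ?thesis unfolding F_def by (subst integral_divide_zero) simp
  qed
  have "(\<lambda>n. \<integral>x. F n x \<partial>sphere_measure) \<longlonglongrightarrow> (\<integral>x. D 0 x \<partial>sphere_measure)"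
  proof (rule integral_dominated_convergence[where w = "\<lambda>_. 4 * B"])
    have "continuous_on UNIV (D 0)"
    proof -
      have "continuous_on UNIV (\<lambda>x. g (rot 0 x))" by (rule continuous_on_compose2[OF gc rotc]) auto
      then show ?thesis unfolding D_def by (intro continuous_intros)
    qed
    then show "D 0 \<in> borel_measurable sphere_measure"
      by (rule measurable_sphere_continuous)
    show "F n \<in> borel_measurable sphere_measure" for n
    proof -
      have "continuous_on UNIV (F n)" unfolding F_def by (intro continuous_intros prc pc) auto
      then show ?thesis by (rule measurable_sphere_continuous)
    qed
    show "integrable sphere_measure (\<lambda>_. 4 * B)" by simp
    show "AE x in sphere_measure. (\<lambda>n. F n x) \<longlonglongrightarrow> D 0 x"
    proof (rule AE_I2)
      fix x
      have r0: "rot 0 x = x" by (simp add: rot_def)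
      have "((\<lambda>h. (\<psi> (rot (0 + h) x) - \<psi> (rot 0 x)) / h) \<longlongrightarrow> D 0 x) (at 0)"
        using der[of x 0] by (simp add: DERIV_def)
      then have "((\<lambda>h. (\<psi> (rot h x) - \<psi> x) / h) \<longlongrightarrow> D 0 x) (at 0)" by (simp add: r0)
      then have "(\<lambda>n. (\<psi> (rot (1 / real (Suc n)) x) - \<psi> x) / (1 / real (Suc n))) \<longlonglongrightarrow> D 0 x"
        by (rule LIMSEQ_SEQ_conv[THEN iffD2, rule_format]) (use LIMSEQ_inverse_real_of_nat in \<open>auto simp: inverse_eq_divide\<close>)
      then show "(\<lambda>n. F n x) \<longlonglongrightarrow> D 0 x" by (simp add: F_def)
    qed
    show "AE x in sphere_measure. norm (F n x) \<le> 4 * B" for n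
      using AE_sphere
    proof eventually_elim
      case (elim x)
      have "\<exists>z. 0 < z \<and> z < 1 / real (Suc n) \<and>
         \<psi> (rot (1 / real (Suc n)) x) - \<psi> (rot 0 x) = (1 / real (Suc n) - 0) * D z x"
        by (rule MVT2) (use der in auto)
      then obtain z where "\<psi> (rot (1 / real (Suc n)) x) - \<psi> x = (1 / real (Suc n)) * D z x"
        by (auto simp: rot_def)
      then have "F n x = D z x" by (simp add: F_def field_simps)
      then show ?case using Db[OF elim] by simp
    qed
  qed
  then have "(\<integral>x. D 0 x \<partial>sphere_measure) = 0" by (simp add: F0 LIMSEQ_const_iff)
  then show ?thesis by (simp add: D_def rot_def algebra_simps)
qed

section \<open>Test functions and tangential derivatives\<close>

lemma test_fun_continuous: "test_fun \<phi> \<Longrightarrow> continuous_on UNIV \<phi>"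
  unfolding test_fun_def by (meson continuous_at_imp_continuous_on has_derivative_continuous)

lemma test_fun_differentiable: "test_fun \<phi> \<Longrightarrow> \<phi> differentiable (at x)"
  unfolding test_fun_def differentiable_def by blast

lemma test_fun_const [intro]: "test_fun (\<lambda>_. c)"
  unfolding test_fun_def
proof (rule exI[of _ "\<lambda>_. 0"])
  have "(\<bullet>) (0 :: real^3) = (\<lambda>_. 0)" by auto
  then show "continuous_on UNIV (\<lambda>_ :: real^3. 0 :: real^3) \<and>
      (\<forall>x :: real^3. ((\<lambda>_. c) has_derivative (\<bullet>) 0) (at x))" by simp
qed

lemma test_fun_coord [intro]: "test_fun (\<lambda>x. x $ i)"
  unfolding test_fun_def
  by (rule exI[of _ "\<lambda>_. axis i 1"])
     (auto simp: inner_axis' fun_eq_iff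
       intro!: has_derivative_eq_rhs[OF bounded_linear_imp_has_derivative[OF bounded_linear_vec_nth]])

lemma test_fun_add [intro]: "test_fun f \<Longrightarrow> test_fun g \<Longrightarrow> test_fun (\<lambda>x. f x + g x)"
  unfolding test_fun_def
proof (elim exE conjE)
  fix u v assume *: "continuous_on UNIV u" "\<forall>x. (f has_derivative (\<bullet>) (u x)) (at x)"
    "continuous_on UNIV v" "\<forall>x. (g has_derivative (\<bullet>) (v x)) (at x)"
  show "\<exists>w. continuous_on UNIV w \<and> (\<forall>x. ((\<lambda>x. f x + g x) has_derivative (\<bullet>) (w x)) (at x))"
    using * by (intro exI[of _ "\<lambda>x. u x + v x"])
      (auto intro!: continuous_intros derivative_eq_intros simp: inner_add_left)
qed

lemma test_fun_mult [intro]: "test_fun f \<Longrightarrow> test_fun g \<Longrightarrow> test_fun (\<lambda>x. f x * g x)"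
proof -
  assume fg: "test_fun f" "test_fun g"
  obtain u v where *: "continuous_on UNIV u" "\<And>x. (f has_derivative (\<bullet>) (u x)) (at x)"
    "continuous_on UNIV v" "\<And>x. (g has_derivative (\<bullet>) (v x)) (at x)"
    using fg unfolding test_fun_def by metis
  have "continuous_on UNIV f" "continuous_on UNIV g" using fg by (auto intro: test_fun_continuous)
  then show "test_fun (\<lambda>x. f x * g x)"
    unfolding test_fun_def using * by (intro exI[of _ "\<lambda>x. g x *\<^sub>R u x + f x *\<^sub>R v x"])
      (auto intro!: continuous_intros derivative_eq_intros simp: inner_add_left algebra_simps)
qed

lemma test_fun_sum: "(\<And>i. i \<in> I \<Longrightarrow> test_fun (f i)) \<Longrightarrow> test_fun (\<lambda>x. \<Sum>i\<in>I. f i x)"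
  by (induction I rule: infinite_finite_induct) auto

lemma Dtan_eq:
  assumes "(\<phi> has_derivative (\<lambda>h. g \<bullet> h)) (at x)"
  shows "Dtan \<phi> k x = g $ k - x $ k * (g \<bullet> x)"
  unfolding Dtan_def frechet_derivative_at[OF assms, symmetric] by (simp add: inner_axis)

lemma continuous_on_Dtan:
  assumes "test_fun \<phi>" shows "continuous_on UNIV (Dtan \<phi> k)"
proof -
  obtain g where g: "continuous_on UNIV g" "\<And>x. (\<phi> has_derivative (\<lambda>h. g x \<bullet> h)) (at x)"
    using assms unfolding test_fun_def by blast
  have "Dtan \<phi> k = (\<lambda>x. g x $ k - x $ k * (g x \<bullet> x))" using Dtan_eq[OF g(2)] by auto
  then show ?thesis using g(1) by (auto intro!: continuous_intros)
qed

text \<open>On the sphere the k-th tangential derivative is the sum over j \<noteq> k of x_j times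
  the rotation field x_j \<partial>_k - x_k \<partial>_j. Applying that field to x_j \<psi> instead
  of \<psi> produces the extra term - x_k \<psi>, once for each of the two indices j \<noteq> k;
  this is the factor 2. The summand \<open>?P\<close> is the field applied to x_j \<psi>, with
  integral zero.\<close>

lemma integral_Dtan:
  assumes "test_fun \<psi>"
  shows "(\<integral>x. Dtan \<psi> k x \<partial>sphere_measure) = 2 * (\<integral>x. x $ k * \<psi> x \<partial>sphere_measure)"
proof -
  obtain g where gc: "continuous_on UNIV g" and g: "\<And>x. (\<psi> has_derivative (\<lambda>h. g x \<bullet> h)) (at x)"
    using assms unfolding test_fun_def by blast
  have pc: "continuous_on UNIV \<psi>" using assms by (rule test_fun_continuous)
  let ?P = "\<lambda>j x. x $ j * (x $ j * g x $ k) - x $ k * (x $ j * g x $ j + \<psi> x)"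
  have "(\<integral>x. ?P j x \<partial>sphere_measure) = 0" if j: "j \<noteq> k" for j
  proof -
    define v where "v = (\<lambda>x. x $ j *\<^sub>R g x + \<psi> x *\<^sub>R axis j 1)"
    have vc: "continuous_on UNIV v" unfolding v_def by (intro continuous_intros gc pc)
    have v: "((\<lambda>x. x $ j * \<psi> x) has_derivative (\<lambda>h. v x \<bullet> h)) (at x)" for x
      unfolding v_def
      by (auto intro!: derivative_eq_intros g bounded_linear_imp_has_derivative bounded_linear_vec_nth
           simp: inner_add_left inner_axis' algebra_simps)
    from integral_rotation_field_zero[OF vc v j] show ?thesis
      using j by (simp add: v_def axis_def algebra_simps)
  qed
  then have "0 = (\<Sum>j\<in>UNIV - {k}. \<integral>x. ?P j x \<partial>sphere_measure)" by simp
  also have "\<dots> = (\<integral>x. (\<Sum>j\<in>UNIV - {k}. ?P j x) \<partial>sphere_measure)"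
    by (rule Bochner_Integration.integral_sum[symmetric])
       (intro integrable_sphere_continuous continuous_intros gc pc)
  also have "\<dots> = (\<integral>x. Dtan \<psi> k x - 2 * (x $ k * \<psi> x) \<partial>sphere_measure)"
  proof (rule integral_cong_AE)
    have "continuous_on UNIV (\<lambda>x. \<Sum>j\<in>UNIV - {k}. ?P j x)"
      by (intro continuous_intros gc pc)
    then show "(\<lambda>x. \<Sum>j\<in>UNIV - {k}. ?P j x) \<in> borel_measurable sphere_measure"
      by (rule measurable_sphere_continuous)
    have "continuous_on UNIV (\<lambda>x. Dtan \<psi> k x - 2 * (x $ k * \<psi> x))"
      by (intro continuous_intros pc continuous_on_Dtan assms)
    then show "(\<lambda>x. Dtan \<psi> k x - 2 * (x $ k * \<psi> x)) \<in> borel_measurable sphere_measure"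
      by (rule measurable_sphere_continuous)
    show "AE x in sphere_measure. (\<Sum>j\<in>UNIV - {k}. ?P j x) = Dtan \<psi> k x - 2 * (x $ k * \<psi> x)"
      using AE_sphere_sum
    proof eventually_elim
      case (elim x)
      have c: "card (UNIV - {k}) = 2" by (simp add: card_Diff_singleton)
      have s1: "(\<Sum>j\<in>UNIV - {k}. x $ j * x $ j) = 1 - x $ k * x $ k"
        using elim by (simp add: sum_diff1)
      have s2: "(\<Sum>j\<in>UNIV - {k}. x $ j * g x $ j) = g x \<bullet> x - x $ k * g x $ k"
        by (simp add: sum_diff1 inner_vec_def mult.commute)
      have "(\<Sum>j\<in>UNIV - {k}. ?P j x) = (\<Sum>j\<in>UNIV - {k}. x $ j * x $ j) * g x $ k
              - x $ k * (\<Sum>j\<in>UNIV - {k}. x $ j * g x $ j) - 2 * (x $ k * \<psi> x)"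
        by (simp add: sum_subtractf sum.distrib sum_distrib_left sum_distrib_right algebra_simps c)
      then show ?case unfolding s1 s2 Dtan_eq[OF g] by (simp add: algebra_simps)
    qed
  qed
  also have "\<dots> = (\<integral>x. Dtan \<psi> k x \<partial>sphere_measure) - 2 * (\<integral>x. x $ k * \<psi> x \<partial>sphere_measure)"
    by (subst Bochner_Integration.integral_diff)
       (auto intro!: integrable_sphere_continuous continuous_intros pc continuous_on_Dtan assms)
  finally show ?thesis by simp
qed

lemma
  assumes "test_fun f" "test_fun g"
  shows Dtan_add: "Dtan (\<lambda>x. f x + g x) k x = Dtan f k x + Dtan g k x"
    and Dtan_mult: "Dtan (\<lambda>x. f x * g x) k x = Dtan f k x * g x + f x * Dtan g k x"
proof -
  obtain u v where u: "\<And>x. (f has_derivative (\<lambda>h. u x \<bullet> h)) (at x)"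
    and v: "\<And>x. (g has_derivative (\<lambda>h. v x \<bullet> h)) (at x)"
    using assms unfolding test_fun_def by metis
  have s: "((\<lambda>x. f x + g x) has_derivative (\<lambda>h. (u x + v x) \<bullet> h)) (at x)"
    by (auto intro!: derivative_eq_intros u v simp: inner_add_left)
  have p: "((\<lambda>x. f x * g x) has_derivative (\<lambda>h. (g x *\<^sub>R u x + f x *\<^sub>R v x) \<bullet> h)) (at x)"
    by (auto intro!: derivative_eq_intros u v simp: inner_add_left algebra_simps)
  show "Dtan (\<lambda>x. f x + g x) k x = Dtan f k x + Dtan g k x"
    unfolding Dtan_eq[OF s] Dtan_eq[OF u] Dtan_eq[OF v] by (simp add: inner_add_left algebra_simps)
  show "Dtan (\<lambda>x. f x * g x) k x = Dtan f k x * g x + f x * Dtan g k x"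
    unfolding Dtan_eq[OF p] Dtan_eq[OF u] Dtan_eq[OF v] by (simp add: inner_add_left algebra_simps)
qed

lemma Dtan_const [simp]: "Dtan (\<lambda>_. c) k x = 0"
  by (simp add: Dtan_def)

lemma Dtan_cmult: "test_fun f \<Longrightarrow> Dtan (\<lambda>x. c * f x) k x = c * Dtan f k x"
  by (subst Dtan_mult) auto

lemma Dtan_sum:
  "(\<And>i. i \<in> I \<Longrightarrow> test_fun (f i)) \<Longrightarrow> Dtan (\<lambda>x. \<Sum>i\<in>I. f i x) k x = (\<Sum>i\<in>I. Dtan (f i) k x)"
  by (induction I rule: infinite_finite_induct) (auto simp: Dtan_add test_fun_sum)

lemma Dtan_coord: "Dtan (\<lambda>x. x $ i) k x = (if i = k then 1 else 0) - x $ k * x $ i"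
proof -
  have "((\<lambda>x. x $ i) has_derivative (\<lambda>h. axis i 1 \<bullet> h)) (at x)"
    by (auto simp: inner_axis' intro!: bounded_linear_imp_has_derivative bounded_linear_vec_nth)
  from Dtan_eq[OF this] show ?thesis by (simp add: inner_axis', simp add: axis_def)
qed

lemma Dtan_radial_zero:
  assumes "test_fun f" "norm x = 1"
  shows "(\<Sum>k\<in>UNIV. x $ k * Dtan f k x) = 0"
proof -
  obtain g where g: "\<And>x. (f has_derivative (\<lambda>h. g x \<bullet> h)) (at x)"
    using assms unfolding test_fun_def by blast
  have s: "(\<Sum>k\<in>UNIV. x $ k * x $ k) = 1"
    using assms(2) by (simp add: norm_eq_1 inner_vec_def)
  have "(\<Sum>k\<in>UNIV. x $ k * Dtan f k x) = g x \<bullet> x - (\<Sum>k\<in>UNIV. x $ k * x $ k) * (g x \<bullet> x)"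
    unfolding Dtan_eq[OF g]
    unfolding right_diff_distrib sum_subtractf sum_distrib_right mult.assoc[symmetric]
    by (simp add: inner_vec_def mult.commute)
  then show ?thesis by (simp add: s)
qed

section \<open>Square-integrable functions and polynomials on the sphere\<close>

lemma L2S_mult_integrable:
  assumes f: "L2S f" and g: "L2S g" shows "integrable sphere_measure (\<lambda>x. f x * g x)"
proof (rule Bochner_Integration.integrable_bound)
  show "integrable sphere_measure (\<lambda>x. (f x)\<^sup>2 + (g x)\<^sup>2)"
    using f g by (intro Bochner_Integration.integrable_add) (auto simp: L2S_def)
  show "(\<lambda>x. f x * g x) \<in> borel_measurable sphere_measure"
    using f g by (intro borel_measurable_times) (auto simp: L2S_def)
  have "\<bar>f x * g x\<bar> \<le> (f x)\<^sup>2 + (g x)\<^sup>2" for x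
  proof -
    have "2 * (\<bar>f x\<bar> * \<bar>g x\<bar>) \<le> (f x)\<^sup>2 + (g x)\<^sup>2"
      using sum_squares_bound[of "\<bar>f x\<bar>" "\<bar>g x\<bar>"] by simp
    moreover have "0 \<le> \<bar>f x\<bar> * \<bar>g x\<bar>" by simp
    ultimately show ?thesis unfolding abs_mult by linarith
  qed
  then show "AE x in sphere_measure. norm (f x * g x) \<le> norm ((f x)\<^sup>2 + (g x)\<^sup>2)" by auto
qed

lemma L2S_measurable: "L2S f \<Longrightarrow> f \<in> borel_measurable sphere_measure"
  by (simp add: L2S_def)

lemma L2S_continuous: "continuous_on UNIV f \<Longrightarrow> L2S f"
  unfolding L2S_def
  by (auto intro!: measurable_sphere_continuous integrable_sphere_continuous continuous_intros)

lemma L2S_const: "L2S (\<lambda>_. c)"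
  by (rule L2S_continuous) simp

lemma L2S_add: assumes f: "L2S f" and g: "L2S g" shows "L2S (\<lambda>x. f x + g x)"
  unfolding L2S_def
proof
  show "(\<lambda>x. f x + g x) \<in> borel_measurable sphere_measure"
    using f g by (intro borel_measurable_add) (auto simp: L2S_def)
  have "integrable sphere_measure (\<lambda>x. (f x)\<^sup>2 + (g x)\<^sup>2 + 2 * (f x * g x))"
    using f g L2S_mult_integrable[OF f g]
    by (intro Bochner_Integration.integrable_add integrable_mult_right) (auto simp: L2S_def)
  then show "integrable sphere_measure (\<lambda>x. (f x + g x)\<^sup>2)"
    by (simp add: power2_sum algebra_simps)
qed

lemma L2S_mult_bounded:
  assumes f: "L2S f" and h: "h \<in> borel_measurable sphere_measure"
    and B: "AE x in sphere_measure. \<bar>h x\<bar> \<le> B"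
  shows "L2S (\<lambda>x. h x * f x)"
  unfolding L2S_def
proof
  show m: "(\<lambda>x. h x * f x) \<in> borel_measurable sphere_measure"
    using f h by (intro borel_measurable_times) (auto simp: L2S_def)
  show "integrable sphere_measure (\<lambda>x. (h x * f x)\<^sup>2)"
  proof (rule Bochner_Integration.integrable_bound)
    show "integrable sphere_measure (\<lambda>x. B\<^sup>2 * (f x)\<^sup>2)" using f by (simp add: L2S_def)
    show "(\<lambda>x. (h x * f x)\<^sup>2) \<in> borel_measurable sphere_measure"
      using m by (rule borel_measurable_power)
    show "AE x in sphere_measure. norm ((h x * f x)\<^sup>2) \<le> norm (B\<^sup>2 * (f x)\<^sup>2)"
      using B
    proof eventually_elim
      case (elim x)
      then have "(h x)\<^sup>2 \<le> B\<^sup>2" using abs_le_square_iff[of "h x" B] by simp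
      then show ?case by (simp add: power_mult_distrib mult_right_mono)
    qed
  qed
qed

lemma L2S_cmult: "L2S f \<Longrightarrow> L2S (\<lambda>x. c * f x)"
  by (rule L2S_mult_bounded[where B = "\<bar>c\<bar>"]) auto

lemma L2S_mult_continuous:
  assumes f: "L2S f" and h: "continuous_on UNIV h" shows "L2S (\<lambda>x. h x * f x)"
proof -
  obtain B where B: "\<And>x. norm x = 1 \<Longrightarrow> norm (h x) \<le> B"
    using continuous_bounded_sphere[OF h] by metis
  show ?thesis
  proof (rule L2S_mult_bounded[OF f measurable_sphere_continuous[OF h], of B])
    show "AE x in sphere_measure. \<bar>h x\<bar> \<le> B" using AE_sphere by eventually_elim (use B in auto)
  qed
qed

lemma L2S_diff: "L2S f \<Longrightarrow> L2S g \<Longrightarrow> L2S (\<lambda>x. f x - g x)"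
  using L2S_add[of f "\<lambda>x. (-1) * g x"] L2S_cmult[of g "-1"] by simp

lemma L2S_sum: "(\<And>i. i \<in> I \<Longrightarrow> L2S (f i)) \<Longrightarrow> L2S (\<lambda>x. \<Sum>i\<in>I. f i x)"
  by (induction I rule: infinite_finite_induct) (auto intro: L2S_add L2S_const)

lemma L2S_integrable: "L2S f \<Longrightarrow> integrable sphere_measure f"
  using L2S_mult_integrable[OF L2S_const[of 1], of f] by simp

lemma ipS_commute: "ipS f g = ipS g f"
  by (simp add: ipS_def mult.commute)

lemma ipS_add_left: "L2S f \<Longrightarrow> L2S g \<Longrightarrow> L2S h \<Longrightarrow> ipS (\<lambda>x. f x + g x) h = ipS f h + ipS g h"
  by (simp add: ipS_def distrib_right L2S_mult_integrable)

lemma ipS_cmult_left: "ipS (\<lambda>x. c * f x) h = c * ipS f h"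
  by (simp add: ipS_def mult.assoc)

lemma ipS_diff_left: "L2S f \<Longrightarrow> L2S g \<Longrightarrow> L2S h \<Longrightarrow> ipS (\<lambda>x. f x - g x) h = ipS f h - ipS g h"
  by (simp add: ipS_def left_diff_distrib L2S_mult_integrable)

lemma ipS_sum_left:
  "(\<And>i. i \<in> I \<Longrightarrow> L2S (f i)) \<Longrightarrow> L2S h \<Longrightarrow> ipS (\<lambda>x. \<Sum>i\<in>I. f i x) h = (\<Sum>i\<in>I. ipS (f i) h)"
  by (simp add: ipS_def sum_distrib_right L2S_mult_integrable)

lemma ipS_cmult_right: "ipS h (\<lambda>x. c * f x) = c * ipS h f"
  by (simp add: ipS_commute[of h] ipS_cmult_left)

lemma ipS_diff_right: "L2S f \<Longrightarrow> L2S g \<Longrightarrow> L2S h \<Longrightarrow> ipS h (\<lambda>x. f x - g x) = ipS h f - ipS h g"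
  by (simp add: ipS_commute[of h] ipS_diff_left)

lemma ipS_sum_right:
  "(\<And>i. i \<in> I \<Longrightarrow> L2S (f i)) \<Longrightarrow> L2S h \<Longrightarrow> ipS h (\<lambda>x. \<Sum>i\<in>I. f i x) = (\<Sum>i\<in>I. ipS h (f i))"
  by (simp add: ipS_commute[of h] ipS_sum_left)

lemma ipS_self_nonneg: "0 \<le> ipS f f"
  by (simp add: ipS_def)

lemma ipS_self: "ipS f f = (\<integral>x. (f x)\<^sup>2 \<partial>sphere_measure)"
  by (simp add: ipS_def power2_eq_square)

lemma ipS_zero [simp]: "ipS (\<lambda>_. 0) f = 0" "ipS f (\<lambda>_. 0) = 0"
  by (simp_all add: ipS_def)

lemma ipS_cong_AE:
  assumes "L2S f" "L2S g" "L2S h" "AE x in sphere_measure. f x = g x"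
  shows "ipS f h = ipS g h"
  unfolding ipS_def
  using assms by (intro integral_cong_AE) (auto intro!: borel_measurable_times simp: L2S_def)

lemma ipS_self_eq_0_iff: "L2S f \<Longrightarrow> ipS f f = 0 \<longleftrightarrow> (AE x in sphere_measure. f x = 0)"
  unfolding ipS_self by (subst integral_nonneg_eq_0_iff_AE) (auto simp: L2S_def)

text \<open>\<open>n\<close> is a strict bound for the degree. Hence \<open>pol 0\<close> contains
  only zero, the functions of lower degree inside \<open>pol (Suc n)\<close> are
  \<open>pol n\<close> even when n = 0, and on the sphere \<open>pol n\<close> is spanned by n^2
  functions.\<close>

inductive pol :: "nat \<Rightarrow> (real^3 \<Rightarrow> real) \<Rightarrow> bool" where
  pol_zero: "pol n (\<lambda>_. 0)"
| pol_const: "pol (Suc n) (\<lambda>_. c)"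
| pol_coord: "pol n p \<Longrightarrow> pol (Suc n) (\<lambda>x. x $ i * p x)"
| pol_add: "pol n p \<Longrightarrow> pol n q \<Longrightarrow> pol n (\<lambda>x. p x + q x)"

lemma pol_test_fun: "pol n p \<Longrightarrow> test_fun p"
  by (induction rule: pol.induct) auto

lemma pol_continuous: "pol n p \<Longrightarrow> continuous_on UNIV p"
  by (intro test_fun_continuous pol_test_fun)

lemma pol_L2S: "pol n p \<Longrightarrow> L2S p"
  by (intro L2S_continuous pol_continuous)

lemma pol_0D: "pol n p \<Longrightarrow> n = 0 \<Longrightarrow> p = (\<lambda>_. 0)"
  by (induction rule: pol.induct) auto

lemma pol_Suc: "pol n p \<Longrightarrow> pol (Suc n) p"
  by (induction rule: pol.induct) (auto intro: pol.intros)

lemma pol_mono: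
  assumes "pol m p" "m \<le> n" shows "pol n p"
  using assms(2) by (rule dec_induct) (auto intro: assms(1) pol_Suc)

lemma pol_cmult: "pol n p \<Longrightarrow> pol n (\<lambda>x. c * p x)"
proof (induction rule: pol.induct)
  case (pol_coord n p i)
  from pol.pol_coord[OF pol_coord.IH, of i] show ?case by (simp add: mult.left_commute)
qed (auto simp: distrib_left intro: pol.intros)

lemma pol_diff: "pol n p \<Longrightarrow> pol n q \<Longrightarrow> pol n (\<lambda>x. p x - q x)"
  using pol_add[of n p "\<lambda>x. (-1) * q x"] pol_cmult[of n q "-1"] by simp

lemma pol_sum: "(\<And>i. i \<in> I \<Longrightarrow> pol n (f i)) \<Longrightarrow> pol n (\<lambda>x. \<Sum>i\<in>I. f i x)"
  by (induction I rule: infinite_finite_induct) (auto intro: pol.intros)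

lemma pol_mult: "pol m p \<Longrightarrow> pol n q \<Longrightarrow> pol (m + n) (\<lambda>x. p x * q x)"
proof (induction rule: pol.induct)
  case (pol_const k c)
  then show ?case by (auto intro: pol_mono[OF pol_cmult])
next
  case (pol_coord k p i)
  from pol.pol_coord[OF pol_coord.IH[OF pol_coord.prems], of i] show ?case by (simp add: mult.assoc)
qed (auto simp: distrib_right intro: pol.intros)

lemma pol_linear:
  assumes Q: "linear Q" and p: "pol n p" shows "pol n (\<lambda>x. p (Q x))"
  using p
proof (induction rule: pol.induct)
  case (pol_coord n p i)
  have *: "Q x $ i = (\<Sum>j\<in>UNIV. x $ j * Q (axis j 1) $ i)" for x
  proof -
    have "Q x = Q (\<Sum>j\<in>UNIV. x $ j *\<^sub>R axis j 1)" by (simp add: basis_expansion scalar_mult_eq_scaleR[symmetric])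
    also have "\<dots> = (\<Sum>j\<in>UNIV. x $ j *\<^sub>R Q (axis j 1))" by (simp add: linear_sum[OF Q] linear_scale[OF Q])
    finally show ?thesis by simp
  qed
  have "pol (Suc n) (\<lambda>x. \<Sum>j\<in>UNIV. Q (axis j 1) $ i * (x $ j * p (Q x)))"
    by (intro pol_sum pol_cmult pol.pol_coord pol_coord.IH)
  moreover have "(\<lambda>x. Q x $ i * p (Q x)) = (\<lambda>x. \<Sum>j\<in>UNIV. Q (axis j 1) $ i * (x $ j * p (Q x)))"
    by (rule ext, subst *) (simp add: sum_distrib_left sum_distrib_right ac_simps)
  ultimately show ?case by simp
qed (auto intro: pol.intros)

text \<open>The radial correction in \<open>Dtan\<close> raises the degree by one. The count is
  crude, but it shows that \<open>Dtan\<close> maps polynomials to test functions, so that it can be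
  applied twice.\<close>

lemma pol_Dtan: "pol n p \<Longrightarrow> pol (Suc n) (Dtan p k)"
proof (induction rule: pol.induct)
  case (pol_coord n p i)
  have "Dtan (\<lambda>x. x $ i * p x) k = (\<lambda>x. (if i = k then 1 else 0) * p x + (-1) * (x $ k * (x $ i * p x)) + x $ i * Dtan p k x)"
    by (rule ext, subst Dtan_mult) (auto simp: Dtan_coord algebra_simps intro: pol_test_fun[OF pol_coord.hyps])
  moreover have "pol (Suc (Suc n)) \<dots>"
    by (intro pol_add pol.pol_coord pol_coord pol_cmult)
       (rule pol_mono[OF pol_coord.hyps], simp)
  ultimately show ?case by simp
next
  case (pol_add n p q)
  have "Dtan (\<lambda>x. p x + q x) k = (\<lambda>x. Dtan p k x + Dtan q k x)"
    using pol_add.hyps by (intro ext Dtan_add) (auto intro: pol_test_fun)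
  then show ?case using pol_add.IH by (auto intro: pol.pol_add)
next
  case (pol_const n c)
  have "Dtan (\<lambda>_. c) k = (\<lambda>_. 0)" by auto
  then show ?case by (auto intro: pol.intros)
next
  case (pol_zero n)
  have "Dtan (\<lambda>_. 0) k = (\<lambda>_. 0)" by auto
  then show ?case by (auto intro: pol.intros)
qed

section \<open>The Laplacian on polynomials, modulo lower degree\<close>

lemma
  assumes "test_fun f" "test_fun g"
  shows frechet_add: "frechet_derivative (\<lambda>x. f x + g x) (at x) h
      = frechet_derivative f (at x) h + frechet_derivative g (at x) h"
    and frechet_mult: "frechet_derivative (\<lambda>x. f x * g x) (at x) h
      = frechet_derivative f (at x) h * g x + f x * frechet_derivative g (at x) h"
proof -
  have f: "(f has_derivative frechet_derivative f (at x)) (at x)"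
    and g: "(g has_derivative frechet_derivative g (at x)) (at x)"
    using test_fun_differentiable[OF assms(1)] test_fun_differentiable[OF assms(2)]
    by (auto simp: frechet_derivative_works)
  show "frechet_derivative (\<lambda>x. f x + g x) (at x) h
      = frechet_derivative f (at x) h + frechet_derivative g (at x) h"
    unfolding frechet_derivative_at[OF has_derivative_add[OF f g], symmetric] ..
  show "frechet_derivative (\<lambda>x. f x * g x) (at x) h
      = frechet_derivative f (at x) h * g x + f x * frechet_derivative g (at x) h"
    unfolding frechet_derivative_at[OF has_derivative_mult[OF f g], symmetric] by simp
qed

lemma frechet_coord: "frechet_derivative (\<lambda>x::real^3. x $ i) (at x) h = h $ i"
  unfolding frechet_derivative_at[OF bounded_linear_imp_has_derivative[OF bounded_linear_vec_nth], symmetric] ..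

lemma pol_partial: "pol n p \<Longrightarrow> pol (n - 1) (\<lambda>x. frechet_derivative p (at x) (axis k 1))"
proof (induction rule: pol.induct)
  case (pol_coord n p i)
  show ?case
  proof (cases n)
    case 0
    then have "p = (\<lambda>_. 0)" using pol_0D[OF pol_coord.hyps] by simp
    then show ?thesis by (auto intro: pol.intros)
  next
    case (Suc m)
    have "(\<lambda>x. frechet_derivative (\<lambda>x. x $ i * p x) (at x) (axis k 1)) =
       (\<lambda>x. (if i = k then 1 else 0) * p x + x $ i * frechet_derivative p (at x) (axis k 1))"
      by (rule ext, subst frechet_mult)
         (auto simp: frechet_coord axis_def intro: pol_test_fun[OF pol_coord.hyps])
    moreover have "pol (Suc m) (\<lambda>x. x $ i * frechet_derivative p (at x) (axis k 1))"
      using pol_coord.IH Suc by (intro pol.pol_coord) simp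
    ultimately show ?thesis
      using Suc pol_coord.hyps by (auto intro!: pol_add pol_cmult)
  qed
next
  case (pol_add n p q)
  have "(\<lambda>x. frechet_derivative (\<lambda>x. p x + q x) (at x) (axis k 1)) =
      (\<lambda>x. frechet_derivative p (at x) (axis k 1) + frechet_derivative q (at x) (axis k 1))"
    using pol_add.hyps by (intro ext frechet_add) (auto intro: pol_test_fun)
  then show ?case using pol_add.IH by (auto intro: pol.pol_add)
qed (auto intro: pol.intros)

text \<open>Euler's relation: the homogeneous part of degree n is multiplied by n, and the
  discrepancy in the other parts goes into \<open>q\<close>.\<close>

lemma pol_euler:
  "pol m p \<Longrightarrow> m = Suc n \<Longrightarrow> \<exists>q. pol n q \<and> (\<forall>x. frechet_derivative p (at x) x = real n * p x + q x)"
proof (induction arbitrary: n rule: pol.induct)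
  case (pol_zero m)
  show ?case by (rule exI[of _ "\<lambda>_. 0"]) (auto intro: pol.intros)
next
  case (pol_const m c)
  have "pol n (\<lambda>_. - (real n * c))" by (cases n) (auto intro: pol.intros)
  then show ?case by (intro exI[of _ "\<lambda>_. - (real n * c)"]) auto
next
  case (pol_coord m p i)
  note tf = pol_test_fun[OF pol_coord.hyps]
  show ?case
  proof (cases n)
    case 0
    then have "p = (\<lambda>_. 0)" using pol_0D[OF pol_coord.hyps] pol_coord.prems by simp
    then show ?thesis by (intro exI[of _ "\<lambda>_. 0"]) (auto intro: pol.intros)
  next
    case (Suc l)
    then obtain q where q: "pol l q" "\<And>x. frechet_derivative p (at x) x = real l * p x + q x"
      using pol_coord.IH[of l] pol_coord.prems by auto
    have "frechet_derivative (\<lambda>x. x $ i * p x) (at x) x = real n * (x $ i * p x) + x $ i * q x" for x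
      using Suc by (subst frechet_mult) (auto simp: frechet_coord tf q(2) algebra_simps)
    moreover have "pol n (\<lambda>x. x $ i * q x)" unfolding Suc by (rule pol.pol_coord[OF q(1)])
    ultimately show ?thesis by blast
  qed
next
  case (pol_add m p q)
  obtain p' q' where *: "pol n p'" "\<And>x. frechet_derivative p (at x) x = real n * p x + p' x"
    "pol n q'" "\<And>x. frechet_derivative q (at x) x = real n * q x + q' x"
    using pol_add.IH[OF pol_add.prems] by metis
  have "frechet_derivative (\<lambda>x. p x + q x) (at x) x = real n * (p x + q x) + (p' x + q' x)" for x
    using pol_add.hyps by (subst frechet_add) (auto simp: * algebra_simps intro: pol_test_fun)
  then show ?case using pol.pol_add[OF *(1,3)] by blast
qed

text \<open>Product rule for the Laplacian, using that \<Delta> x_i = - 2 x_i and that the gradient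
  of x_i, paired with the tangential gradient of \<open>p\<close>, yields its i-th
  component.\<close>

lemma Dtan_laplace_coord:
  assumes p: "test_fun p" and D: "\<And>k. test_fun (Dtan p k)" and x: "norm x = 1"
  shows "(\<Sum>k\<in>UNIV. Dtan (Dtan (\<lambda>x. x $ i * p x) k) k x)
    = x $ i * (\<Sum>k\<in>UNIV. Dtan (Dtan p k) k x) + 2 * Dtan p i x - 2 * x $ i * p x"
proof -
  define d where "d = (\<lambda>k. if i = k then 1 else 0 :: real)"
  have s: "(\<Sum>k\<in>UNIV. x $ k * x $ k) = 1"
    using x by (simp add: norm_eq_1 inner_vec_def)
  have 1: "Dtan (\<lambda>x. x $ i * p x) k = (\<lambda>x. (d k + (-1) * (x $ k * x $ i)) * p x + x $ i * Dtan p k x)" for k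
    by (rule ext, subst Dtan_mult) (auto simp: Dtan_coord p d_def algebra_simps)
  have tf: "test_fun (\<lambda>x. d k + (-1) * (x $ k * x $ i))" for k
    by (intro test_fun_add test_fun_const test_fun_mult test_fun_coord)
  have 2: "Dtan (\<lambda>x. d k + (-1) * (x $ k * x $ i)) k x
      = - ((1 - x $ k * x $ k) * x $ i + x $ k * (d k - x $ k * x $ i))" for k
    unfolding Dtan_add[OF test_fun_const test_fun_mult[OF test_fun_const
        test_fun_mult[OF test_fun_coord test_fun_coord]]]
      Dtan_cmult[OF test_fun_mult[OF test_fun_coord test_fun_coord]]
      Dtan_mult[OF test_fun_coord test_fun_coord]
    by (simp add: Dtan_coord d_def algebra_simps)
  have 3: "Dtan (Dtan (\<lambda>x. x $ i * p x) k) k x =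
       - ((1 - x $ k * x $ k) * x $ i + x $ k * (d k - x $ k * x $ i)) * p x
       + 2 * ((d k - x $ k * x $ i) * Dtan p k x) + x $ i * Dtan (Dtan p k) k x" for k
    unfolding 1
    apply (subst Dtan_add)
      apply (intro test_fun_mult tf p)
     apply (intro test_fun_mult test_fun_coord D)
    apply (subst Dtan_mult[OF tf p])
    apply (subst Dtan_mult[OF test_fun_coord D])
    apply (simp only: 2 Dtan_coord)
    apply (simp add: d_def algebra_simps)
    done
  have i: "(\<Sum>k\<in>UNIV. f k * d k) = f i" for f :: "3 \<Rightarrow> real"
  proof -
    have "(\<Sum>k\<in>UNIV. f k * d k) = (\<Sum>k\<in>UNIV. if k = i then f i else 0)"
      by (rule sum.cong) (auto simp: d_def)
    then show ?thesis by simp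
  qed
  have "(\<Sum>k\<in>UNIV. Dtan (Dtan (\<lambda>x. x $ i * p x) k) k x) =
     (\<Sum>k\<in>UNIV. - (x $ i * p x) + 2 * (x $ i * p x) * (x $ k * x $ k) - p x * (x $ k * d k)
        + 2 * (Dtan p k x * d k) - 2 * x $ i * (x $ k * Dtan p k x) + x $ i * Dtan (Dtan p k) k x)"
    by (rule sum.cong[OF refl], simp only: 3) (simp add: algebra_simps)
  also have "\<dots> = - 3 * (x $ i * p x) + 2 * (x $ i * p x) * (\<Sum>k\<in>UNIV. x $ k * x $ k)
       - p x * (\<Sum>k\<in>UNIV. x $ k * d k) + 2 * (\<Sum>k\<in>UNIV. Dtan p k x * d k)
       - 2 * x $ i * (\<Sum>k\<in>UNIV. x $ k * Dtan p k x) + x $ i * (\<Sum>k\<in>UNIV. Dtan (Dtan p k) k x)"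
    by (simp add: sum.distrib sum_subtractf sum_distrib_left[symmetric])
  also have "\<dots> = x $ i * (\<Sum>k\<in>UNIV. Dtan (Dtan p k) k x) + 2 * Dtan p i x - 2 * x $ i * p x"
    unfolding s i Dtan_radial_zero[OF p x] by (simp add: algebra_simps)
  finally show ?thesis .
qed

text \<open>By \<open>Dtan_laplace_coord\<close> a factor x_i on a polynomial of degree l changes
  the leading coefficient to - l (l + 1) - 2 l - 2 = - (l + 1) (l + 2). The term - 2 l comes from
  the radial part of 2 \<open>Dtan p i\<close>, evaluated by \<open>pol_euler\<close>; the partial
  derivative that remains in it has lower degree.\<close>

lemma pol_laplace:
  "pol m p \<Longrightarrow> m = Suc n \<Longrightarrow> \<exists>q. pol n q \<and>
     (\<forall>x. norm x = 1 \<longrightarrow> (\<Sum>k\<in>UNIV. Dtan (Dtan p k) k x) = - real (n * (n + 1)) * p x + q x)"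
proof (induction arbitrary: n rule: pol.induct)
  case (pol_zero m)
  have "Dtan (\<lambda>_. 0) k = (\<lambda>_. 0)" for k by auto
  then show ?case by (intro exI[of _ "\<lambda>_. 0"]) (auto intro: pol.intros)
next
  case (pol_const m c)
  have "Dtan (\<lambda>_. c) k = (\<lambda>_. 0)" for k by auto
  moreover have "pol n (\<lambda>_. real (n * (n + 1)) * c)" by (cases n) (auto intro: pol.intros)
  ultimately show ?case by (intro exI[of _ "\<lambda>_. real (n * (n + 1)) * c"]) (auto simp: algebra_simps)
next
  case (pol_coord m p i)
  note tf = pol_test_fun[OF pol_coord.hyps] pol_test_fun[OF pol_Dtan[OF pol_coord.hyps]]
  show ?case
  proof (cases n)
    case 0
    then have p: "p = (\<lambda>_. 0)" using pol_0D[OF pol_coord.hyps] pol_coord.prems by simp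
    have "Dtan (\<lambda>_. 0) k = (\<lambda>_. 0)" for k by auto
    then show ?thesis unfolding p by (intro exI[of _ "\<lambda>_. 0"]) (auto intro: pol.intros)
  next
    case (Suc l)
    then have pl: "pol (Suc l) p" using pol_coord by simp
    obtain q where q: "pol l q"
      "\<And>x. norm x = 1 \<Longrightarrow> (\<Sum>k\<in>UNIV. Dtan (Dtan p k) k x) = - real (l * (l + 1)) * p x + q x"
      using pol_coord.IH[of l] pol_coord.prems Suc by auto
    obtain r where r: "pol l r" "\<And>x. frechet_derivative p (at x) x = real l * p x + r x"
      using pol_euler[OF pl refl] by auto
    define s where "s = (\<lambda>x. x $ i * q x + (2 * frechet_derivative p (at x) (axis i 1) + (-2) * (x $ i * r x)))"
    have "pol n s" unfolding s_def Suc
      by (intro pol_add pol_cmult pol.pol_coord q r) (use pol_partial[OF pl, of i] in \<open>auto intro: pol_Suc\<close>)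
    moreover have "(\<Sum>k\<in>UNIV. Dtan (Dtan (\<lambda>x. x $ i * p x) k) k x)
        = - real (n * (n + 1)) * (x $ i * p x) + s x" if "norm x = 1" for x
      unfolding Dtan_laplace_coord[OF tf that] q(2)[OF that] Dtan_def[of p i] r(2) s_def Suc
      by (simp add: algebra_simps)
    ultimately show ?thesis by blast
  qed
next
  case (pol_add m p q)
  obtain p' where p': "pol n p'"
    "\<And>x. norm x = 1 \<Longrightarrow> (\<Sum>k\<in>UNIV. Dtan (Dtan p k) k x) = - real (n * (n + 1)) * p x + p' x"
    using pol_add.IH(1)[OF pol_add.prems] by auto
  obtain q' where q': "pol n q'"
    "\<And>x. norm x = 1 \<Longrightarrow> (\<Sum>k\<in>UNIV. Dtan (Dtan q k) k x) = - real (n * (n + 1)) * q x + q' x"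
    using pol_add.IH(2)[OF pol_add.prems] by auto
  have D: "Dtan (\<lambda>x. p x + q x) k = (\<lambda>x. Dtan p k x + Dtan q k x)" for k
    using pol_add.hyps by (intro ext Dtan_add) (auto intro: pol_test_fun)
  have "(\<Sum>k\<in>UNIV. Dtan (Dtan (\<lambda>x. p x + q x) k) k x) =
      (\<Sum>k\<in>UNIV. Dtan (Dtan p k) k x) + (\<Sum>k\<in>UNIV. Dtan (Dtan q k) k x)" for x
    unfolding D sum.distrib[symmetric]
    using pol_add.hyps by (intro sum.cong refl Dtan_add) (auto intro: pol_test_fun pol_Dtan)
  then have "(\<Sum>k\<in>UNIV. Dtan (Dtan (\<lambda>x. p x + q x) k) k x) =
      - real (n * (n + 1)) * (p x + q x) + (p' x + q' x)" if "norm x = 1" for x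
    using p'(2)[OF that] q'(2)[OF that] by (simp only: distrib_left)
  with pol.pol_add[OF p'(1) q'(1)] show ?case by blast
qed

section \<open>Spherical harmonics\<close>

lemma ipS_lincomb_left:
  "(\<And>i. i \<in> I \<Longrightarrow> L2S (f i)) \<Longrightarrow> L2S h
    \<Longrightarrow> ipS (\<lambda>x. \<Sum>i\<in>I. c i * f i x) h = (\<Sum>i\<in>I. c i * ipS (f i) h)"
  by (subst ipS_sum_left) (auto simp: ipS_cmult_left intro: L2S_cmult)

lemma ipS_lincomb_right:
  "(\<And>i. i \<in> I \<Longrightarrow> L2S (f i)) \<Longrightarrow> L2S h
    \<Longrightarrow> ipS h (\<lambda>x. \<Sum>i\<in>I. c i * f i x) = (\<Sum>i\<in>I. c i * ipS h (f i))"
  by (simp add: ipS_commute[of h] ipS_lincomb_left)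

lemma L2S_lincomb: "(\<And>i. i \<in> I \<Longrightarrow> L2S (f i)) \<Longrightarrow> L2S (\<lambda>x. \<Sum>i\<in>I. c i * f i x)"
  by (intro L2S_sum L2S_cmult)

section \<open>Monomials ordered by degree and their Gram-Schmidt orthonormalisation\<close>

definition mon :: "nat \<Rightarrow> nat \<Rightarrow> nat \<Rightarrow> real^3 \<Rightarrow> real" where
  "mon a b c x = (x $ 1) ^ a * (x $ 2) ^ b * (x $ 3) ^ c"

text \<open>On the sphere only the monomials with \<open>x\<^sub>3\<close>-exponent 0 or 1 are needed; \<open>2 l + 1\<close> of them have
  degree \<open>l\<close>, and they occupy the indices \<open>l\<^sup>2, \<dots>, (l + 1)\<^sup>2 - 1\<close>.\<close>

definition mon_enum :: "nat \<Rightarrow> real^3 \<Rightarrow> real" where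
  "mon_enum k = (let l = floor_sqrt k; j = k - l\<^sup>2
     in if j \<le> l then mon j (l - j) 0 else mon (j - l - 1) (2 * l - j) 1)"

lemma pol_mon: "pol (Suc (a + b + c)) (mon a b c)"
proof (induction a)
  case 0
  show ?case
  proof (induction b)
    case 0
    show ?case
    proof (induction c)
      case 0
      have "mon 0 0 0 = (\<lambda>_. 1)" by (auto simp: mon_def)
      then show ?case by (auto intro: pol.intros)
    next
      case (Suc c)
      have "mon 0 0 (Suc c) = (\<lambda>x. x $ 3 * mon 0 0 c x)" by (auto simp: mon_def)
      then show ?case using pol_coord[OF Suc, of 3] by simp
    qed
  next
    case (Suc b)
    have "mon 0 (Suc b) c = (\<lambda>x. x $ 2 * mon 0 b c x)" by (auto simp: mon_def)
    then show ?case using pol_coord[OF Suc, of 2] by simp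
  qed
next
  case (Suc a)
  have "mon (Suc a) b c = (\<lambda>x. x $ 1 * mon a b c x)" by (auto simp: mon_def)
  then show ?case using pol_coord[OF Suc, of 1] by simp
qed

lemma mon_enum_cases:
  obtains a b c where "c \<le> 1" "a + b + c = floor_sqrt k" "mon_enum k = mon a b c"
proof -
  define l j where "l = floor_sqrt k" and "j = k - l\<^sup>2"
  have "k < (Suc l)\<^sup>2" unfolding l_def by (rule Suc_floor_sqrt_power2_gt)
  then have j: "j \<le> 2 * l" by (auto simp: j_def power2_eq_square)
  show thesis
  proof (cases "j \<le> l")
    case True
    then show thesis by (intro that[of 0 j "l - j"]) (auto simp: mon_enum_def l_def j_def Let_def)
  next
    case False
    then show thesis using j
      by (intro that[of 1 "j - l - 1" "2 * l - j"]) (auto simp: mon_enum_def l_def j_def Let_def)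
  qed
qed

lemma floor_sqrt_less_iff: "floor_sqrt k < n \<longleftrightarrow> k < n\<^sup>2"
  using le_floor_sqrt_iff[of n k] by (auto simp: not_le[symmetric])

lemma mon_enum_surj:
  assumes "c \<le> 1" "a + b + c < n"
  shows "\<exists>k<n\<^sup>2. mon_enum k = mon a b c"
proof -
  define l where "l = a + b + c"
  \<comment> \<open>The block of degree l lists the l + 1 monomials free of x_3 before the l
    monomials with x_3-exponent 1.\<close>
  define j where "j = (if c = 0 then a else l + 1 + a)"
  have j: "j \<le> 2 * l" using assms by (auto simp: j_def l_def)
  have f: "floor_sqrt (l\<^sup>2 + j) = l"
    using j by (intro floor_sqrt_unique) (auto simp: power2_eq_square)
  have "mon_enum (l\<^sup>2 + j) = (if j \<le> l then mon j (l - j) 0 else mon (j - l - 1) (2 * l - j) 1)"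
    by (simp only: mon_enum_def Let_def f add_diff_cancel_left')
  also have "\<dots> = mon a b c"
    using assms by (cases "c = 0") (auto simp: j_def l_def le_Suc_eq)
  finally have "mon_enum (l\<^sup>2 + j) = mon a b c" .
  moreover have "l\<^sup>2 + j < n\<^sup>2"
    using assms(2) by (simp only: floor_sqrt_less_iff[symmetric] f) (simp add: l_def)
  ultimately show ?thesis by blast
qed

lemma pol_mon_enum: "pol (Suc (floor_sqrt k)) (mon_enum k)"
  by (rule mon_enum_cases[of k]) (metis pol_mon)

text \<open>The identity is demanded on the sphere only, where x_3^2 may be replaced by 1 - x_1^2 -
  x_2^2. Off the sphere the enumerated monomials would not span the polynomials of degree 2 or
  more.\<close>

definition spn :: "nat \<Rightarrow> (real^3 \<Rightarrow> real) \<Rightarrow> bool" where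
  "spn n p \<longleftrightarrow> (\<exists>a. \<forall>x. norm x = 1 \<longrightarrow> p x = (\<Sum>k<n\<^sup>2. a k * mon_enum k x))"

lemma spn_add: "spn n p \<Longrightarrow> spn n q \<Longrightarrow> spn n (\<lambda>x. p x + q x)"
  unfolding spn_def
proof (elim exE)
  fix a b assume "\<forall>x. norm x = 1 \<longrightarrow> p x = (\<Sum>k<n\<^sup>2. a k * mon_enum k x)"
    "\<forall>x. norm x = 1 \<longrightarrow> q x = (\<Sum>k<n\<^sup>2. b k * mon_enum k x)"
  then show "\<exists>c. \<forall>x. norm x = 1 \<longrightarrow> p x + q x = (\<Sum>k<n\<^sup>2. c k * mon_enum k x)"
    by (intro exI[of _ "\<lambda>k. a k + b k"]) (auto simp: distrib_right sum.distrib)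
qed

lemma spn_cmult: "spn n p \<Longrightarrow> spn n (\<lambda>x. c * p x)"
  unfolding spn_def
proof (elim exE)
  fix a assume "\<forall>x. norm x = 1 \<longrightarrow> p x = (\<Sum>k<n\<^sup>2. a k * mon_enum k x)"
  then show "\<exists>b. \<forall>x. norm x = 1 \<longrightarrow> c * p x = (\<Sum>k<n\<^sup>2. b k * mon_enum k x)"
    by (intro exI[of _ "\<lambda>k. c * a k"]) (auto simp: sum_distrib_left mult.assoc)
qed

lemma spn_zero: "spn n (\<lambda>_. 0)"
  unfolding spn_def by (rule exI[of _ "\<lambda>_. 0"]) auto

lemma spn_sum: "(\<And>i. i \<in> I \<Longrightarrow> spn n (f i)) \<Longrightarrow> spn n (\<lambda>x. \<Sum>i\<in>I. f i x)"
  by (induction I rule: infinite_finite_induct) (auto intro: spn_add spn_zero)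

lemma spn_cong: "spn n p \<Longrightarrow> (\<And>x. norm x = 1 \<Longrightarrow> q x = p x) \<Longrightarrow> spn n q"
  unfolding spn_def by (metis (full_types))

lemma spn_mon_enum: "k < n\<^sup>2 \<Longrightarrow> spn n (mon_enum k)"
  unfolding spn_def
  by (rule exI[of _ "\<lambda>i. if i = k then 1 else 0"]) (auto simp: if_distrib if_distribR cong: if_cong)

lemma spn_mon: "c \<le> 1 \<Longrightarrow> a + b + c < n \<Longrightarrow> spn n (mon a b c)"
  using mon_enum_surj spn_mon_enum by metis

lemma spn_coord_mon:
  assumes c: "c \<le> 1" and n: "a + b + c < n"
  shows "spn (Suc n) (\<lambda>x. x $ i * mon a b c x)"
proof -
  consider "i = 1" | "i = 2" | "i = 3" "c = 0" | "i = 3" "c = 1"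
    using exhaust_3[of i] c by (auto simp: le_Suc_eq)
  then show ?thesis
  proof cases
    case 1
    then have "(\<lambda>x. x $ i * mon a b c x) = mon (Suc a) b c" by (auto simp: mon_def)
    then show ?thesis using spn_mon[of c "Suc a" b "Suc n"] c n by simp
  next
    case 2
    then have "(\<lambda>x. x $ i * mon a b c x) = mon a (Suc b) c" by (auto simp: mon_def)
    then show ?thesis using spn_mon[of c a "Suc b" "Suc n"] c n by simp
  next
    case 3
    then have "(\<lambda>x. x $ i * mon a b c x) = mon a b 1" by (auto simp: mon_def)
    then show ?thesis using spn_mon[of 1 a b "Suc n"] 3 n by simp
  next
    case 4
    have "spn (Suc n) (\<lambda>x. mon a b 0 x + ((-1) * mon (a + 2) b 0 x + (-1) * mon a (b + 2) 0 x))"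
      using 4 n by (intro spn_add spn_cmult spn_mon) auto
    then show ?thesis
    proof (rule spn_cong)
      fix x :: "real^3" assume "norm x = 1"
      then have "(x $ 3)\<^sup>2 = 1 - (x $ 1)\<^sup>2 - (x $ 2)\<^sup>2"
        by (simp add: norm_eq_1 inner_vec_def sum_3 power2_eq_square)
      then have "(x $ 3)\<^sup>2 * ((x $ 1) ^ a * (x $ 2) ^ b)
          = (1 - (x $ 1)\<^sup>2 - (x $ 2)\<^sup>2) * ((x $ 1) ^ a * (x $ 2) ^ b)" by simp
      then show "x $ i * mon a b c x
          = mon a b 0 x + ((-1) * mon (a + 2) b 0 x + (-1) * mon a (b + 2) 0 x)"
        using 4 by (simp add: mon_def power2_eq_square power_add algebra_simps)
    qed
  qed
qed

lemma spn_coord: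
  assumes "spn n p" shows "spn (Suc n) (\<lambda>x. x $ i * p x)"
proof -
  obtain a where a: "\<And>x. norm x = 1 \<Longrightarrow> p x = (\<Sum>k<n\<^sup>2. a k * mon_enum k x)"
    using assms unfolding spn_def by auto
  have "spn (Suc n) (\<lambda>x. x $ i * mon_enum k x)" if "k < n\<^sup>2" for k
  proof (rule mon_enum_cases[of k])
    fix s b c assume "c \<le> 1" "s + b + c = floor_sqrt k" "mon_enum k = mon s b c"
    then show ?thesis using that spn_coord_mon[of c s b n i] by (simp add: floor_sqrt_less_iff)
  qed
  then have "spn (Suc n) (\<lambda>x. \<Sum>k<n\<^sup>2. a k * (x $ i * mon_enum k x))"
    by (intro spn_sum spn_cmult) auto
  then show ?thesis
    by (rule spn_cong) (simp add: a sum_distrib_left algebra_simps)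
qed

lemma pol_imp_spn: "pol n p \<Longrightarrow> spn n p"
proof (induction rule: pol.induct)
  case (pol_const n c)
  have "mon 0 0 0 = (\<lambda>_. 1)" by (auto simp: mon_def)
  then show ?case using spn_cmult[OF spn_mon[of 0 0 0 "Suc n"], of c] by simp
qed (auto intro: spn_zero spn_add spn_coord)

text \<open>Where the Gram-Schmidt residual vanishes, division by \<open>0\<close> makes \<open>Y n\<close> the zero function. Every
  \<open>Y n\<close> thus has norm 1 or 0, and linear independence of the monomials is never needed.\<close>

function Y :: "nat \<Rightarrow> real^3 \<Rightarrow> real" where
  "Y n = (let r = (\<lambda>x. mon_enum n x - (\<Sum>k<n. ipS (mon_enum n) (Y k) * Y k x))
          in (\<lambda>x. r x / sqrt (ipS r r)))"
  by auto
termination by (relation "Wellfounded.measure id") auto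

declare Y.simps [simp del]

definition gs_res :: "nat \<Rightarrow> real^3 \<Rightarrow> real" where
  "gs_res n x = mon_enum n x - (\<Sum>k<n. ipS (mon_enum n) (Y k) * Y k x)"

lemma Y_eq: "Y n x = gs_res n x / sqrt (ipS (gs_res n) (gs_res n))"
  by (subst Y.simps) (simp add: gs_res_def[abs_def] Let_def)

lemma pol_Y: "pol (Suc (floor_sqrt n)) (Y n)"
proof (induction n rule: less_induct)
  case (less n)
  have "pol (Suc (floor_sqrt n)) (\<lambda>x. \<Sum>k<n. ipS (mon_enum n) (Y k) * Y k x)"
  proof (intro pol_sum pol_cmult)
    fix k assume "k \<in> {..<n}"
    then show "pol (Suc (floor_sqrt n)) (Y k)"
      using less.IH[of k] mono_floor_sqrt'[of k n] by (auto intro: pol_mono)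
  qed
  then have "pol (Suc (floor_sqrt n)) (gs_res n)"
    unfolding gs_res_def[abs_def] by (intro pol_diff pol_mon_enum)
  from pol_cmult[OF this, of "1 / sqrt (ipS (gs_res n) (gs_res n))"]
  show ?case by (simp add: Y_eq[abs_def])
qed

lemma Y_test_fun: "test_fun (Y k)" using pol_Y by (rule pol_test_fun)
lemma Y_continuous: "continuous_on UNIV (Y k)" using pol_Y by (rule pol_continuous)
lemma Y_L2S: "L2S (Y k)" using pol_Y by (rule pol_L2S)

lemma mon_enum_L2S: "L2S (mon_enum k)" using pol_mon_enum by (rule pol_L2S)

lemma gs_res_continuous: "continuous_on UNIV (gs_res n)"
  unfolding gs_res_def[abs_def]
  by (intro continuous_intros Y_continuous pol_continuous[OF pol_mon_enum])

lemma gs_res_L2S: "L2S (gs_res n)"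
  using gs_res_continuous by (rule L2S_continuous)

text \<open>With values 1 and 0, this acts as the projection onto the indices with
  \<open>Y k\<close> non-zero. Coefficients \<open>ipS f (Y k)\<close> absorb the factor, whereas an
  arbitrary element of \<open>l2\<close> may have entries at the other indices; this is why the
  factor appears in \<open>synth\<close> and in everything built from it.\<close>

definition nY :: "nat \<Rightarrow> real" where "nY k = ipS (Y k) (Y k)"

lemma nY_cases: "nY k = 1 \<or> (nY k = 0 \<and> Y k = (\<lambda>_. 0))"
proof (cases "ipS (gs_res k) (gs_res k) = 0")
  case True
  then have "Y k = (\<lambda>_. 0)" by (auto simp: Y_eq)
  then show ?thesis by (simp add: nY_def)
next
  case False
  define s where "s = sqrt (ipS (gs_res k) (gs_res k))"
  have s: "s \<noteq> 0" "s * s = ipS (gs_res k) (gs_res k)" using False ipS_self_nonneg by (auto simp: s_def)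
  have "Y k = (\<lambda>x. (1 / s) * gs_res k x)" by (auto simp: Y_eq s_def)
  then have "nY k = (1 / s) * ((1 / s) * (s * s))"
    unfolding nY_def by (simp only: ipS_cmult_left ipS_cmult_right s(2))
  then show ?thesis using s(1) by simp
qed

lemma Y_nY: "nY k * Y k x = Y k x"
  using nY_cases[of k] by auto

lemma Y_orth_less: "j < n \<Longrightarrow> ipS (Y n) (Y j) = 0"
proof (induction n arbitrary: j rule: less_induct)
  case (less n)
  have orth: "ipS (Y k) (Y j) = (if k = j then nY j else 0)" if "k < n" for k
    using less.IH[of k j] less.IH[of j k] that less.prems ipS_commute[of "Y k" "Y j"]
    by (cases k j rule: linorder_cases) (auto simp: nY_def)
  have "ipS (gs_res n) (Y j) = ipS (mon_enum n) (Y j) - (\<Sum>k<n. ipS (mon_enum n) (Y k) * ipS (Y k) (Y j))"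
    unfolding gs_res_def[abs_def]
    by (subst ipS_diff_left) (auto simp: ipS_lincomb_left Y_L2S intro!: mon_enum_L2S L2S_lincomb)
  also have "(\<Sum>k<n. ipS (mon_enum n) (Y k) * ipS (Y k) (Y j)) = (\<Sum>k<n. if k = j then ipS (mon_enum n) (Y j) * nY j else 0)"
    by (rule sum.cong) (auto simp: orth)
  also have "\<dots> = ipS (mon_enum n) (Y j) * nY j" using less.prems by simp
  also have "ipS (mon_enum n) (Y j) * nY j = ipS (mon_enum n) (Y j)"
    using nY_cases[of j] by auto
  finally have "ipS (gs_res n) (Y j) = 0" by simp
  moreover have "Y n = (\<lambda>x. (1 / sqrt (ipS (gs_res n) (gs_res n))) * gs_res n x)" by (auto simp: Y_eq)
  ultimately show ?case by (simp only: ipS_cmult_left)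
qed

lemma Y_orth: "ipS (Y k) (Y j) = (if k = j then nY j else 0)"
  using Y_orth_less[of j k] Y_orth_less[of k j] ipS_commute[of "Y k" "Y j"]
  by (cases k j rule: linorder_cases) (auto simp: nY_def)

text \<open>A residual of norm zero vanishes almost everywhere, hence by continuity at every point
  of the sphere, so the expansion survives the degenerate case of Gram-Schmidt.\<close>

lemma mon_enum_expansion:
  assumes x: "norm x = 1"
  shows "mon_enum n x = (\<Sum>k<n. ipS (mon_enum n) (Y k) * Y k x) + sqrt (ipS (gs_res n) (gs_res n)) * Y n x"
proof (cases "ipS (gs_res n) (gs_res n) = 0")
  case True
  then have "AE x in sphere_measure. gs_res n x = 0" using ipS_self_eq_0_iff[OF gs_res_L2S] by simp
  from AE_sphere_zero_imp[OF gs_res_continuous this x] show ?thesis using True by (simp add: gs_res_def)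
next
  case False
  then have "sqrt (ipS (gs_res n) (gs_res n)) * Y n x = gs_res n x" by (simp add: Y_eq)
  then show ?thesis by (simp add: gs_res_def)
qed

lemma pol_expansion:
  assumes p: "pol n p" and x: "norm x = 1"
  shows "p x = (\<Sum>k<n\<^sup>2. ipS p (Y k) * Y k x)"
proof -
  define V where "V = (\<lambda>f. \<exists>a. \<forall>x. norm x = 1 \<longrightarrow> f x = (\<Sum>k<n\<^sup>2. a k * Y k x))"
  have Va: "V (\<lambda>x. f x + g x)" if "V f" "V g" for f g
  proof -
    from that obtain a b where "\<forall>x. norm x = 1 \<longrightarrow> f x = (\<Sum>k<n\<^sup>2. a k * Y k x)"
      "\<forall>x. norm x = 1 \<longrightarrow> g x = (\<Sum>k<n\<^sup>2. b k * Y k x)" unfolding V_def by auto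
    then show ?thesis unfolding V_def
      by (intro exI[of _ "\<lambda>k. a k + b k"]) (auto simp: distrib_right sum.distrib)
  qed
  have Vc: "V (\<lambda>x. c * f x)" if "V f" for c f
  proof -
    from that obtain a where "\<forall>x. norm x = 1 \<longrightarrow> f x = (\<Sum>k<n\<^sup>2. a k * Y k x)"
      unfolding V_def by auto
    then show ?thesis unfolding V_def
      by (intro exI[of _ "\<lambda>k. c * a k"]) (auto simp: sum_distrib_left mult.assoc)
  qed
  have V0: "V (\<lambda>_. 0)" unfolding V_def by (rule exI[of _ "\<lambda>_. 0"]) auto
  have Vs: "V (\<lambda>x. \<Sum>i\<in>I. f i x)" if "\<And>i. i \<in> I \<Longrightarrow> V (f i)" for I :: "nat set" and f
    using that by (induction I rule: infinite_finite_induct) (auto intro: Va V0)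
  have VY: "V (Y k)" if "k < n\<^sup>2" for k
    unfolding V_def using that
    by (intro exI[of _ "\<lambda>i. if i = k then 1 else 0"]) (auto simp: if_distrib if_distribR cong: if_cong)
  have Vm: "V (mon_enum k)" if k: "k < n\<^sup>2" for k
  proof -
    have "V (\<lambda>x. (\<Sum>j<k. ipS (mon_enum k) (Y j) * Y j x) + sqrt (ipS (gs_res k) (gs_res k)) * Y k x)"
      using k by (intro Va Vs Vc VY) auto
    then show ?thesis using mon_enum_expansion[of _ k] unfolding V_def by auto
  qed
  obtain b where b: "\<forall>x. norm x = 1 \<longrightarrow> p x = (\<Sum>k<n\<^sup>2. b k * mon_enum k x)"
    using pol_imp_spn[OF p] unfolding spn_def by auto
  have "V (\<lambda>x. \<Sum>k<n\<^sup>2. b k * mon_enum k x)" by (intro Vs Vc Vm) auto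
  then obtain a where a: "\<And>x. norm x = 1 \<Longrightarrow> p x = (\<Sum>k<n\<^sup>2. a k * Y k x)"
    using b unfolding V_def by auto
  have aAE: "AE x in sphere_measure. p x = (\<Sum>k<n\<^sup>2. a k * Y k x)"
    using AE_sphere by eventually_elim (rule a)
  \<comment> \<open>At a degenerate index \<open>a k\<close> is arbitrary; the factor
    \<open>nY k\<close> is later absorbed by \<open>Y k\<close>.\<close>
  have "ipS p (Y k) = a k * nY k" if k: "k < n\<^sup>2" for k
  proof -
    have "ipS p (Y k) = ipS (\<lambda>x. \<Sum>k<n\<^sup>2. a k * Y k x) (Y k)"
      by (rule ipS_cong_AE[OF pol_L2S[OF p] _ Y_L2S aAE]) (intro L2S_lincomb Y_L2S)
    also have "\<dots> = (\<Sum>j<n\<^sup>2. a j * ipS (Y j) (Y k))"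
      by (subst ipS_sum_left) (auto simp: ipS_cmult_left intro!: L2S_cmult Y_L2S)
    also have "\<dots> = (\<Sum>j<n\<^sup>2. if j = k then a k * nY k else 0)"
      by (rule sum.cong) (auto simp: Y_orth)
    also have "\<dots> = a k * nY k" using k by simp
    finally show ?thesis .
  qed
  then have "(\<Sum>k<n\<^sup>2. ipS p (Y k) * Y k x) = (\<Sum>k<n\<^sup>2. a k * Y k x)"
    by (intro sum.cong refl) (simp add: mult.assoc Y_nY)
  then show ?thesis using a[OF x] by simp
qed

lemma pol_expansion_AE: "pol n p \<Longrightarrow> AE x in sphere_measure. p x = (\<Sum>k<n\<^sup>2. ipS p (Y k) * Y k x)"
  using AE_sphere by eventually_elim (rule pol_expansion)

lemma pol_orth:
  assumes p: "pol n p" and k: "n\<^sup>2 \<le> k" shows "ipS p (Y k) = 0"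
proof -
  have "ipS p (Y k) = ipS (\<lambda>x. \<Sum>j<n\<^sup>2. ipS p (Y j) * Y j x) (Y k)"
    by (rule ipS_cong_AE[OF pol_L2S[OF p] _ Y_L2S pol_expansion_AE[OF p]])
       (intro L2S_sum L2S_cmult Y_L2S)
  also have "\<dots> = (\<Sum>j<n\<^sup>2. ipS p (Y j) * ipS (Y j) (Y k))"
    by (subst ipS_sum_left) (auto simp: ipS_cmult_left intro!: L2S_cmult Y_L2S)
  also have "\<dots> = 0" using k by (intro sum.neutral) (auto simp: Y_orth)
  finally show ?thesis .
qed

section \<open>Green's formula and the eigenvalue equation\<close>

lemma integral_Dtan_parts:
  assumes f: "test_fun f" and g: "test_fun g"
  shows "(\<integral>x. Dtan f k x * g x \<partial>sphere_measure)
       = - (\<integral>x. f x * Dtan g k x \<partial>sphere_measure) + 2 * (\<integral>x. x $ k * f x * g x \<partial>sphere_measure)"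
proof -
  have "(\<integral>x. Dtan f k x * g x + f x * Dtan g k x \<partial>sphere_measure)
      = 2 * (\<integral>x. x $ k * (f x * g x) \<partial>sphere_measure)"
    using integral_Dtan[OF test_fun_mult[OF f g], of k] by (simp add: Dtan_mult[OF f g])
  moreover have "(\<integral>x. Dtan f k x * g x + f x * Dtan g k x \<partial>sphere_measure)
      = (\<integral>x. Dtan f k x * g x \<partial>sphere_measure) + (\<integral>x. f x * Dtan g k x \<partial>sphere_measure)"
    by (rule Bochner_Integration.integral_add)
       (intro integrable_sphere_continuous continuous_intros continuous_on_Dtan
          test_fun_continuous[OF f] test_fun_continuous[OF g] f g)+
  ultimately show ?thesis by (simp add: mult.assoc)
qed

definition lapS :: "(real^3 \<Rightarrow> real) \<Rightarrow> real^3 \<Rightarrow> real" where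
  "lapS f x = (\<Sum>k\<in>UNIV. Dtan (Dtan f k) k x)"

lemma lapS_continuous: "(\<And>k. test_fun (Dtan f k)) \<Longrightarrow> continuous_on UNIV (lapS f)"
  unfolding lapS_def[abs_def] by (intro continuous_intros continuous_on_Dtan)

text \<open>Integration by parts is applied to each \<open>Dtan f k\<close>. The curvature terms add
  up to the normal component of a tangential field and vanish.\<close>

lemma green:
  assumes f: "test_fun f" "\<And>k. test_fun (Dtan f k)" and g: "test_fun g"
  shows "ipS (lapS f) g = - (\<integral>x. (\<Sum>k\<in>UNIV. Dtan f k x * Dtan g k x) \<partial>sphere_measure)"
proof -
  note cont = continuous_intros continuous_on_Dtan test_fun_continuous[OF g] f g
  have "ipS (lapS f) g = (\<Sum>k\<in>UNIV. \<integral>x. Dtan (Dtan f k) k x * g x \<partial>sphere_measure)"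
    unfolding ipS_def lapS_def sum_distrib_right
    by (intro Bochner_Integration.integral_sum integrable_sphere_continuous cont)
  also have "\<dots> = (\<Sum>k\<in>UNIV. - (\<integral>x. Dtan f k x * Dtan g k x \<partial>sphere_measure)
        + 2 * (\<integral>x. x $ k * Dtan f k x * g x \<partial>sphere_measure))"
    by (intro sum.cong refl integral_Dtan_parts f g)
  also have "\<dots> = - (\<Sum>k\<in>UNIV. \<integral>x. Dtan f k x * Dtan g k x \<partial>sphere_measure)
        + 2 * (\<Sum>k\<in>UNIV. \<integral>x. x $ k * Dtan f k x * g x \<partial>sphere_measure)"
    by (simp add: sum_subtractf sum_distrib_left)
  also have "(\<Sum>k\<in>UNIV. \<integral>x. Dtan f k x * Dtan g k x \<partial>sphere_measure)
      = (\<integral>x. (\<Sum>k\<in>UNIV. Dtan f k x * Dtan g k x) \<partial>sphere_measure)"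
    by (intro Bochner_Integration.integral_sum[symmetric] integrable_sphere_continuous cont)
  also have "(\<Sum>k\<in>UNIV. \<integral>x. x $ k * Dtan f k x * g x \<partial>sphere_measure)
      = (\<integral>x. (\<Sum>k\<in>UNIV. x $ k * Dtan f k x * g x) \<partial>sphere_measure)"
    by (intro Bochner_Integration.integral_sum[symmetric] integrable_sphere_continuous cont)
  also have "\<dots> = (\<integral>x. 0 \<partial>sphere_measure)"
  proof (rule integral_cong_AE)
    have "continuous_on UNIV (\<lambda>x. \<Sum>k\<in>UNIV. x $ k * Dtan f k x * g x)" by (intro cont)
    then show "(\<lambda>x. \<Sum>k\<in>UNIV. x $ k * Dtan f k x * g x) \<in> borel_measurable sphere_measure"
      by (rule measurable_sphere_continuous)
    show "AE x in sphere_measure. (\<Sum>k\<in>UNIV. x $ k * Dtan f k x * g x) = 0"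
      using AE_sphere
      by eventually_elim (simp add: sum_distrib_right[symmetric] Dtan_radial_zero f)
  qed simp
  finally show ?thesis by simp
qed

text \<open>By the enumeration \<open>floor_sqrt k\<close> is the degree l of the block containing
  k, so this is the eigenvalue l (l + 1).\<close>

definition lam :: "nat \<Rightarrow> real" where
  "lam k = real (floor_sqrt k * (floor_sqrt k + 1))"

lemma pol_lapS:
  assumes "pol (Suc n) p"
  obtains q where "pol n q" "\<And>x. norm x = 1 \<Longrightarrow> lapS p x = - real (n * (n + 1)) * p x + q x"
  using pol_laplace[OF assms refl] unfolding lapS_def by auto

lemma lapS_symmetric:
  assumes f: "pol m f" and g: "pol n g"
  shows "ipS (lapS f) g = ipS f (lapS g)"
proof -
  have "ipS (lapS f) g = - (\<integral>x. (\<Sum>k\<in>UNIV. Dtan f k x * Dtan g k x) \<partial>sphere_measure)"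
    by (rule green) (auto intro: pol_test_fun pol_test_fun[OF pol_Dtan] f g)
  also have "\<dots> = ipS (lapS g) f"
    by (subst green[of g f]) (auto intro: pol_test_fun pol_test_fun[OF pol_Dtan] f g simp: mult.commute)
  finally show ?thesis by (simp add: ipS_commute)
qed

lemma L2S_lapS_Y: "L2S (lapS (Y j))"
  by (intro L2S_continuous lapS_continuous pol_test_fun[OF pol_Dtan[OF pol_Y]])

text \<open>The remainder \<open>q\<close> of \<open>pol_laplace\<close> has degree below l, so it
  is determined by its coefficients at the \<open>Y j\<close> of smaller degree. These vanish: the
  Laplacian is symmetric and maps \<open>Y j\<close> to a polynomial of degree below l, which is
  orthogonal to \<open>Y k\<close>.\<close>

lemma lapS_Y: "AE x in sphere_measure. lapS (Y k) x = - lam k * Y k x"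
proof -
  define l where "l = floor_sqrt k"
  have lk: "l\<^sup>2 \<le> k" unfolding l_def by (rule floor_sqrt_power2_le)
  obtain q where q: "pol l q" "\<And>x. norm x = 1 \<Longrightarrow> lapS (Y k) x = - lam k * Y k x + q x"
    using pol_lapS[OF pol_Y[of k]] unfolding l_def lam_def by blast
  have lc: "L2S (lapS (Y j))" for j
    by (rule L2S_lapS_Y)
  have qY: "ipS q (Y j) = 0" if j: "j < l\<^sup>2" for j
  proof -
    have jl: "floor_sqrt j < l" using j by (simp add: floor_sqrt_less_iff)
    obtain r where r: "pol (floor_sqrt j) r" "\<And>x. norm x = 1 \<Longrightarrow> lapS (Y j) x = - lam j * Y j x + r x"
      using pol_lapS[OF pol_Y[of j]] unfolding lam_def by blast
    have pj: "pol l (\<lambda>x. - lam j * Y j x + r x)"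
      using jl by (intro pol_add pol_cmult) (auto intro: pol_mono[OF pol_Y] pol_mono[OF r(1)])
    have "ipS q (Y j) = ipS (\<lambda>x. lapS (Y k) x - (- lam k * Y k x)) (Y j)"
    proof (rule ipS_cong_AE[OF pol_L2S[OF q(1)] _ Y_L2S])
      show "AE x in sphere_measure. q x = lapS (Y k) x - (- lam k * Y k x)"
        using AE_sphere by eventually_elim (simp add: q(2))
    qed (intro L2S_diff L2S_cmult Y_L2S lc)
    also have "\<dots> = ipS (lapS (Y k)) (Y j) - (- lam k) * ipS (Y k) (Y j)"
      unfolding ipS_cmult_left[symmetric] by (intro ipS_diff_left L2S_cmult Y_L2S lc)
    also have "ipS (Y k) (Y j) = 0" using j lk by (simp add: Y_orth)
    also have "ipS (lapS (Y k)) (Y j) = ipS (lapS (Y j)) (Y k)"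
      using lapS_symmetric[OF pol_Y[of k] pol_Y[of j]] ipS_commute[of "Y k" "lapS (Y j)"] by simp
    also have "\<dots> = ipS (\<lambda>x. - lam j * Y j x + r x) (Y k)"
    proof (rule ipS_cong_AE[OF lc pol_L2S[OF pj] Y_L2S])
      show "AE x in sphere_measure. lapS (Y j) x = - lam j * Y j x + r x"
        using AE_sphere by eventually_elim (simp add: r(2))
    qed
    also have "\<dots> = 0" by (rule pol_orth[OF pj lk])
    finally show ?thesis by simp
  qed
  have q0: "q x = 0" if "norm x = 1" for x
    using pol_expansion[OF q(1) that] qY by simp
  show ?thesis using AE_sphere by eventually_elim (simp add: q(2) q0)
qed

lemma integral_Dtan_Y:
  assumes g: "test_fun g"
  shows "(\<integral>x. (\<Sum>m\<in>UNIV. Dtan (Y k) m x * Dtan g m x) \<partial>sphere_measure) = lam k * ipS (Y k) g"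
proof -
  have "ipS (lapS (Y k)) g = ipS (\<lambda>x. - lam k * Y k x) g"
    by (rule ipS_cong_AE[OF _ _ _ lapS_Y])
       (intro L2S_lapS_Y L2S_cmult Y_L2S L2S_continuous test_fun_continuous g)+
  moreover have "ipS (lapS (Y k)) g = - (\<integral>x. (\<Sum>m\<in>UNIV. Dtan (Y k) m x * Dtan g m x) \<partial>sphere_measure)"
    by (intro green Y_test_fun pol_test_fun[OF pol_Dtan[OF pol_Y]] g)
  ultimately show ?thesis unfolding ipS_cmult_left by simp
qed

text \<open>By rotation invariance of \<open>pol n\<close> its reproducing kernel is constant on the diagonal.\<close>

lemma kernel_le:
  assumes x: "norm x = 1" and y: "norm y = 1"
  shows "(\<Sum>k<n\<^sup>2. (Y k y)\<^sup>2) \<le> (\<Sum>k<n\<^sup>2. (Y k x)\<^sup>2)"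
proof -
  obtain Q where Q: "orthogonal_transformation Q" "Q x = y"
    using orthogonal_transformation_exists_1[OF x y] by blast
  \<comment> \<open>\<open>K\<close> is the section at \<open>y\<close> of the reproducing kernel,
    so its value at \<open>y\<close> and its squared norm both equal the left-hand sum. Composition
    with \<open>Q\<close> keeps the norm and moves the value to \<open>x\<close>. Cauchy-Schwarz in
    the expansion of \<open>h\<close> at \<open>x\<close> then bounds h(x)^2 by h(x) times the
    right-hand sum.\<close>
  define K where "K = (\<lambda>z. \<Sum>k<n\<^sup>2. Y k y * Y k z)"
  have pY: "pol n (Y k)" if "k < n\<^sup>2" for k
    using that by (intro pol_mono[OF pol_Y]) (simp add: floor_sqrt_less_iff Suc_le_eq)
  have K: "pol n K" unfolding K_def by (intro pol_sum pol_cmult pY) simp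
  define h where "h = (\<lambda>z. K (Q z))"
  have h: "pol n h" unfolding h_def
    by (rule pol_linear[OF orthogonal_transformation_linear[OF Q(1)] K])
  have hx: "h x = (\<Sum>k<n\<^sup>2. (Y k y)\<^sup>2)" by (simp add: h_def Q(2) K_def power2_eq_square)
  have hh: "ipS h h = (\<Sum>k<n\<^sup>2. (Y k y)\<^sup>2)"
  proof -
    have "ipS h h = ipS K K" unfolding ipS_def h_def
      by (rule integral_sphere_orthogonal[OF Q(1), of "\<lambda>z. K z * K z"])
         (auto intro!: borel_measurable_continuous_onI continuous_intros pol_continuous[OF K])
    also have "\<dots> = (\<Sum>k<n\<^sup>2. Y k y * ipS (Y k) K)"
      by (subst (1) K_def, subst ipS_sum_left) (auto simp: ipS_cmult_left intro!: L2S_cmult Y_L2S pol_L2S[OF K])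
    also have "\<dots> = (\<Sum>k<n\<^sup>2. (Y k y)\<^sup>2)"
    proof (rule sum.cong[OF refl])
      fix k assume k: "k \<in> {..<n\<^sup>2}"
      have "ipS (Y k) K = (\<Sum>j<n\<^sup>2. Y j y * ipS (Y k) (Y j))"
        unfolding K_def by (subst ipS_sum_right) (auto simp: ipS_cmult_right intro!: L2S_cmult Y_L2S)
      also have "\<dots> = (\<Sum>j<n\<^sup>2. if j = k then nY k * Y k y else 0)"
        by (rule sum.cong) (auto simp: Y_orth)
      also have "\<dots> = Y k y" using k by (simp add: Y_nY)
      finally show "Y k y * ipS (Y k) K = (Y k y)\<^sup>2" by (simp add: power2_eq_square)
    qed
    finally show ?thesis .
  qed
  have bessel: "(\<Sum>k<n\<^sup>2. (ipS h (Y k))\<^sup>2) = ipS h h"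
  proof -
    have "ipS h h = ipS (\<lambda>x. \<Sum>k<n\<^sup>2. ipS h (Y k) * Y k x) h"
      by (rule ipS_cong_AE[OF pol_L2S[OF h] _ pol_L2S[OF h] pol_expansion_AE[OF h]])
         (intro L2S_sum L2S_cmult Y_L2S)
    also have "\<dots> = (\<Sum>k<n\<^sup>2. ipS h (Y k) * ipS (Y k) h)"
      by (subst ipS_sum_left) (auto simp: ipS_cmult_left intro!: L2S_cmult Y_L2S pol_L2S[OF h])
    finally show ?thesis by (simp add: power2_eq_square ipS_commute)
  qed
  have "(h x)\<^sup>2 = (\<Sum>k<n\<^sup>2. ipS h (Y k) * Y k x)\<^sup>2" using pol_expansion[OF h x] by simp
  also have "\<dots> \<le> (\<Sum>k<n\<^sup>2. (ipS h (Y k))\<^sup>2) * (\<Sum>k<n\<^sup>2. (Y k x)\<^sup>2)"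
    by (rule Cauchy_Schwarz_ineq_sum)
  finally have le: "h x * h x \<le> h x * (\<Sum>k<n\<^sup>2. (Y k x)\<^sup>2)"
    unfolding bessel hh hx by (simp add: power2_eq_square)
  show ?thesis
  proof (cases "h x > 0")
    case True
    then show ?thesis using le hx by simp
  next
    case False
    then show ?thesis using sum_nonneg[of "{..<n\<^sup>2}" "\<lambda>k. (Y k x)\<^sup>2"] hx by auto
  qed
qed

text \<open>The diagonal of the kernel is dominated by its average over the sphere, and its integral
  counts the non-zero functions among the first n^2.\<close>

lemma kernel_bound:
  assumes y: "norm y = 1"
  shows "4 * pi * (\<Sum>k<n\<^sup>2. (Y k y)\<^sup>2) \<le> real (n\<^sup>2)"
proof -
  have "4 * pi * (\<Sum>k<n\<^sup>2. (Y k y)\<^sup>2) = (\<integral>x. (\<Sum>k<n\<^sup>2. (Y k y)\<^sup>2) \<partial>sphere_measure)"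
    by (simp add: measure_sphere_measure_UNIV)
  also have "\<dots> \<le> (\<integral>x. (\<Sum>k<n\<^sup>2. (Y k x)\<^sup>2) \<partial>sphere_measure)"
  proof (rule integral_mono_AE)
    show "AE x in sphere_measure. (\<Sum>k<n\<^sup>2. (Y k y)\<^sup>2) \<le> (\<Sum>k<n\<^sup>2. (Y k x)\<^sup>2)"
      using AE_sphere by eventually_elim (rule kernel_le[OF _ y])
  qed (auto intro!: integrable_sphere_continuous continuous_intros Y_continuous)
  also have "\<dots> = (\<Sum>k<n\<^sup>2. nY k)"
    unfolding nY_def ipS_self
    by (intro Bochner_Integration.integral_sum integrable_sphere_continuous continuous_intros Y_continuous)
  also have "\<dots> \<le> (\<Sum>k<n\<^sup>2. 1)"
  proof (rule sum_mono)
    show "nY k \<le> 1" for k using nY_cases[of k] by auto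
  qed
  finally show ?thesis by simp
qed

lemma lam_ge:
  assumes "4 ^ M \<le> k" shows "4 ^ M \<le> lam k"
proof -
  have "(2 ^ M)\<^sup>2 = (4 :: nat) ^ M" by (simp add: power2_eq_square power_mult_distrib[symmetric])
  then have "2 ^ M \<le> floor_sqrt k" using assms by (intro le_floor_sqrtI) simp
  then have "2 ^ M * 2 ^ M \<le> floor_sqrt k * (floor_sqrt k + 1)" by (intro mult_le_mono) auto
  then have "real (2 ^ M * 2 ^ M) \<le> lam k" unfolding lam_def by (rule of_nat_mono)
  moreover have "real (2 ^ M * 2 ^ M) = 4 ^ M" by (simp add: power_mult_distrib[symmetric])
  ultimately show ?thesis by simp
qed

text \<open>Induction over dyadic shells: degrees from 2 ^ M to 2 ^ (M + 1) are the indices from 4 ^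
  M to 4 ^ (M + 1). There \<open>lam k\<close> is at least 4 ^ M, while \<open>kernel_bound\<close>
  gives at most 4 * 4 ^ M / (4 \<pi>) for the sum of squares, so a shell contributes at most 1. The
  sum starts at 1 because \<open>lam 0 = 0\<close>. Its growth like the logarithm of the degree is
  what separates H^1 from L^\<infinity>.\<close>

lemma kernel_log_bound:
  assumes y: "norm y = 1"
  shows "(\<Sum>k\<in>{1..<4 ^ M}. (Y k y)\<^sup>2 / lam k) \<le> real M"
proof (induction M)
  case (Suc M)
  have split: "{1..<4 ^ Suc M} = {1..<4 ^ M} \<union> {4 ^ M..<4 ^ Suc M :: nat}"
    using ivl_disj_un_two(3)[of 1 "4 ^ M" "4 ^ Suc M :: nat"] by simp
  have "(\<Sum>k\<in>{4 ^ M..<4 ^ Suc M}. (Y k y)\<^sup>2 / lam k) \<le> (\<Sum>k\<in>{4 ^ M..<4 ^ Suc M}. (Y k y)\<^sup>2 / 4 ^ M)"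
  proof (rule sum_mono)
    fix k assume "k \<in> {4 ^ M..<4 ^ Suc M :: nat}"
    then have "4 ^ M \<le> lam k" by (intro lam_ge) simp
    then show "(Y k y)\<^sup>2 / lam k \<le> (Y k y)\<^sup>2 / 4 ^ M"
      by (intro divide_left_mono) (auto intro!: mult_pos_pos elim: less_le_trans[rotated])
  qed
  also have "\<dots> \<le> (\<Sum>k<(2 ^ Suc M)\<^sup>2. (Y k y)\<^sup>2 / 4 ^ M)"
  proof (rule sum_mono2)
    have "(2 ^ Suc M)\<^sup>2 = (4 :: nat) ^ Suc M" by (simp add: power2_eq_square power_mult_distrib[symmetric])
    then show "{4 ^ M..<4 ^ Suc M} \<subseteq> {..<(2 ^ Suc M)\<^sup>2 :: nat}" by auto
  qed auto
  also have "\<dots> = (\<Sum>k<(2 ^ Suc M)\<^sup>2. (Y k y)\<^sup>2) / 4 ^ M" by (simp add: sum_divide_distrib)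
  also have "\<dots> \<le> 1"
  proof -
    have "4 * 1 * (\<Sum>k<(2 ^ Suc M)\<^sup>2. (Y k y)\<^sup>2) \<le> 4 * pi * (\<Sum>k<(2 ^ Suc M)\<^sup>2. (Y k y)\<^sup>2)"
      using pi_gt3 by (intro mult_right_mono sum_nonneg) auto
    also have "\<dots> \<le> real ((2 ^ Suc M)\<^sup>2)" by (rule kernel_bound[OF y])
    also have "\<dots> = 4 * 4 ^ M" by (simp add: power2_eq_square power_mult_distrib[symmetric])
    finally show ?thesis by (simp add: field_simps)
  qed
  finally have "(\<Sum>k\<in>{4 ^ M..<4 ^ Suc M}. (Y k y)\<^sup>2 / lam k) \<le> 1" .
  moreover have "(\<Sum>k\<in>{1..<4 ^ Suc M}. (Y k y)\<^sup>2 / lam k)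
    = (\<Sum>k\<in>{1..<4 ^ M}. (Y k y)\<^sup>2 / lam k) + (\<Sum>k\<in>{4 ^ M..<4 ^ Suc M}. (Y k y)\<^sup>2 / lam k)"
    unfolding split by (rule sum.union_disjoint) auto
  ultimately show ?case using Suc by simp
qed simp

section \<open>Completeness of the spherical harmonics\<close>

lemma real_polynomial_function_pol:
  assumes "real_polynomial_function (p :: real^3 \<Rightarrow> real)" shows "\<exists>n. pol n p"
  using assms
proof induction
  case (linear f)
  have eq: "f = (\<lambda>x. \<Sum>i\<in>UNIV. x $ i * f (axis i 1))"
  proof
    fix x
    have "f x = f (\<Sum>i\<in>UNIV. x $ i *\<^sub>R axis i 1)"
      by (simp add: basis_expansion scalar_mult_eq_scaleR[symmetric])
    also have "\<dots> = (\<Sum>i\<in>UNIV. x $ i *\<^sub>R f (axis i 1))"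
      using bounded_linear.linear[OF linear] by (simp add: linear_sum linear_scale)
    finally show "f x = (\<Sum>i\<in>UNIV. x $ i * f (axis i 1))" by simp
  qed
  have "pol (Suc (Suc 0)) (\<lambda>x. \<Sum>i\<in>UNIV. x $ i * f (axis i 1))"
    by (intro pol_sum pol_coord pol_const)
  then show ?case using eq by auto
next
  case (const c)
  show ?case using pol_const[of 0 c] by blast
next
  case (add f g)
  then obtain m n where "pol m f" "pol n g" by blast
  then have "pol (max m n) (\<lambda>x. f x + g x)" by (intro pol_add) (auto elim: pol_mono)
  then show ?case by blast
next
  case (mult f g)
  then show ?case using pol_mult by blast
qed

text \<open>Orthogonality extends from the \<open>Y k\<close> to all polynomials, then to continuous
  functions by uniform approximation on the sphere, then to indicators of closed sets as limits of
  cut-off distance functions, and finally to all Borel sets, since the closed sets are stable under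
  intersection and generate them.\<close>

lemma orth_imp_AE_zero:
  assumes f: "L2S f" and orth: "\<And>k. ipS f (Y k) = 0"
  shows "AE x in sphere_measure. f x = 0"
proof -
  have fi: "integrable sphere_measure f" by (rule L2S_integrable[OF f])
  have P: "ipS f p = 0" if p: "pol n p" for n p
  proof -
    have "ipS p f = ipS (\<lambda>x. \<Sum>k<n\<^sup>2. ipS p (Y k) * Y k x) f"
      by (rule ipS_cong_AE[OF pol_L2S[OF p] _ f pol_expansion_AE[OF p]]) (intro L2S_lincomb Y_L2S)
    also have "\<dots> = (\<Sum>k<n\<^sup>2. ipS p (Y k) * ipS (Y k) f)" by (intro ipS_lincomb_left Y_L2S f)
    also have "\<dots> = 0" using orth by (intro sum.neutral) (simp add: ipS_commute)
    finally show ?thesis by (simp add: ipS_commute)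
  qed
  have C: "ipS f g = 0" if g: "continuous_on UNIV g" for g
  proof (rule ccontr)
    assume n: "ipS f g \<noteq> 0"
    \<comment> \<open>The L^1 norm of \<open>f\<close> is increased by 1 to allow division by it and
      to make the final estimate e (I - 1) < e I strict.\<close>
    define I where "I = (\<integral>x. \<bar>f x\<bar> \<partial>sphere_measure) + 1"
    have I: "I > 0" unfolding I_def by (intro add_nonneg_pos) auto
    define e where "e = \<bar>ipS f g\<bar> / I"
    have e: "e > 0" using n I by (simp add: e_def)
    obtain p where p: "real_polynomial_function p" "\<And>x. x \<in> sphere 0 1 \<Longrightarrow> \<bar>g x - p x\<bar> < e"
      using Stone_Weierstrass_real_polynomial_function[of "sphere (0::real^3) 1" g e] e
        continuous_on_subset[OF g] by auto
    obtain m where m: "pol m p" using real_polynomial_function_pol[OF p(1)] by blast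
    note gp = L2S_diff[OF L2S_continuous[OF g] pol_L2S[OF m]]
    have "ipS f g = ipS f (\<lambda>x. g x - p x)"
      using P[OF m] by (simp add: ipS_diff_right L2S_continuous[OF g] pol_L2S[OF m] f)
    then have "\<bar>ipS f g\<bar> \<le> (\<integral>x. \<bar>f x * (g x - p x)\<bar> \<partial>sphere_measure)"
      unfolding ipS_def by (simp add: integral_abs_bound)
    also have "\<dots> \<le> (\<integral>x. e * \<bar>f x\<bar> \<partial>sphere_measure)"
    proof (rule integral_mono_AE)
      show "integrable sphere_measure (\<lambda>x. \<bar>f x * (g x - p x)\<bar>)"
        by (intro integrable_abs L2S_mult_integrable f gp)
      show "integrable sphere_measure (\<lambda>x. e * \<bar>f x\<bar>)" using fi by simp
      show "AE x in sphere_measure. \<bar>f x * (g x - p x)\<bar> \<le> e * \<bar>f x\<bar>"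
        using AE_sphere
      proof eventually_elim
        case (elim x)
        then have "\<bar>g x - p x\<bar> \<le> e" using p(2)[of x] by simp
        from mult_right_mono[OF this, of "\<bar>f x\<bar>"] show ?case by (simp add: abs_mult mult.commute)
      qed
    qed
    also have "\<dots> = e * (I - 1)" by (simp add: I_def)
    also have "\<dots> < e * I" using e by simp
    also have "\<dots> = \<bar>ipS f g\<bar>" using I by (simp add: e_def)
    finally show False by simp
  qed
  have cl: "(\<integral>x\<in>A. f x \<partial>sphere_measure) = 0" if A: "closed A" for A
  proof (cases "A = {}")
    case False
    define g where "g = (\<lambda>n x. max 0 (1 - real n * infdist x A))"
    have gc: "continuous_on UNIV (g n)" for n
      unfolding g_def by (intro continuous_intros)
    have "(\<lambda>n. \<integral>x. f x * g n x \<partial>sphere_measure) \<longlonglongrightarrow> (\<integral>x. indicator A x *\<^sub>R f x \<partial>sphere_measure)"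
    proof (rule integral_dominated_convergence[where w = "\<lambda>x. \<bar>f x\<bar>"])
      show "(\<lambda>x. indicator A x *\<^sub>R f x) \<in> borel_measurable sphere_measure"
        using A f by (intro borel_measurable_scaleR borel_measurable_indicator) (auto simp: L2S_def)
      show "(\<lambda>x. f x * g n x) \<in> borel_measurable sphere_measure" for n
        by (intro borel_measurable_times L2S_measurable[OF f] measurable_sphere_continuous[OF gc])
      show "integrable sphere_measure (\<lambda>x. \<bar>f x\<bar>)" using fi by simp
      show "AE x in sphere_measure. norm (f x * g n x) \<le> \<bar>f x\<bar>" for n
      proof (rule AE_I2)
        fix x
        have "0 \<le> real n * infdist x A" by (simp add: infdist_nonneg)
        then have "\<bar>g n x\<bar> \<le> 1" by (simp add: g_def)
        then show "norm (f x * g n x) \<le> \<bar>f x\<bar>" by (simp add: abs_mult mult_left_le)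
      qed
      show "AE x in sphere_measure. (\<lambda>n. f x * g n x) \<longlonglongrightarrow> indicator A x *\<^sub>R f x"
      proof (rule AE_I2)
        fix x
        have "(\<lambda>n. g n x) \<longlonglongrightarrow> indicator A x"
        proof (cases "x \<in> A")
          case True
          then show ?thesis by (simp add: g_def)
        next
          case nA: False
          then have d: "infdist x A > 0"
            using in_closed_iff_infdist_zero[OF A False, of x] infdist_nonneg[of x A] by linarith
          obtain N where N: "1 < real N * infdist x A" using ex_less_of_nat_mult[OF d] by blast
          have "g n x = 0" if "n \<ge> N" for n
          proof -
            have "real N * infdist x A \<le> real n * infdist x A"
              using that d by (intro mult_right_mono) auto
            then show ?thesis using N by (simp add: g_def)
          qed
          then have "eventually (\<lambda>n. g n x = 0) sequentially"
            by (rule eventually_sequentiallyI)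
          then show ?thesis using nA by (simp add: tendsto_eventually)
        qed
        from tendsto_mult_left[OF this, of "f x"]
        show "(\<lambda>n. f x * g n x) \<longlonglongrightarrow> indicator A x *\<^sub>R f x" by (simp add: mult.commute)
      qed
    qed
    moreover have "(\<integral>x. f x * g n x \<partial>sphere_measure) = 0" for n
      using C[OF gc] by (simp add: ipS_def)
    ultimately show ?thesis by (simp add: set_lebesgue_integral_def LIMSEQ_const_iff)
  qed (simp add: set_lebesgue_integral_def)
  have sint: "set_integrable sphere_measure A f" if "A \<in> sets borel" for A
    unfolding set_integrable_def using fi that by (intro integrable_mult_indicator) auto
  have "(\<integral>x\<in>A. f x \<partial>sphere_measure) = 0" if "A \<in> sets sphere_measure" for A
  proof -
    have sb: "sigma_sets UNIV (Collect closed) = sets (borel :: (real^3) measure)"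
      by (subst borel_eq_closed) (simp add: sets_measure_of)
    have stable: "Int_stable (Collect closed :: (real^3) set set)"
      by (auto simp: Int_stable_def)
    have pow: "Collect closed \<subseteq> Pow (UNIV :: (real^3) set)" by simp
    have "A \<in> sigma_sets UNIV (Collect closed)" using that sb by simp
    then show ?thesis
    proof (induction rule: sigma_sets_induct_disjoint[OF stable pow, consumes 1, case_names basic empty compl union])
      case (basic B) then show ?case using cl by simp
    next
      case empty show ?case by (simp add: set_lebesgue_integral_def)
    next
      case (compl B)
      have B: "B \<in> sets borel" "UNIV - B \<in> sets borel" using compl sb by auto
      have "(\<integral>x\<in>(B \<union> (UNIV - B)). f x \<partial>sphere_measure)
          = (\<integral>x\<in>B. f x \<partial>sphere_measure) + (\<integral>x\<in>(UNIV - B). f x \<partial>sphere_measure)"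
        by (rule set_integral_Un) (auto intro: sint B)
      then show ?case using cl[of UNIV] compl.IH by simp
    next
      case (union B)
      have B: "B i \<in> sets borel" for i using union.hyps sb by auto
      have "(\<integral>x\<in>(\<Union>i. B i). f x \<partial>sphere_measure) = (\<Sum>i. \<integral>x\<in>B i. f x \<partial>sphere_measure)"
        using union.hyps(1) B
        by (intro lebesgue_integral_countable_add sint) (auto simp: disjoint_family_on_def)
      then show ?case using union.IH by simp
    qed
  qed
  then show ?thesis
    by (intro density_unique_real fi) (auto simp: set_lebesgue_integral_def)
qed

section \<open>Completeness of L^2 and expansion in spherical harmonics\<close>

lemma ipS_Cauchy_Schwarz:
  assumes f: "L2S f" and g: "L2S g" shows "(ipS f g)\<^sup>2 \<le> ipS f f * ipS g g"
proof (cases "ipS g g = 0")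
  case True
  then have "AE x in sphere_measure. g x = 0" using ipS_self_eq_0_iff[OF g] by simp
  from ipS_cong_AE[OF g L2S_const f this] show ?thesis using True by (simp add: ipS_commute)
next
  case False
  then have pos: "ipS g g > 0" using ipS_self_nonneg[of g] by simp
  define t where "t = ipS f g / ipS g g"
  have "0 \<le> ipS (\<lambda>x. f x - t * g x) (\<lambda>x. f x - t * g x)" by (rule ipS_self_nonneg)
  also have "\<dots> = ipS f f - 2 * t * ipS f g + t * t * ipS g g"
    using f g by (simp add: ipS_diff_left ipS_diff_right ipS_cmult_left ipS_cmult_right L2S_diff L2S_cmult
       ipS_commute[of g f] algebra_simps)
  also have "\<dots> = ipS f f - (ipS f g)\<^sup>2 / ipS g g"
    using pos by (simp add: t_def power2_eq_square)
  finally show ?thesis using pos by (simp add: field_simps)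
qed

text \<open>Riesz-Fischer: along a fast subsequence the increments are summable in L^1, so it
  converges almost everywhere, and Fatou's lemma carries the Cauchy bound over to the limit. In the
  applications \<open>\<tau>\<close> is the tail of a convergent series of squares.\<close>

lemma L2S_complete:
  assumes S: "\<And>n. L2S (S n)" and t0: "\<tau> \<longlonglongrightarrow> 0"
    and C: "\<And>m n. m \<le> n \<Longrightarrow> ipS (\<lambda>x. S n x - S m x) (\<lambda>x. S n x - S m x) \<le> \<tau> m"
  shows "\<exists>f. L2S f \<and> (\<lambda>n. ipS (\<lambda>x. S n x - f x) (\<lambda>x. S n x - f x)) \<longlonglongrightarrow> 0"
proof -
  have meas [measurable]: "S n \<in> borel_measurable sphere_measure" for n using S by (rule L2S_measurable)
  have "\<exists>N. \<forall>n\<ge>N. \<tau> n \<le> (1/4) ^ j" for j :: nat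
  proof -
    have "eventually (\<lambda>n. \<tau> n < (1/4) ^ j) sequentially"
      using t0 by (rule order_tendstoD) simp
    then show ?thesis by (auto simp: eventually_sequentially intro: less_imp_le)
  qed
  then obtain N where N: "\<And>j n. n \<ge> N j \<Longrightarrow> \<tau> n \<le> (1/4) ^ j" by metis
  \<comment> \<open>Cumulative sums give a monotone choice, and adding 1 at each step forces
    \<open>j \<le> r j\<close> in addition to \<open>N j \<le> r j\<close>.\<close>
  define r where "r = (\<lambda>j. \<Sum>i\<le>j. Suc (N i))"
  have r_le: "r j \<le> r (Suc j)" for j by (simp add: r_def)
  have r_N: "N j \<le> r j" for j
  proof -
    have "Suc (N j) \<le> r j" unfolding r_def by (rule member_le_sum) auto
    then show ?thesis by simp
  qed
  have r_ge: "j \<le> r j" for j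
  proof -
    have "(\<Sum>i\<le>j. 1) \<le> r j" unfolding r_def by (rule sum_mono) simp
    then show ?thesis by simp
  qed
  define D where "D = (\<lambda>j x. \<bar>S (r (Suc j)) x - S (r j) x\<bar>)"
  have L2d: "L2S (\<lambda>x. S n x - S m x)" for m n by (intro L2S_diff S)
  have Dint: "integrable sphere_measure (D j)" for j
    unfolding D_def by (intro integrable_abs L2S_integrable L2d)
  \<comment> \<open>From s \<le> (2 ^ j s^2 + 2 ^ (-j)) / 2 and the area 4 \<pi> the integral is at
    most (1 + 4 \<pi>) / 2 times 2 ^ (-j), and (1 + 4 \<pi>) / 2 is below 7.\<close>
  have Dle: "(\<integral>x. D j x \<partial>sphere_measure) \<le> 7 * (1/2) ^ j" for j
  proof -
    let ?d = "\<lambda>x. S (r (Suc j)) x - S (r j) x"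
    have "(\<integral>x. D j x \<partial>sphere_measure)
        \<le> (\<integral>x. (2 ^ j * (?d x)\<^sup>2 + (1/2) ^ j) / 2 \<partial>sphere_measure)"
    proof (rule integral_mono[OF Dint])
      show "integrable sphere_measure (\<lambda>x. (2 ^ j * (?d x)\<^sup>2 + (1/2) ^ j) / 2)"
        using L2d[of "r (Suc j)" "r j"] by (simp add: L2S_def)
      fix x
      have "0 \<le> (1/2) ^ j * (2 ^ j * \<bar>?d x\<bar> - 1)\<^sup>2" by simp
      also have "\<dots> = (1/2) ^ j * 2 ^ j * (2 ^ j * (\<bar>?d x\<bar>)\<^sup>2) - 2 * ((1/2) ^ j * 2 ^ j) * \<bar>?d x\<bar> + (1/2) ^ j"
        by (simp add: power2_eq_square algebra_simps)
      also have "(1/2) ^ j * 2 ^ j = (1::real)" by (simp add: power_mult_distrib[symmetric])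
      finally show "D j x \<le> (2 ^ j * (?d x)\<^sup>2 + (1/2) ^ j) / 2" by (simp add: D_def)
    qed
    also have "\<dots> = (2 ^ j * ipS ?d ?d + 4 * pi * (1/2) ^ j) / 2"
      unfolding ipS_self using L2d[of "r (Suc j)" "r j"]
      by (simp add: L2S_def measure_sphere_measure_UNIV)
    also have "\<dots> \<le> (2 ^ j * (1/4) ^ j + 4 * pi * (1/2) ^ j) / 2"
      using C[OF r_le[of j]] N[OF r_N[of j]]
      by (intro divide_right_mono add_right_mono mult_left_mono) auto
    also have "2 ^ j * (1/4 :: real) ^ j = (1/2) ^ j" by (simp add: power_mult_distrib[symmetric])
    also have "((1/2) ^ j + 4 * pi * (1/2) ^ j) / 2 = ((1 + 4 * pi) / 2) * (1/2) ^ j"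
      by (simp add: field_simps)
    also have "\<dots> \<le> 7 * (1/2) ^ j"
    proof (rule mult_right_mono)
      have "pi \<le> 3.2" by (rule order_trans[OF pi_approx(2)]) simp
      then show "(1 + 4 * pi) / 2 \<le> 7" by simp
    qed simp
    finally show ?thesis .
  qed
  have Dnn: "0 \<le> D j x" for j x by (simp add: D_def)
  have Dm [measurable]: "D j \<in> borel_measurable sphere_measure" for j
    using Dint by (rule borel_measurable_integrable)
  have "AE x in sphere_measure. (\<Sum>j. ennreal (D j x)) \<noteq> \<infinity>"
  proof (rule nn_integral_noteq_infinite)
    have "(\<integral>\<^sup>+x. (\<Sum>j. ennreal (D j x)) \<partial>sphere_measure) = (\<Sum>j. \<integral>\<^sup>+x. ennreal (D j x) \<partial>sphere_measure)"
      by (rule nn_integral_suminf) measurable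
    also have "\<dots> = (\<Sum>j. ennreal (\<integral>x. D j x \<partial>sphere_measure))"
      by (intro suminf_cong nn_integral_eq_integral Dint) (simp add: Dnn)
    also have "\<dots> \<le> (\<Sum>j. ennreal (7 * (1/2) ^ j))"
      by (intro suminf_le summableI ennreal_leI Dle)
    also have "(\<Sum>j. ennreal (7 * (1/2) ^ j)) < \<infinity>"
    proof -
      have "(\<Sum>j. ennreal (7 * (1/2) ^ j)) \<noteq> top"
        by (rule ennreal_suminf_neq_top) (intro summable_mult summable_geometric, auto)
      then show ?thesis by (simp only: infinity_ennreal_def less_top)
    qed
    finally show "(\<integral>\<^sup>+x. (\<Sum>j. ennreal (D j x)) \<partial>sphere_measure) \<noteq> \<infinity>" by simp
  qed measurable
  then have conv: "AE x in sphere_measure. convergent (\<lambda>j. S (r j) x)"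
  proof eventually_elim
    case (elim x)
    have "summable (\<lambda>j. \<bar>S (r (Suc j)) x - S (r j) x\<bar>)"
    proof (rule summable_suminf_not_top)
      show "(\<Sum>j. ennreal \<bar>S (r (Suc j)) x - S (r j) x\<bar>) \<noteq> top"
        using elim by (simp only: D_def infinity_ennreal_def not_False_eq_True)
    qed simp
    then have "summable (\<lambda>j. S (r (Suc j)) x - S (r j) x)" by (rule summable_rabs_cancel)
    then have "convergent (\<lambda>n. \<Sum>j<n. S (r (Suc j)) x - S (r j) x)" by (simp add: summable_iff_convergent)
    then have "convergent (\<lambda>n. S (r n) x - S (r 0) x)" by (simp add: sum_lessThan_telescope[of "\<lambda>j. S (r j) x"])
    from convergent_add[OF this convergent_const[of "S (r 0) x"]] show ?case by simp
  qed
  define f where "f = (\<lambda>x. lim (\<lambda>j. S (r j) x))"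
  have fm [measurable]: "f \<in> borel_measurable sphere_measure" unfolding f_def by measurable
  have lim: "AE x in sphere_measure. (\<lambda>j. S (r j) x) \<longlonglongrightarrow> f x"
    using conv by eventually_elim (simp add: f_def convergent_LIMSEQ_iff)
  have fat: "(\<integral>\<^sup>+x. ennreal ((f x - S m x)\<^sup>2) \<partial>sphere_measure) \<le> ennreal (\<tau> m)" for m
  proof -
    have "(\<integral>\<^sup>+x. ennreal ((f x - S m x)\<^sup>2) \<partial>sphere_measure)
        = (\<integral>\<^sup>+x. liminf (\<lambda>j. ennreal ((S (r j) x - S m x)\<^sup>2)) \<partial>sphere_measure)"
    proof (rule nn_integral_cong_AE)
      show "AE x in sphere_measure. ennreal ((f x - S m x)\<^sup>2) = liminf (\<lambda>j. ennreal ((S (r j) x - S m x)\<^sup>2))"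
        using lim
      proof eventually_elim
        case (elim x)
        have "(\<lambda>j. ennreal ((S (r j) x - S m x)\<^sup>2)) \<longlonglongrightarrow> ennreal ((f x - S m x)\<^sup>2)"
          by (intro tendsto_intros elim)
        from lim_imp_Liminf[OF _ this] show ?case by (rule sym) simp
      qed
    qed
    also have "\<dots> \<le> liminf (\<lambda>j. \<integral>\<^sup>+x. ennreal ((S (r j) x - S m x)\<^sup>2) \<partial>sphere_measure)"
      by (rule nn_integral_liminf) measurable
    also have "\<dots> \<le> liminf (\<lambda>j. ennreal (\<tau> m))"
    proof (rule Liminf_mono)
      show "\<forall>\<^sub>F j in sequentially. (\<integral>\<^sup>+x. ennreal ((S (r j) x - S m x)\<^sup>2) \<partial>sphere_measure) \<le> ennreal (\<tau> m)"
        using eventually_ge_at_top[of m]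
      proof eventually_elim
        case (elim j)
        have "(\<integral>\<^sup>+x. ennreal ((S (r j) x - S m x)\<^sup>2) \<partial>sphere_measure)
            = ennreal (ipS (\<lambda>x. S (r j) x - S m x) (\<lambda>x. S (r j) x - S m x))"
          unfolding ipS_self using L2d[of "r j" m]
          by (intro nn_integral_eq_integral) (auto simp: L2S_def)
        then show ?case using C[of m "r j"] elim r_ge[of j] by (simp add: ennreal_leI)
      qed
    qed
    also have "\<dots> = ennreal (\<tau> m)" by (simp add: Liminf_const)
    finally show ?thesis .
  qed
  have L2fd: "L2S (\<lambda>x. f x - S m x)" for m
    unfolding L2S_def
  proof
    show "integrable sphere_measure (\<lambda>x. (f x - S m x)\<^sup>2)"
    proof (rule integrableI_nonneg)
      show "(\<integral>\<^sup>+x. ennreal ((f x - S m x)\<^sup>2) \<partial>sphere_measure) < \<infinity>"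
        using fat[of m] by (simp add: order.strict_trans1)
    qed auto
  qed measurable
  have L2f: "L2S f" using L2S_add[OF L2fd[of 0] S[of 0]] by simp
  have le: "ipS (\<lambda>x. S m x - f x) (\<lambda>x. S m x - f x) \<le> max 0 (\<tau> m)" for m
  proof -
    have "ennreal (\<integral>x. (f x - S m x)\<^sup>2 \<partial>sphere_measure) = (\<integral>\<^sup>+x. ennreal ((f x - S m x)\<^sup>2) \<partial>sphere_measure)"
      using L2fd[of m] by (intro nn_integral_eq_integral[symmetric]) (auto simp: L2S_def)
    also have "\<dots> \<le> ennreal (max 0 (\<tau> m))" using fat[of m] by (simp add: ennreal_max_0)
    finally have "(\<integral>x. (f x - S m x)\<^sup>2 \<partial>sphere_measure) \<le> max 0 (\<tau> m)"
      by (subst (asm) ennreal_le_iff) auto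
    then show ?thesis unfolding ipS_self by (simp add: power2_commute)
  qed
  have "(\<lambda>n. ipS (\<lambda>x. S n x - f x) (\<lambda>x. S n x - f x)) \<longlonglongrightarrow> 0"
  proof (rule tendsto_sandwich[OF _ _ tendsto_const])
    show "(\<lambda>m. max 0 (\<tau> m)) \<longlonglongrightarrow> 0" using tendsto_max[OF tendsto_const[of 0] t0] by simp
  qed (auto simp: ipS_self_nonneg le)
  with L2f show ?thesis by blast
qed

definition L2lim :: "(nat \<Rightarrow> real^3 \<Rightarrow> real) \<Rightarrow> (real^3 \<Rightarrow> real) \<Rightarrow> bool" where
  "L2lim S f \<longleftrightarrow> (\<forall>n. L2S (S n)) \<and> L2S f \<and> (\<lambda>n. ipS (\<lambda>x. S n x - f x) (\<lambda>x. S n x - f x)) \<longlonglongrightarrow> 0"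

lemma L2lim_ipS:
  assumes S: "L2lim S f" and g: "L2S g"
  shows "(\<lambda>n. ipS (S n) g) \<longlonglongrightarrow> ipS f g"
proof -
  have L: "L2S (S n)" "L2S f" for n using S by (auto simp: L2lim_def)
  have "(\<lambda>n. ipS (S n) g - ipS f g) \<longlonglongrightarrow> 0"
  proof (rule Lim_null_comparison)
    show "(\<lambda>n. sqrt (ipS (\<lambda>x. S n x - f x) (\<lambda>x. S n x - f x) * ipS g g)) \<longlonglongrightarrow> 0"
    proof -
      have "(\<lambda>n. ipS (\<lambda>x. S n x - f x) (\<lambda>x. S n x - f x)) \<longlonglongrightarrow> 0"
        using S by (simp add: L2lim_def)
      from tendsto_real_sqrt[OF tendsto_mult[OF this tendsto_const[of "ipS g g"]]] show ?thesis by simp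
    qed
    show "\<forall>\<^sub>F n in sequentially. norm (ipS (S n) g - ipS f g) \<le> sqrt (ipS (\<lambda>x. S n x - f x) (\<lambda>x. S n x - f x) * ipS g g)"
    proof (rule always_eventually, rule allI)
      fix n
      have "(ipS (S n) g - ipS f g)\<^sup>2 = (ipS (\<lambda>x. S n x - f x) g)\<^sup>2"
        using L g by (simp add: ipS_diff_left)
      also have "\<dots> \<le> ipS (\<lambda>x. S n x - f x) (\<lambda>x. S n x - f x) * ipS g g"
        by (intro ipS_Cauchy_Schwarz L2S_diff L g)
      finally show "norm (ipS (S n) g - ipS f g) \<le> sqrt (ipS (\<lambda>x. S n x - f x) (\<lambda>x. S n x - f x) * ipS g g)"
        by (simp add: real_le_rsqrt)
    qed
  qed
  then show ?thesis by (simp add: LIM_zero_iff)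
qed

lemma L2lim_norm:
  assumes S: "L2lim S f" shows "(\<lambda>n. ipS (S n) (S n)) \<longlonglongrightarrow> ipS f f"
proof -
  have L: "L2S (S n)" "L2S f" for n using S by (auto simp: L2lim_def)
  have "(\<lambda>n. ipS (\<lambda>x. S n x - f x) (\<lambda>x. S n x - f x) + 2 * ipS (S n) f - ipS f f) \<longlonglongrightarrow> 0 + 2 * ipS f f - ipS f f"
    using S L2lim_ipS[OF S L(2)] by (intro tendsto_intros) (auto simp: L2lim_def)
  moreover have "ipS (\<lambda>x. S n x - f x) (\<lambda>x. S n x - f x) + 2 * ipS (S n) f - ipS f f = ipS (S n) (S n)" for n
    using L by (simp add: ipS_diff_left ipS_diff_right L2S_diff ipS_commute[of f "S n"])
  ultimately show ?thesis by simp
qed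

lemma ipS_Y_sums:
  "ipS (\<lambda>x. \<Sum>k\<in>K. a k * Y k x) (\<lambda>x. \<Sum>k\<in>K. a k * Y k x) = (\<Sum>k\<in>K. (a k)\<^sup>2 * nY k)" if "finite K"
proof -
  have "ipS (\<lambda>x. \<Sum>k\<in>K. a k * Y k x) (\<lambda>x. \<Sum>k\<in>K. a k * Y k x)
      = (\<Sum>k\<in>K. a k * (\<Sum>j\<in>K. a j * ipS (Y k) (Y j)))"
    by (subst ipS_lincomb_left) (auto intro!: Y_L2S L2S_lincomb simp: ipS_lincomb_right Y_L2S)
  also have "\<dots> = (\<Sum>k\<in>K. a k * (\<Sum>j\<in>K. if j = k then a k * nY k else 0))"
    by (intro sum.cong refl arg_cong2[where f = "(*)"]) (auto simp: Y_orth)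
  also have "\<dots> = (\<Sum>k\<in>K. (a k)\<^sup>2 * nY k)"
    using that by (simp add: power2_eq_square mult.assoc)
  finally show ?thesis .
qed

lemma nY_le_1: "nY k \<le> 1"
  using nY_cases[of k] by auto

lemma synth_exists:
  fixes c :: "nat \<Rightarrow> real"
  assumes c: "summable (\<lambda>k. (c k)\<^sup>2)"
  shows "\<exists>f. L2lim (\<lambda>n x. \<Sum>k<n. c k * Y k x) f \<and> (\<forall>k. ipS f (Y k) = c k * nY k)"
proof -
  define S where "S = (\<lambda>n x. \<Sum>k<n. c k * Y k x)"
  have S: "L2S (S n)" for n unfolding S_def by (intro L2S_lincomb Y_L2S)
  have "\<exists>f. L2S f \<and> (\<lambda>n. ipS (\<lambda>x. S n x - f x) (\<lambda>x. S n x - f x)) \<longlonglongrightarrow> 0"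
  proof (rule L2S_complete[OF S])
    show "(\<lambda>m. (\<Sum>k. (c k)\<^sup>2) - (\<Sum>k<m. (c k)\<^sup>2)) \<longlonglongrightarrow> 0"
      using tendsto_diff[OF tendsto_const summable_LIMSEQ[OF c], of "\<Sum>k. (c k)\<^sup>2"] by simp
    fix m n :: nat assume mn: "m \<le> n"
    have "(\<lambda>x. S n x - S m x) = (\<lambda>x. \<Sum>k\<in>{m..<n}. c k * Y k x)"
      using mn by (auto simp: S_def sum_diff_nat_ivl[of 0 m n, symmetric] atLeast0LessThan[symmetric])
    then have "ipS (\<lambda>x. S n x - S m x) (\<lambda>x. S n x - S m x) = (\<Sum>k\<in>{m..<n}. (c k)\<^sup>2 * nY k)"
      by (simp add: ipS_Y_sums)
    also have "\<dots> \<le> (\<Sum>k\<in>{m..<n}. (c k)\<^sup>2)"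
      by (intro sum_mono) (simp add: nY_le_1 mult_left_le)
    also have "\<dots> = (\<Sum>k<n. (c k)\<^sup>2) - (\<Sum>k<m. (c k)\<^sup>2)"
      using mn by (simp add: sum_diff_nat_ivl[of 0 m n, symmetric] atLeast0LessThan[symmetric])
    also have "\<dots> \<le> (\<Sum>k. (c k)\<^sup>2) - (\<Sum>k<m. (c k)\<^sup>2)"
      by (intro diff_right_mono sum_le_suminf c) auto
    finally show "ipS (\<lambda>x. S n x - S m x) (\<lambda>x. S n x - S m x) \<le> (\<Sum>k. (c k)\<^sup>2) - (\<Sum>k<m. (c k)\<^sup>2)" .
  qed
  then obtain f where f: "L2lim S f" using S by (auto simp: L2lim_def)
  have "ipS f (Y k) = c k * nY k" for k
  proof (rule LIMSEQ_unique[OF L2lim_ipS[OF f Y_L2S]])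
    have "ipS (S n) (Y k) = c k * nY k" if "n > k" for n
    proof -
      have "ipS (S n) (Y k) = (\<Sum>j<n. c j * ipS (Y j) (Y k))"
        unfolding S_def by (intro ipS_lincomb_left Y_L2S)
      also have "\<dots> = (\<Sum>j<n. if j = k then c k * nY k else 0)" by (rule sum.cong) (auto simp: Y_orth)
      also have "\<dots> = c k * nY k" using that by simp
      finally show ?thesis .
    qed
    then have "eventually (\<lambda>n. ipS (S n) (Y k) = c k * nY k) sequentially"
      by (rule eventually_mono[OF eventually_gt_at_top[of k]])
    then show "(\<lambda>n. ipS (S n) (Y k)) \<longlonglongrightarrow> c k * nY k" by (rule tendsto_eventually)
  qed
  with f show ?thesis unfolding S_def by blast
qed

lemma ipS_Y_nY: "ipS f (Y k) * nY k = ipS f (Y k)"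
  using nY_cases[of k] by auto

lemma bessel_sum:
  assumes f: "L2S f" shows "(\<Sum>k<n. (ipS f (Y k))\<^sup>2) \<le> ipS f f"
proof -
  define s where "s = (\<lambda>x. \<Sum>k<n. ipS f (Y k) * Y k x)"
  have s: "L2S s" unfolding s_def by (intro L2S_lincomb Y_L2S)
  have ss: "ipS s s = (\<Sum>k<n. (ipS f (Y k))\<^sup>2)"
    unfolding s_def by (subst ipS_Y_sums) (auto simp: power2_eq_square mult.assoc ipS_Y_nY)
  have fs: "ipS f s = (\<Sum>k<n. (ipS f (Y k))\<^sup>2)"
    unfolding s_def by (simp add: ipS_lincomb_right Y_L2S f power2_eq_square)
  have "0 \<le> ipS (\<lambda>x. f x - s x) (\<lambda>x. f x - s x)" by (rule ipS_self_nonneg)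
  also have "\<dots> = ipS f f - 2 * ipS f s + ipS s s"
    using f s by (simp add: ipS_diff_left ipS_diff_right L2S_diff ipS_commute[of s f])
  finally show ?thesis by (simp add: ss fs)
qed

lemma bessel_summable: "L2S f \<Longrightarrow> summable (\<lambda>k. (ipS f (Y k))\<^sup>2)"
  by (rule summableI_nonneg_bounded[where x = "ipS f f"]) (auto simp: bessel_sum)

lemma L2S_eqI_AE:
  assumes f: "L2S f" and g: "L2S g" and eq: "\<And>k. ipS f (Y k) = ipS g (Y k)"
  shows "AE x in sphere_measure. f x = g x"
proof -
  have "AE x in sphere_measure. f x - g x = 0"
    by (rule orth_imp_AE_zero) (auto intro: L2S_diff f g simp: ipS_diff_left f g Y_L2S eq)
  then show ?thesis by simp
qed

text \<open>The partial sums converge to some function by \<open>synth_exists\<close>; it has the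
  same coefficients as \<open>f\<close>, so completeness of the system identifies the two almost
  everywhere.\<close>

lemma L2lim_expansion:
  assumes f: "L2S f" shows "L2lim (\<lambda>n x. \<Sum>k<n. ipS f (Y k) * Y k x) f"
proof -
  obtain g where g: "L2lim (\<lambda>n x. \<Sum>k<n. ipS f (Y k) * Y k x) g" "\<And>k. ipS g (Y k) = ipS f (Y k) * nY k"
    using synth_exists[OF bessel_summable[OF f]] by blast
  have gL: "L2S g" using g by (simp add: L2lim_def)
  have ae: "AE x in sphere_measure. f x = g x"
    by (rule L2S_eqI_AE[OF f gL]) (simp add: g(2) ipS_Y_nY)
  have "ipS (\<lambda>x. (\<Sum>k<n. ipS f (Y k) * Y k x) - f x) (\<lambda>x. (\<Sum>k<n. ipS f (Y k) * Y k x) - f x)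
     = ipS (\<lambda>x. (\<Sum>k<n. ipS f (Y k) * Y k x) - g x) (\<lambda>x. (\<Sum>k<n. ipS f (Y k) * Y k x) - g x)" for n
    unfolding ipS_self
  proof (rule integral_cong_AE)
    have L: "L2S (\<lambda>x. (\<Sum>k<n. ipS f (Y k) * Y k x) - h x)" if "L2S h" for h
      by (intro L2S_diff L2S_lincomb Y_L2S that)
    show "(\<lambda>x. ((\<Sum>k<n. ipS f (Y k) * Y k x) - f x)\<^sup>2) \<in> borel_measurable sphere_measure"
      by (intro borel_measurable_power L2S_measurable L f)
    show "(\<lambda>x. ((\<Sum>k<n. ipS f (Y k) * Y k x) - g x)\<^sup>2) \<in> borel_measurable sphere_measure"
      by (intro borel_measurable_power L2S_measurable L gL)
  qed (use ae in auto)
  then show ?thesis using g f by (simp add: L2lim_def)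
qed

lemma parseval:
  assumes f: "L2S f" and g: "L2S g"
  shows "(\<lambda>k. ipS f (Y k) * ipS g (Y k)) sums ipS f g"
proof -
  have "ipS (\<lambda>x. \<Sum>k<n. ipS f (Y k) * Y k x) g = (\<Sum>k<n. ipS f (Y k) * ipS g (Y k))" for n
    by (simp add: ipS_lincomb_left Y_L2S g ipS_commute[of g])
  then show ?thesis using L2lim_ipS[OF L2lim_expansion[OF f] g] by (simp add: sums_def)
qed

definition cf :: "(real^3 \<Rightarrow> real) \<Rightarrow> l2" where
  "cf f = Abs_l2 (\<lambda>k. ipS f (Y k))"

lemma l2_nth_cf: "L2S f \<Longrightarrow> l2_nth (cf f) k = ipS f (Y k)"
  by (simp add: cf_def l2_nth_Abs bessel_summable)

lemma inner_cf: "L2S f \<Longrightarrow> L2S g \<Longrightarrow> cf f \<bullet> cf g = ipS f g"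
  by (simp add: inner_l2_def l2_nth_cf sums_unique[OF parseval, symmetric])

lemma norm_cf: "L2S f \<Longrightarrow> (norm (cf f))\<^sup>2 = ipS f f"
  by (simp add: power2_norm_eq_inner inner_cf)

lemma cf_diff: "L2S f \<Longrightarrow> L2S g \<Longrightarrow> cf (\<lambda>x. f x - g x) = cf f - cf g"
  by (rule l2_eqI) (simp add: l2_nth_cf L2S_diff ipS_diff_left Y_L2S)

text \<open>Right inverse of \<open>cf\<close> up to the factor \<open>nY k\<close>; the function
  picked is determined up to a null set.\<close>

definition synth :: "l2 \<Rightarrow> real^3 \<Rightarrow> real" where
  "synth c = (SOME f. L2S f \<and> (\<forall>k. ipS f (Y k) = l2_nth c k * nY k))"

lemma synth: "L2S (synth c)" "ipS (synth c) (Y k) = l2_nth c k * nY k"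
proof -
  have "\<exists>f. L2S f \<and> (\<forall>k. ipS f (Y k) = l2_nth c k * nY k)"
    using synth_exists[OF summable_l2[of c]] by (auto simp: L2lim_def)
  from someI_ex[OF this] show "L2S (synth c)" "ipS (synth c) (Y k) = l2_nth c k * nY k"
    unfolding synth_def by auto
qed

section \<open>Weak gradients in terms of the expansion coefficients\<close>

lemma ipS_diff_self:
  assumes "L2S f" "L2S g"
  shows "ipS (\<lambda>x. f x - g x) (\<lambda>x. f x - g x) = ipS f f - 2 * ipS f g + ipS g g"
  using assms by (simp add: ipS_diff_left ipS_diff_right L2S_diff ipS_commute[of g f])

lemma lam_nonneg: "0 \<le> lam k" by (simp add: lam_def)

lemma lam_0: "lam 0 = 0" by (simp add: lam_def)

lemma lam_ge_2: "k \<ge> 1 \<Longrightarrow> 2 \<le> lam k"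
proof -
  assume "k \<ge> 1"
  then have "floor_sqrt k \<ge> 1" using floor_sqrt_greater_zero_iff[of k] by linarith
  then have "1 * (1 + 1) \<le> floor_sqrt k * (floor_sqrt k + 1)" by (intro mult_le_mono) auto
  then have "real (1 * (1 + 1)) \<le> lam k" unfolding lam_def by (rule of_nat_mono)
  then show ?thesis by simp
qed

lemma DY_L2S: "L2S (Dtan (Y k) m)"
  by (intro L2S_continuous continuous_on_Dtan Y_test_fun)

lemma DY_test_fun: "test_fun (Dtan (Y k) m)"
  by (rule pol_test_fun[OF pol_Dtan[OF pol_Y]])

lemma DY_orth: "(\<Sum>m\<in>UNIV. ipS (Dtan (Y k) m) (Dtan (Y j) m)) = (if k = j then lam k * nY k else 0)"
proof -
  have "(\<Sum>m\<in>UNIV. ipS (Dtan (Y k) m) (Dtan (Y j) m))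
      = (\<integral>x. (\<Sum>m\<in>UNIV. Dtan (Y k) m x * Dtan (Y j) m x) \<partial>sphere_measure)"
    unfolding ipS_def by (intro Bochner_Integration.integral_sum[symmetric] L2S_mult_integrable DY_L2S)
  then show ?thesis using integral_Dtan_Y[OF Y_test_fun, of k j] Y_orth[of k j] by simp
qed

lemma DY_sums:
  assumes "finite K"
  shows "(\<Sum>m\<in>UNIV. ipS (\<lambda>x. \<Sum>k\<in>K. a k * Dtan (Y k) m x) (\<lambda>x. \<Sum>k\<in>K. a k * Dtan (Y k) m x))
      = (\<Sum>k\<in>K. lam k * (a k)\<^sup>2 * nY k)"
proof -
  have "(\<Sum>m\<in>UNIV. ipS (\<lambda>x. \<Sum>k\<in>K. a k * Dtan (Y k) m x) (\<lambda>x. \<Sum>k\<in>K. a k * Dtan (Y k) m x))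
      = (\<Sum>m\<in>UNIV. \<Sum>k\<in>K. \<Sum>j\<in>K. a k * a j * ipS (Dtan (Y k) m) (Dtan (Y j) m))"
    by (subst ipS_lincomb_left)
       (auto intro!: DY_L2S L2S_lincomb simp: ipS_lincomb_right DY_L2S sum_distrib_left mult.assoc)
  also have "\<dots> = (\<Sum>k\<in>K. \<Sum>m\<in>UNIV. \<Sum>j\<in>K. a k * a j * ipS (Dtan (Y k) m) (Dtan (Y j) m))"
    by (rule sum.swap)
  also have "\<dots> = (\<Sum>k\<in>K. \<Sum>j\<in>K. \<Sum>m\<in>UNIV. a k * a j * ipS (Dtan (Y k) m) (Dtan (Y j) m))"
    by (intro sum.cong refl sum.swap)
  also have "\<dots> = (\<Sum>k\<in>K. \<Sum>j\<in>K. if j = k then lam k * (a k)\<^sup>2 * nY k else 0)"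
    by (intro sum.cong refl) (auto simp: sum_distrib_left[symmetric] DY_orth power2_eq_square)
  also have "\<dots> = (\<Sum>k\<in>K. lam k * (a k)\<^sup>2 * nY k)" using assms by simp
  finally show ?thesis .
qed

text \<open>\<open>Dtan (Y k) m\<close> is itself a test function. Inserting it into the definition
  of the weak gradient and summing over m turns the left-hand side into \<open>u\<close> against the
  Laplacian of \<open>Y k\<close>, while the curvature terms cancel by tangentiality.\<close>

lemma wgrad_coef:
  assumes u: "L2S u" and G: "is_wgrad u G"
  shows "(\<Sum>m\<in>UNIV. ipS (\<lambda>x. G x $ m) (Dtan (Y k) m)) = lam k * ipS u (Y k)"
proof -
  have GL: "L2S (\<lambda>x. G x $ m)" for m using G by (simp add: is_wgrad_def)
  have eq: "ipS u (Dtan (Dtan (Y k) m) m)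
      = - ipS (\<lambda>x. G x $ m) (Dtan (Y k) m) + 2 * ipS (\<lambda>x. x $ m * u x) (Dtan (Y k) m)" for m
    using G DY_test_fun[of k m] unfolding is_wgrad_def ipS_def by blast
  have L: "L2S (Dtan (Dtan (Y k) m) m)" for m
    by (intro L2S_continuous continuous_on_Dtan DY_test_fun)
  have "(\<Sum>m\<in>UNIV. ipS u (Dtan (Dtan (Y k) m) m)) = ipS u (lapS (Y k))"
    unfolding lapS_def[abs_def] by (intro ipS_sum_right[symmetric] L u)
  also have "\<dots> = ipS (\<lambda>x. - lam k * Y k x) u"
    unfolding ipS_commute[of u]
    by (rule ipS_cong_AE[OF L2S_lapS_Y _ u lapS_Y]) (intro L2S_cmult Y_L2S)
  also have "\<dots> = - lam k * ipS u (Y k)"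
    by (simp only: ipS_cmult_left ipS_commute[of u])
  finally have 1: "(\<Sum>m\<in>UNIV. ipS u (Dtan (Dtan (Y k) m) m)) = - lam k * ipS u (Y k)" .
  have "(\<Sum>m\<in>UNIV. ipS (\<lambda>x. x $ m * u x) (Dtan (Y k) m)) = (\<Sum>m\<in>UNIV. ipS u (\<lambda>x. x $ m * Dtan (Y k) m x))"
    by (simp add: ipS_def ac_simps)
  also have "\<dots> = ipS u (\<lambda>x. \<Sum>m\<in>UNIV. x $ m * Dtan (Y k) m x)"
    by (intro ipS_sum_right[symmetric] L2S_mult_continuous DY_L2S u continuous_intros)
  also have "\<dots> = ipS (\<lambda>x. 0) u"
    unfolding ipS_commute[of u]
  proof (rule ipS_cong_AE)
    show "AE x in sphere_measure. (\<Sum>m\<in>UNIV. x $ m * Dtan (Y k) m x) = 0"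
      using AE_sphere by eventually_elim (rule Dtan_radial_zero[OF Y_test_fun])
  qed (intro L2S_sum L2S_mult_continuous DY_L2S u continuous_intros L2S_const)+
  finally have 2: "(\<Sum>m\<in>UNIV. ipS (\<lambda>x. x $ m * u x) (Dtan (Y k) m)) = 0" by simp
  have "(\<Sum>m\<in>UNIV. ipS u (Dtan (Dtan (Y k) m) m))
      = - (\<Sum>m\<in>UNIV. ipS (\<lambda>x. G x $ m) (Dtan (Y k) m))
        + 2 * (\<Sum>m\<in>UNIV. ipS (\<lambda>x. x $ m * u x) (Dtan (Y k) m))"
    unfolding eq by (simp add: sum_subtractf sum_distrib_left)
  then show ?thesis unfolding 1 2 by simp
qed

text \<open>Bessel's inequality for gradients: the tangential gradients of the \<open>Y k\<close>
  are mutually orthogonal with squared norms \<open>lam k * nY k\<close>, and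
  \<open>wgrad_coef\<close> supplies their inner products with \<open>G\<close>.\<close>

lemma H1S_summable:
  assumes "H1S u" shows "summable (\<lambda>k. lam k * (ipS u (Y k))\<^sup>2)"
proof -
  obtain G where u: "L2S u" and G: "is_wgrad u G" using assms by (auto simp: H1S_def)
  have GL: "L2S (\<lambda>x. G x $ m)" for m using G by (simp add: is_wgrad_def)
  define c where "c = (\<lambda>k. ipS u (Y k))"
  show ?thesis
  proof (rule summableI_nonneg_bounded[where x = "\<Sum>m\<in>UNIV. ipS (\<lambda>x. G x $ m) (\<lambda>x. G x $ m)"])
    fix n
    define V where "V = (\<lambda>m x. \<Sum>k<n. c k * Dtan (Y k) m x)"
    have V: "L2S (V m)" for m unfolding V_def by (intro L2S_lincomb DY_L2S)
    have VV: "(\<Sum>m\<in>UNIV. ipS (V m) (V m)) = (\<Sum>k<n. lam k * (c k)\<^sup>2)"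
    proof -
      have "(\<Sum>m\<in>UNIV. ipS (V m) (V m)) = (\<Sum>k<n. lam k * (c k)\<^sup>2 * nY k)"
        unfolding V_def by (rule DY_sums) simp
      also have "\<dots> = (\<Sum>k<n. lam k * (c k)\<^sup>2)"
        by (intro sum.cong refl) (simp add: c_def power2_eq_square mult.assoc ipS_Y_nY)
      finally show ?thesis .
    qed
    have GV: "(\<Sum>m\<in>UNIV. ipS (\<lambda>x. G x $ m) (V m)) = (\<Sum>k<n. lam k * (c k)\<^sup>2)"
    proof -
      have "(\<Sum>m\<in>UNIV. ipS (\<lambda>x. G x $ m) (V m)) = (\<Sum>m\<in>UNIV. \<Sum>k<n. c k * ipS (\<lambda>x. G x $ m) (Dtan (Y k) m))"
        unfolding V_def by (intro sum.cong refl ipS_lincomb_right DY_L2S GL)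
      also have "\<dots> = (\<Sum>k<n. \<Sum>m\<in>UNIV. c k * ipS (\<lambda>x. G x $ m) (Dtan (Y k) m))"
        by (rule sum.swap)
      also have "\<dots> = (\<Sum>k<n. c k * (lam k * c k))"
        by (simp add: sum_distrib_left[symmetric] wgrad_coef[OF u G] c_def)
      finally show ?thesis by (simp add: power2_eq_square ac_simps)
    qed
    have "0 \<le> (\<Sum>m\<in>UNIV. ipS (\<lambda>x. G x $ m - V m x) (\<lambda>x. G x $ m - V m x))"
      by (intro sum_nonneg ipS_self_nonneg)
    also have "\<dots> = (\<Sum>m\<in>UNIV. ipS (\<lambda>x. G x $ m) (\<lambda>x. G x $ m) - 2 * ipS (\<lambda>x. G x $ m) (V m) + ipS (V m) (V m))"
      by (intro sum.cong refl ipS_diff_self GL V)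
    also have "\<dots> = (\<Sum>m\<in>UNIV. ipS (\<lambda>x. G x $ m) (\<lambda>x. G x $ m)) - (\<Sum>k<n. lam k * (c k)\<^sup>2)"
      by (simp add: sum.distrib sum_subtractf sum_distrib_left[symmetric] VV GV)
    finally show "(\<Sum>k<n. lam k * (ipS u (Y k))\<^sup>2) \<le> (\<Sum>m\<in>UNIV. ipS (\<lambda>x. G x $ m) (\<lambda>x. G x $ m))"
      by (simp add: c_def)
  qed (simp add: lam_nonneg)
qed

text \<open>The gradients of the partial sums are Cauchy, and the identity defining a weak gradient
  passes to L^2 limits. The norm of the gradient constructed here is recorded because
  \<open>h1sq\<close> refers to one picked by choice; \<open>wgrad_unique\<close> transfers the
  value.\<close>

lemma wgrad_exists:
  assumes u: "L2S u" and sm: "summable (\<lambda>k. lam k * (ipS u (Y k))\<^sup>2)"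
  shows "\<exists>G. is_wgrad u G \<and> (\<Sum>m\<in>UNIV. ipS (\<lambda>x. G x $ m) (\<lambda>x. G x $ m)) = (\<Sum>k. lam k * (ipS u (Y k))\<^sup>2)"
proof -
  define c where "c = (\<lambda>k. ipS u (Y k))"
  define S where "S = (\<lambda>m n x. \<Sum>k<n. c k * Dtan (Y k) m x)"
  have S: "L2S (S m n)" for m n unfolding S_def by (intro L2S_lincomb DY_L2S)
  have cn: "lam k * (c k)\<^sup>2 * nY k = lam k * (c k)\<^sup>2" for k
    by (simp add: c_def power2_eq_square mult.assoc ipS_Y_nY)
  have sm': "summable (\<lambda>k. lam k * (c k)\<^sup>2)" using sm by (simp add: c_def)
  have "\<exists>f. L2lim (S m) f" for m
  proof -
    have "\<exists>f. L2S f \<and> (\<lambda>n. ipS (\<lambda>x. S m n x - f x) (\<lambda>x. S m n x - f x)) \<longlonglongrightarrow> 0"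
    proof (rule L2S_complete[OF S])
      show "(\<lambda>l. (\<Sum>k. lam k * (c k)\<^sup>2) - (\<Sum>k<l. lam k * (c k)\<^sup>2)) \<longlonglongrightarrow> 0"
        using tendsto_diff[OF tendsto_const summable_LIMSEQ[OF sm'], of "\<Sum>k. lam k * (c k)\<^sup>2"] by simp
      fix l n :: nat assume ln: "l \<le> n"
      let ?e = "\<lambda>m x. \<Sum>k\<in>{l..<n}. c k * Dtan (Y k) m x"
      have "(\<lambda>x. S m n x - S m l x) = ?e m"
        using ln by (auto simp: S_def sum_diff_nat_ivl[of 0 l n, symmetric] atLeast0LessThan[symmetric])
      then have "ipS (\<lambda>x. S m n x - S m l x) (\<lambda>x. S m n x - S m l x) = ipS (?e m) (?e m)" by simp
      \<comment> \<open>Only the sum over the three components obeys the orthogonality relation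
        \<open>DY_orth\<close>, so a single component is estimated by that sum.\<close>
      also have "\<dots> \<le> (\<Sum>m\<in>UNIV. ipS (?e m) (?e m))"
        by (rule member_le_sum) (auto simp: ipS_self_nonneg)
      also have "\<dots> = (\<Sum>k\<in>{l..<n}. lam k * (c k)\<^sup>2)"
        by (subst DY_sums) (auto simp: cn)
      also have "\<dots> = (\<Sum>k<n. lam k * (c k)\<^sup>2) - (\<Sum>k<l. lam k * (c k)\<^sup>2)"
        using ln by (simp add: sum_diff_nat_ivl[of 0 l n, symmetric] atLeast0LessThan[symmetric])
      also have "\<dots> \<le> (\<Sum>k. lam k * (c k)\<^sup>2) - (\<Sum>k<l. lam k * (c k)\<^sup>2)"
        by (intro diff_right_mono sum_le_suminf sm') (auto simp: lam_nonneg)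
      finally show "ipS (\<lambda>x. S m n x - S m l x) (\<lambda>x. S m n x - S m l x)
          \<le> (\<Sum>k. lam k * (c k)\<^sup>2) - (\<Sum>k<l. lam k * (c k)\<^sup>2)" .
    qed
    then show ?thesis using S by (auto simp: L2lim_def)
  qed
  then obtain g where g: "\<And>m. L2lim (S m) (g m)" by metis
  have gL: "L2S (g m)" for m using g by (simp add: L2lim_def)
  define G where "G = (\<lambda>x. \<chi> m. g m x)"
  define U where "U = (\<lambda>n x. \<Sum>k<n. c k * Y k x)"
  have U: "L2lim U u" unfolding U_def c_def by (rule L2lim_expansion[OF u])
  have Utf: "test_fun (U n)" for n unfolding U_def by (intro test_fun_sum test_fun_mult test_fun_const Y_test_fun)
  have DU: "Dtan (U n) m = S m n" for n m
  proof
    fix x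
    have "Dtan (U n) m x = (\<Sum>k<n. Dtan (\<lambda>x. c k * Y k x) m x)"
      unfolding U_def by (intro Dtan_sum test_fun_mult test_fun_const Y_test_fun)
    then show "Dtan (U n) m x = S m n x" by (simp add: S_def Dtan_cmult Y_test_fun)
  qed
  have "is_wgrad u G" unfolding is_wgrad_def
  proof (intro conjI allI impI)
    show "L2S (\<lambda>x. G x $ m)" for m using gL by (simp add: G_def)
    fix \<phi> m assume \<phi>: "test_fun \<phi>"
    have L\<phi>: "L2S \<phi>" "L2S (Dtan \<phi> m)" using \<phi> by (auto intro: L2S_continuous test_fun_continuous continuous_on_Dtan)
    have Lx: "L2S (\<lambda>x. x $ m * \<phi> x)" by (intro L2S_mult_continuous L\<phi> continuous_intros)
    have eq: "ipS (U n) (Dtan \<phi> m) = - ipS (S m n) \<phi> + 2 * ipS (U n) (\<lambda>x. x $ m * \<phi> x)" for n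
      using integral_Dtan_parts[OF Utf \<phi>, of n m] unfolding DU ipS_def by (simp add: ac_simps)
    have "ipS u (Dtan \<phi> m) = - ipS (g m) \<phi> + 2 * ipS u (\<lambda>x. x $ m * \<phi> x)"
    proof (rule LIMSEQ_unique)
      show "(\<lambda>n. ipS (U n) (Dtan \<phi> m)) \<longlonglongrightarrow> ipS u (Dtan \<phi> m)" by (rule L2lim_ipS[OF U L\<phi>(2)])
      show "(\<lambda>n. ipS (U n) (Dtan \<phi> m)) \<longlonglongrightarrow> - ipS (g m) \<phi> + 2 * ipS u (\<lambda>x. x $ m * \<phi> x)"
        unfolding eq by (intro tendsto_intros L2lim_ipS[OF U Lx] L2lim_ipS[OF g L\<phi>(1)])
    qed
    then show "(\<integral>x. u x * Dtan \<phi> m x \<partial>sphere_measure) = - (\<integral>x. G x $ m * \<phi> x \<partial>sphere_measure)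
        + 2 * (\<integral>x. x $ m * u x * \<phi> x \<partial>sphere_measure)"
      by (simp add: ipS_def G_def ac_simps)
  qed
  moreover have "(\<Sum>m\<in>UNIV. ipS (\<lambda>x. G x $ m) (\<lambda>x. G x $ m)) = (\<Sum>k. lam k * (c k)\<^sup>2)"
  proof (rule LIMSEQ_unique)
    have "(\<lambda>n. \<Sum>m\<in>UNIV. ipS (S m n) (S m n)) \<longlonglongrightarrow> (\<Sum>m\<in>UNIV. ipS (g m) (g m))"
      by (intro tendsto_sum L2lim_norm g)
    then show "(\<lambda>n. \<Sum>k<n. lam k * (c k)\<^sup>2) \<longlonglongrightarrow> (\<Sum>m\<in>UNIV. ipS (\<lambda>x. G x $ m) (\<lambda>x. G x $ m))"
      unfolding S_def G_def by (subst (asm) DY_sums) (auto simp: cn)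
    show "(\<lambda>n. \<Sum>k<n. lam k * (c k)\<^sup>2) \<longlonglongrightarrow> (\<Sum>k. lam k * (c k)\<^sup>2)" by (rule summable_LIMSEQ[OF sm'])
  qed
  ultimately show ?thesis unfolding c_def by blast
qed

lemma H1S_iff: "H1S u \<longleftrightarrow> L2S u \<and> summable (\<lambda>k. lam k * (ipS u (Y k))\<^sup>2)"
  using H1S_summable wgrad_exists unfolding H1S_def by blast

lemma wgrad_unique:
  assumes u: "L2S u" and G: "is_wgrad u G" and G': "is_wgrad u G'"
  shows "AE x in sphere_measure. G x $ m = G' x $ m"
proof (rule L2S_eqI_AE)
  show "L2S (\<lambda>x. G x $ m)" "L2S (\<lambda>x. G' x $ m)" using G G' by (auto simp: is_wgrad_def)
  fix k
  have "(\<integral>x. u x * Dtan (Y k) m x \<partial>sphere_measure)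
      = - (\<integral>x. H x $ m * Y k x \<partial>sphere_measure) + 2 * (\<integral>x. x $ m * u x * Y k x \<partial>sphere_measure)"
    if "is_wgrad u H" for H
    using that Y_test_fun[of k] unfolding is_wgrad_def by blast
  from this[OF G] this[OF G'] have "(\<integral>x. G x $ m * Y k x \<partial>sphere_measure)
      = (\<integral>x. G' x $ m * Y k x \<partial>sphere_measure)" by simp
  then show "ipS (\<lambda>x. G x $ m) (Y k) = ipS (\<lambda>x. G' x $ m) (Y k)" by (simp add: ipS_def)
qed

lemma h1sq_eq:
  assumes u: "H1S u" shows "h1sq u = (\<Sum>k. lam k * (ipS u (Y k))\<^sup>2)"
proof -
  have uL: "L2S u" using u by (simp add: H1S_def)
  obtain G where G: "is_wgrad u G"
    "(\<Sum>m\<in>UNIV. ipS (\<lambda>x. G x $ m) (\<lambda>x. G x $ m)) = (\<Sum>k. lam k * (ipS u (Y k))\<^sup>2)"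
    using wgrad_exists[OF uL H1S_summable[OF u]] by blast
  have W: "is_wgrad u (wgrad u)" unfolding wgrad_def by (rule someI[of "is_wgrad u", OF G(1)])
  have WL: "L2S (\<lambda>x. wgrad u x $ m)" for m using W by (simp add: is_wgrad_def)
  have GL: "L2S (\<lambda>x. G x $ m)" for m using G(1) by (simp add: is_wgrad_def)
  have "h1sq u = (\<Sum>m\<in>UNIV. ipS (\<lambda>x. wgrad u x $ m) (\<lambda>x. wgrad u x $ m))"
    unfolding h1sq_def ipS_self using WL by (intro Bochner_Integration.integral_sum) (simp add: L2S_def)
  also have "\<dots> = (\<Sum>m\<in>UNIV. ipS (\<lambda>x. G x $ m) (\<lambda>x. G x $ m))"
  proof (rule sum.cong[OF refl])
    fix m
    note ae = wgrad_unique[OF uL W G(1), of m]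
    have "ipS (\<lambda>x. wgrad u x $ m) (\<lambda>x. wgrad u x $ m) = ipS (\<lambda>x. G x $ m) (\<lambda>x. wgrad u x $ m)"
      by (rule ipS_cong_AE[OF WL GL WL ae])
    also have "\<dots> = ipS (\<lambda>x. wgrad u x $ m) (\<lambda>x. G x $ m)" by (rule ipS_commute)
    also have "\<dots> = ipS (\<lambda>x. G x $ m) (\<lambda>x. G x $ m)" by (rule ipS_cong_AE[OF WL GL GL ae])
    finally show "ipS (\<lambda>x. wgrad u x $ m) (\<lambda>x. wgrad u x $ m) = ipS (\<lambda>x. G x $ m) (\<lambda>x. G x $ m)" .
  qed
  finally show ?thesis using G(2) by simp
qed

section \<open>Testing against arbitrary eigenfunctions\<close>

lemma eigenS_coef:
  assumes Z: "eigenS l Z" and k: "lam k \<noteq> l" shows "ipS Z (Y k) = 0"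
proof -
  obtain G where ZL: "L2S Z" and G: "is_wgrad Z G"
    and e: "\<And>\<phi>. test_fun \<phi> \<Longrightarrow> (\<integral>x. (\<Sum>m\<in>UNIV. G x $ m * Dtan \<phi> m x) \<partial>sphere_measure)
        = l * (\<integral>x. Z x * \<phi> x \<partial>sphere_measure)"
    using Z by (auto simp: eigenS_def H1S_def)
  have GL: "L2S (\<lambda>x. G x $ m)" for m using G by (simp add: is_wgrad_def)
  have "lam k * ipS Z (Y k) = (\<Sum>m\<in>UNIV. ipS (\<lambda>x. G x $ m) (Dtan (Y k) m))"
    by (rule wgrad_coef[OF ZL G, symmetric])
  also have "\<dots> = (\<integral>x. (\<Sum>m\<in>UNIV. G x $ m * Dtan (Y k) m x) \<partial>sphere_measure)"
    unfolding ipS_def by (intro Bochner_Integration.integral_sum[symmetric] L2S_mult_integrable GL DY_L2S)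
  also have "\<dots> = l * ipS Z (Y k)" unfolding ipS_def by (rule e[OF Y_test_fun])
  finally show ?thesis using k by simp
qed

lemma finite_lam: "finite {k. lam k = l}"
proof (cases "\<exists>k0. lam k0 = l")
  case True
  then obtain k0 where k0: "lam k0 = l" by blast
  have "{k. lam k = l} \<subseteq> {..<(Suc (floor_sqrt k0))\<^sup>2}"
  proof
    fix k assume "k \<in> {k. lam k = l}"
    then have "real (floor_sqrt k * (floor_sqrt k + 1)) = real (floor_sqrt k0 * (floor_sqrt k0 + 1))"
      using k0 by (simp only: lam_def mem_Collect_eq)
    then have eq: "floor_sqrt k * (floor_sqrt k + 1) = floor_sqrt k0 * (floor_sqrt k0 + 1)"
      by (simp only: of_nat_eq_iff)
    have "floor_sqrt k < Suc (floor_sqrt k0)"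
    proof (rule ccontr)
      assume "\<not> ?thesis"
      then have "Suc (floor_sqrt k0) * (floor_sqrt k0 + 1) \<le> floor_sqrt k * (floor_sqrt k + 1)"
        by (intro mult_le_mono) auto
      then show False using eq by simp
    qed
    then show "k \<in> {..<(Suc (floor_sqrt k0))\<^sup>2}" by (simp only: floor_sqrt_less_iff lessThan_iff)
  qed
  then show ?thesis by (rule finite_subset) simp
qed simp

text \<open>By \<open>eigenS_coef\<close> only the finitely many terms with \<open>lam k = l\<close>
  of Parseval's series survive; there are none if \<open>l\<close> is not of the form n (n + 1). The
  Duhamel formula can thus be proved for each \<open>Y k\<close> and summed.\<close>

lemma ipS_eigenS:
  assumes Z: "eigenS l Z" and f: "L2S f"
  shows "ipS f Z = (\<Sum>k | lam k = l. ipS f (Y k) * ipS Z (Y k))"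
proof -
  have ZL: "L2S Z" using Z by (auto simp: eigenS_def H1S_def)
  have "(\<lambda>k. ipS f (Y k) * ipS Z (Y k)) sums (\<Sum>k | lam k = l. ipS f (Y k) * ipS Z (Y k))"
    by (rule sums_finite[OF finite_lam]) (auto simp: eigenS_coef[OF Z])
  with parseval[OF f ZL] show ?thesis by (rule sums_unique2)
qed

section \<open>The exponential nonlinearity\<close>

lemma Y_0: "Y 0 x = 1 / sqrt (4 * pi)"
proof -
  have "mon_enum 0 = (\<lambda>_. 1)" by (auto simp: mon_enum_def mon_def Let_def)
  then have "gs_res 0 = (\<lambda>_. 1)" by (auto simp: gs_res_def)
  then show ?thesis by (simp add: Y_eq ipS_def measure_sphere_measure_UNIV)
qed

lemma integral_eq_ipS_Y0: "(\<integral>x. f x \<partial>sphere_measure) = sqrt (4 * pi) * ipS f (Y 0)"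
  by (simp add: ipS_def Y_0)

text \<open>The symbol of (-\<Delta>)^(-1/2) on functions of mean zero; the value 0 at
  \<open>k = 0\<close> removes the constant mode. Elsewhere \<open>lam k\<close> is at least 2, so
  it is an admissible multiplier for \<open>mlt\<close>.\<close>

definition iom :: "nat \<Rightarrow> real" where
  "iom k = (if k = 0 then 0 else 1 / sqrt (lam k))"

lemma iom_bound: "\<bar>iom k\<bar> \<le> 1"
proof (cases "k = 0")
  case False
  then have "2 \<le> lam k" by (intro lam_ge_2) simp
  then have "1 \<le> sqrt (lam k)" by simp
  then show ?thesis by (simp add: iom_def)
qed (simp add: iom_def)

lemma iom_square: "(iom k)\<^sup>2 = (if k = 0 then 0 else 1 / lam k)"
  by (simp add: iom_def power_divide lam_nonneg)

text \<open>The zero-mean function \<open>v\<close> with \<open>sqrt (-\<Delta>) v = \<Sum>\<^sub>k w\<^sub>k Y\<^sub>k\<close>.\<close>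

definition pot :: "l2 \<Rightarrow> real^3 \<Rightarrow> real" where
  "pot w = synth (mlt iom w)"

lemma pot_L2S: "L2S (pot w)"
  by (simp add: pot_def synth)

lemma pot_coef: "ipS (pot w) (Y k) = iom k * l2_nth w k * nY k"
  by (simp add: pot_def synth iom_bound)

lemma pot_mean: "(\<integral>x. pot w x \<partial>sphere_measure) = 0"
  by (simp add: integral_eq_ipS_Y0 pot_coef iom_def)

lemma pot_diff_AE: "AE x in sphere_measure. pot (w - w') x = pot w x - pot w' x"
  by (rule L2S_eqI_AE) (auto simp: pot_L2S L2S_diff ipS_diff_left Y_L2S pot_coef algebra_simps)

lemma pot_scale_AE: "AE x in sphere_measure. pot (a *\<^sub>R w) x = a * pot w x"
  by (rule L2S_eqI_AE) (auto simp: pot_L2S L2S_cmult ipS_cmult_left pot_coef)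

lemma pot_measurable [measurable]: "pot w \<in> borel_measurable sphere_measure"
  using pot_L2S by (rule L2S_measurable)

text \<open>Indices below 4 ^ M are the degrees below 2 ^ M.\<close>

definition pot_cut :: "l2 \<Rightarrow> nat \<Rightarrow> real^3 \<Rightarrow> real" where
  "pot_cut w M x = (\<Sum>k<4 ^ M. ipS (pot w) (Y k) * Y k x)"

lemma pot_cut_L2S: "L2S (pot_cut w M)"
  unfolding pot_cut_def[abs_def] by (intro L2S_lincomb Y_L2S)

text \<open>Brezis-Gallouet type estimate: Cauchy-Schwarz with the entries of \<open>w\<close> on
  one side and \<open>iom k * Y k x\<close> on the other, whose squares are summed by
  \<open>kernel_log_bound\<close>.\<close>

lemma pot_cut_bound:
  assumes x: "norm x = 1" and w: "norm w \<le> R" shows "\<bar>pot_cut w M x\<bar> \<le> R * sqrt (real M)"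
proof -
  have "pot_cut w M x = (\<Sum>k\<in>{1..<4 ^ M}. l2_nth w k * (iom k * Y k x))"
  proof -
    have "pot_cut w M x = (\<Sum>k\<in>{1..<4 ^ M}. ipS (pot w) (Y k) * Y k x)"
      unfolding pot_cut_def
      by (rule sum.mono_neutral_right) (auto simp: pot_coef iom_def)
    also have "\<dots> = (\<Sum>k\<in>{1..<4 ^ M}. l2_nth w k * (iom k * Y k x))"
    proof (rule sum.cong[OF refl])
      fix k
      have "ipS (pot w) (Y k) * Y k x = iom k * l2_nth w k * (nY k * Y k x)"
        by (simp add: pot_coef)
      also have "\<dots> = l2_nth w k * (iom k * Y k x)" unfolding Y_nY by simp
      finally show "ipS (pot w) (Y k) * Y k x = l2_nth w k * (iom k * Y k x)" .
    qed
    finally show ?thesis .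
  qed
  then have "(pot_cut w M x)\<^sup>2 \<le> (\<Sum>k\<in>{1..<4 ^ M}. (l2_nth w k)\<^sup>2) * (\<Sum>k\<in>{1..<4 ^ M}. (iom k * Y k x)\<^sup>2)"
    by (simp add: Cauchy_Schwarz_ineq_sum)
  also have "(\<Sum>k\<in>{1..<4 ^ M}. (iom k * Y k x)\<^sup>2) = (\<Sum>k\<in>{1..<4 ^ M}. (Y k x)\<^sup>2 / lam k)"
    by (rule sum.cong) (auto simp: power_mult_distrib iom_square)
  also have "(\<Sum>k\<in>{1..<4 ^ M}. (l2_nth w k)\<^sup>2) * (\<Sum>k\<in>{1..<4 ^ M}. (Y k x)\<^sup>2 / lam k) \<le> R\<^sup>2 * real M"
  proof (rule mult_mono)
    have "(\<Sum>k\<in>{1..<4 ^ M}. (l2_nth w k)\<^sup>2) \<le> (norm w)\<^sup>2" by (rule sum_l2_le) simp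
    also have "\<dots> \<le> R\<^sup>2" using w by (intro power_mono) auto
    finally show "(\<Sum>k\<in>{1..<4 ^ M}. (l2_nth w k)\<^sup>2) \<le> R\<^sup>2" .
    show "(\<Sum>k\<in>{1..<4 ^ M}. (Y k x)\<^sup>2 / lam k) \<le> real M" by (rule kernel_log_bound[OF x])
  qed (auto intro!: sum_nonneg simp: lam_nonneg)
  also have "\<dots> = (R * sqrt (real M))\<^sup>2" by (simp add: power_mult_distrib)
  finally have "\<bar>pot_cut w M x\<bar> \<le> \<bar>R * sqrt (real M)\<bar>" by (simp add: abs_le_square_iff)
  moreover have "0 \<le> R" using w norm_ge_zero[of w] by linarith
  ultimately show ?thesis by simp
qed

text \<open>From index 4 ^ M on, \<open>lam k\<close> is at least 4 ^ M, so a coefficient of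
  \<open>pot w\<close> is in modulus at most 2 ^ (-M) times the entry of \<open>w\<close>.\<close>

lemma pot_tail_bound:
  assumes w: "norm w \<le> R"
  shows "ipS (\<lambda>x. pot w x - pot_cut w M x) (\<lambda>x. pot w x - pot_cut w M x) \<le> R\<^sup>2 / 4 ^ M"
proof -
  define c where "c = (\<lambda>k. ipS (pot w) (Y k))"
  have pc: "ipS (pot_cut w M) (pot_cut w M) = (\<Sum>k<4 ^ M. (c k)\<^sup>2)"
    unfolding pot_cut_def[abs_def] c_def
    by (subst ipS_Y_sums) (auto simp: power2_eq_square mult.assoc ipS_Y_nY)
  have ppc: "ipS (pot w) (pot_cut w M) = (\<Sum>k<4 ^ M. (c k)\<^sup>2)"
    unfolding pot_cut_def[abs_def] c_def
    by (simp add: ipS_lincomb_right Y_L2S pot_L2S power2_eq_square)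
  have cs: "(\<lambda>k. (c k)\<^sup>2) sums ipS (pot w) (pot w)"
    using parseval[OF pot_L2S pot_L2S, of w w] by (simp add: c_def power2_eq_square)
  have c_le: "(c k)\<^sup>2 \<le> (l2_nth w k)\<^sup>2 / 4 ^ M" if "k \<ge> 4 ^ M" for k
  proof -
    have k0: "k \<noteq> 0" using that by (metis not_numeral_le_zero le_zero_eq power_not_zero zero_neq_numeral)
    have l: "4 ^ M \<le> lam k" using that by (rule lam_ge)
    have "(c k)\<^sup>2 = (l2_nth w k)\<^sup>2 * (nY k)\<^sup>2 / lam k"
      using k0 by (simp add: c_def pot_coef power_mult_distrib iom_square)
    also have "\<dots> \<le> (l2_nth w k)\<^sup>2 * 1 / lam k"
      using lam_nonneg[of k] nY_cases[of k] by (intro divide_right_mono mult_left_mono) auto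
    also have "\<dots> \<le> (l2_nth w k)\<^sup>2 / 4 ^ M"
      using l by (auto intro!: divide_left_mono mult_pos_pos elim: less_le_trans[rotated])
    finally show ?thesis .
  qed
  have "ipS (pot w) (pot w) \<le> (\<Sum>k<4 ^ M. (c k)\<^sup>2) + R\<^sup>2 / 4 ^ M"
  proof -
    have "(\<Sum>k<n. (c k)\<^sup>2) \<le> (\<Sum>k<4 ^ M. (c k)\<^sup>2) + R\<^sup>2 / 4 ^ M" for n
    proof -
      have "(\<Sum>k<n. (c k)\<^sup>2) \<le> (\<Sum>k\<in>{..<4 ^ M} \<union> {4 ^ M..<n}. (c k)\<^sup>2)"
        by (rule sum_mono2) auto
      also have "\<dots> = (\<Sum>k<4 ^ M. (c k)\<^sup>2) + (\<Sum>k\<in>{4 ^ M..<n}. (c k)\<^sup>2)"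
        by (rule sum.union_disjoint) auto
      also have "(\<Sum>k\<in>{4 ^ M..<n}. (c k)\<^sup>2) \<le> (\<Sum>k\<in>{4 ^ M..<n}. (l2_nth w k)\<^sup>2 / 4 ^ M)"
        by (rule sum_mono) (auto intro: c_le)
      also have "\<dots> = (\<Sum>k\<in>{4 ^ M..<n}. (l2_nth w k)\<^sup>2) / 4 ^ M" by (simp add: sum_divide_distrib)
      also have "\<dots> \<le> (norm w)\<^sup>2 / 4 ^ M" by (intro divide_right_mono sum_l2_le) auto
      also have "\<dots> \<le> R\<^sup>2 / 4 ^ M" using w by (intro divide_right_mono power_mono) auto
      finally show ?thesis by simp
    qed
    then have "(\<Sum>k. (c k)\<^sup>2) \<le> (\<Sum>k<4 ^ M. (c k)\<^sup>2) + R\<^sup>2 / 4 ^ M"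
      by (intro suminf_le_const sums_summable[OF cs]) auto
    then show ?thesis using sums_unique[OF cs] by simp
  qed
  then show ?thesis by (simp add: ipS_diff_self pot_L2S pot_cut_L2S pc ppc)
qed

text \<open>The expansion is cut with M = 7 j. The low part is at most R sqrt (7 j), and R sqrt (7
  j) \<le> j / 2 is the condition 28 R^2 \<le> j. On the level set the remainder is therefore at
  least j / 2 \<ge> 1 / 2, so 4 times its square is at least 1, and Chebyshev's inequality applies
  with \<open>pot_tail_bound\<close>. The factor 7 is dictated by \<open>exp_decay\<close>.\<close>

lemma emeasure_pot_level:
  assumes w: "norm w \<le> R" and j: "1 \<le> j" "28 * R\<^sup>2 \<le> real j"
  shows "emeasure sphere_measure {x. \<bar>pot w x\<bar> > real j} \<le> ennreal (4 * R\<^sup>2 / 4 ^ (7 * j))"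
proof -
  define D where "D = (\<lambda>x. pot w x - pot_cut w (7 * j) x)"
  have D: "L2S D" unfolding D_def by (intro L2S_diff pot_L2S pot_cut_L2S)
  have R: "0 \<le> R" using w norm_ge_zero[of w] by linarith
  have m: "{x. \<bar>pot w x\<bar> > real j} \<in> sets sphere_measure"
    using borel_measurable_less[of "\<lambda>_. real j" sphere_measure "\<lambda>x. \<bar>pot w x\<bar>"] by simp
  have "R * sqrt (real (7 * j)) \<le> real j / 2"
  proof (rule power2_le_imp_le)
    have "(R * sqrt (real (7 * j)))\<^sup>2 = (28 * R\<^sup>2) * real j / 4" by (simp add: power_mult_distrib)
    also have "\<dots> \<le> real j * real j / 4" using j by (intro divide_right_mono mult_right_mono) auto
    finally show "(R * sqrt (real (7 * j)))\<^sup>2 \<le> (real j / 2)\<^sup>2" by (simp add: power2_eq_square)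
  qed simp
  then have cut: "\<bar>pot_cut w (7 * j) x\<bar> \<le> real j / 2" if "norm x = 1" for x
    using pot_cut_bound[OF that w, of "7 * j"] by linarith
  have "emeasure sphere_measure {x. \<bar>pot w x\<bar> > real j}
      = (\<integral>\<^sup>+x. indicator {x. \<bar>pot w x\<bar> > real j} x \<partial>sphere_measure)"
    using m by (rule nn_integral_indicator[symmetric])
  also have "\<dots> \<le> (\<integral>\<^sup>+x. ennreal (4 * (D x)\<^sup>2) \<partial>sphere_measure)"
  proof (rule nn_integral_mono_AE)
    show "AE x in sphere_measure. (indicator {x. \<bar>pot w x\<bar> > real j} x :: ennreal) \<le> ennreal (4 * (D x)\<^sup>2)"
      using AE_sphere
    proof eventually_elim
      case (elim x)
      show ?case
      proof (cases "\<bar>pot w x\<bar> > real j")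
        case True
        then have "real j / 2 \<le> \<bar>D x\<bar>" unfolding D_def using cut[OF elim] by linarith
        then have "1/2 \<le> \<bar>D x\<bar>" using j by linarith
        then have "(1/2)\<^sup>2 \<le> \<bar>D x\<bar>\<^sup>2" by (intro power_mono) auto
        then have "1 \<le> 4 * (D x)\<^sup>2" by (simp add: power2_eq_square)
        then have "ennreal 1 \<le> ennreal (4 * (D x)\<^sup>2)" by (rule ennreal_leI)
        then show ?thesis using True by simp
      qed simp
    qed
  qed
  also have "\<dots> = ennreal (\<integral>x. 4 * (D x)\<^sup>2 \<partial>sphere_measure)"
    using D by (intro nn_integral_eq_integral) (auto simp: L2S_def)
  also have "\<dots> \<le> ennreal (4 * R\<^sup>2 / 4 ^ (7 * j))"
    using pot_tail_bound[OF w, of "7 * j"] by (intro ennreal_leI) (simp add: ipS_self D_def)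
  finally show ?thesis .
qed

text \<open>Origin of the 7: exp 8 \<le> 3^8 = 6561 \<le> 8192 = 4^7 / 2, so the level sets shrink
  faster than exp (8 n) grows, with a geometric factor to spare.\<close>

lemma exp_decay: "exp (8 * real n) / 4 ^ (7 * n) \<le> (1/2) ^ n"
proof -
  have e: "exp (8 * real n) = (exp 1 ^ 8) ^ n"
    by (simp add: exp_of_nat_mult[symmetric] power_mult[symmetric] mult.commute)
  have "exp (8 * real n) / 4 ^ (7 * n) = (exp 1 ^ 8 / 4 ^ 7) ^ n"
    unfolding e by (simp add: power_mult power_divide)
  also have "\<dots> \<le> (1/2) ^ n"
  proof (rule power_mono)
    have "exp 1 ^ 8 \<le> (3::real) ^ 8" by (intro power_mono exp_le) simp
    then show "exp 1 ^ 8 / 4 ^ 7 \<le> (1/2 :: real)" by simp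
  qed simp
  finally show ?thesis .
qed

text \<open>Trudinger-type inequality. Level sets \<open>\<bar>v\<bar> > j\<close> are estimated by cutting the expansion of \<open>v\<close> at
  degree \<open>2 ^ (7 j)\<close>: the low part is bounded by \<open>O(sqrt j)\<close>, hence by \<open>j / 2\<close> for large \<open>j\<close>, and the
  remainder is small in \<open>L\<^sup>2\<close>.\<close>

lemma exp_pot_bound:
  "\<exists>K\<ge>0. \<forall>w. norm w \<le> R \<longrightarrow> integrable sphere_measure (\<lambda>x. exp (8 * \<bar>pot w x\<bar>)) \<and>
     (\<integral>x. exp (8 * \<bar>pot w x\<bar>) \<partial>sphere_measure) \<le> K"
proof -
  \<comment> \<open>From this level on \<open>emeasure_pot_level\<close> applies; below it the
    exponential is bounded by a constant.\<close>
  define J where "J = Suc (nat \<lceil>28 * R\<^sup>2\<rceil>)"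
  have J: "1 \<le> J" "28 * R\<^sup>2 \<le> real J" unfolding J_def by (simp, linarith)
  \<comment> \<open>The bound below level J times the area 4 \<pi>, plus a geometric series over the
    higher levels. \<open>exp 8\<close> pays for using the upper end J + i + 1 of a layer in
    \<open>a\<close> against the level J + i in \<open>B\<close>.\<close>
  define K where "K = exp (8 * real J) * (4 * pi) + exp 8 * (4 * R\<^sup>2) * 2"
  have K: "0 \<le> K" by (simp add: K_def)
  have "integrable sphere_measure (\<lambda>x. exp (8 * \<bar>pot w x\<bar>)) \<and>
     (\<integral>x. exp (8 * \<bar>pot w x\<bar>) \<partial>sphere_measure) \<le> K" if w: "norm w \<le> R" for w
  proof -
    define B where "B = (\<lambda>i. {x. \<bar>pot w x\<bar> > real (J + i)})"
    define a where "a = (\<lambda>i::nat. exp (8 * real (J + i + 1)))"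
    have Bm [measurable]: "B i \<in> sets sphere_measure" for i
      using borel_measurable_less[of "\<lambda>_. real (J + i)" sphere_measure "\<lambda>x. \<bar>pot w x\<bar>"] by (simp add: B_def)
    have pw: "ennreal (exp (8 * \<bar>pot w x\<bar>)) \<le> ennreal (exp (8 * real J)) + (\<Sum>i. ennreal (a i) * indicator (B i) x)" for x
    proof (cases "\<bar>pot w x\<bar> \<le> real J")
      case True
      then have "ennreal (exp (8 * \<bar>pot w x\<bar>)) \<le> ennreal (exp (8 * real J))" by (intro ennreal_leI) simp
      then show ?thesis by (rule order_trans) simp
    next
      case False
      \<comment> \<open>The ceiling minus 1, rather than the floor, gives m < s \<le> m + 1 for the
        value s: the strict inequality is the one in \<open>B\<close>. The single term i = m - J of
        the series then already suffices.\<close>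
      define m where "m = nat (\<lceil>\<bar>pot w x\<bar>\<rceil> - 1)"
      have mJ: "J \<le> m" "real m < \<bar>pot w x\<bar>" "\<bar>pot w x\<bar> \<le> real (m + 1)"
        using False unfolding m_def by linarith+
      define i where "i = m - J"
      have im: "J + i = m" using mJ by (simp add: i_def)
      have "a i = exp (8 * real (m + 1))" by (simp only: a_def im)
      moreover have "(indicator (B i) x :: ennreal) = 1" using mJ(2) by (simp add: B_def im del: of_nat_add)
      ultimately have "ennreal (exp (8 * \<bar>pot w x\<bar>)) \<le> ennreal (a i) * indicator (B i) x"
        using mJ(3) by (auto intro!: ennreal_leI)
      also have "\<dots> \<le> (\<Sum>i. ennreal (a i) * indicator (B i) x)"
      proof -
        define f where "f = (\<lambda>k. ennreal (a k) * indicator (B k) x)"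
        have "f i \<le> suminf f" using sum_le_suminf[OF summableI, of "{i}" f] by simp
        then show ?thesis by (simp only: f_def)
      qed
      also have "\<dots> \<le> ennreal (exp (8 * real J)) + (\<Sum>i. ennreal (a i) * indicator (B i) x)" by simp
      finally show ?thesis .
    qed
    have "(\<integral>\<^sup>+x. ennreal (exp (8 * \<bar>pot w x\<bar>)) \<partial>sphere_measure)
        \<le> (\<integral>\<^sup>+x. ennreal (exp (8 * real J)) + (\<Sum>i. ennreal (a i) * indicator (B i) x) \<partial>sphere_measure)"
      by (intro nn_integral_mono pw)
    also have "\<dots> = (\<integral>\<^sup>+x. ennreal (exp (8 * real J)) \<partial>sphere_measure)
          + (\<integral>\<^sup>+x. (\<Sum>i. ennreal (a i) * indicator (B i) x) \<partial>sphere_measure)"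
      by (rule nn_integral_add) measurable
    also have "(\<integral>\<^sup>+x. ennreal (exp (8 * real J)) \<partial>sphere_measure) = ennreal (exp (8 * real J) * (4 * pi))"
      by (simp add: emeasure_sphere_measure_UNIV ennreal_mult)
    also have "(\<integral>\<^sup>+x. (\<Sum>i. ennreal (a i) * indicator (B i) x) \<partial>sphere_measure)
        = (\<Sum>i. \<integral>\<^sup>+x. ennreal (a i) * indicator (B i) x \<partial>sphere_measure)"
      by (rule nn_integral_suminf) measurable
    also have "\<dots> = (\<Sum>i. ennreal (a i) * emeasure sphere_measure (B i))"
      by (intro suminf_cong nn_integral_cmult_indicator Bm)
    also have "\<dots> \<le> (\<Sum>i. ennreal (exp 8 * (4 * R\<^sup>2) * (1/2) ^ i))"
    proof (intro suminf_le summableI)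
      fix i
      have "ennreal (a i) * emeasure sphere_measure (B i)
          \<le> ennreal (a i) * ennreal (4 * R\<^sup>2 / 4 ^ (7 * (J + i)))"
        unfolding B_def using J by (intro mult_left_mono emeasure_pot_level w) auto
      also have "\<dots> = ennreal (a i * (4 * R\<^sup>2 / 4 ^ (7 * (J + i))))"
        by (rule ennreal_mult[symmetric]) (auto simp: a_def)
      also have "a i * (4 * R\<^sup>2 / 4 ^ (7 * (J + i))) = exp 8 * (4 * R\<^sup>2) * (exp (8 * real (J + i)) / 4 ^ (7 * (J + i)))"
        by (simp add: a_def exp_add[symmetric] algebra_simps)
      also have "ennreal \<dots> \<le> ennreal (exp 8 * (4 * R\<^sup>2) * (1/2) ^ i)"
      proof (intro ennreal_leI mult_left_mono)
        have "(1/2 :: real) ^ (J + i) \<le> (1/2) ^ i" by (rule power_decreasing) auto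
        then show "exp (8 * real (J + i)) / 4 ^ (7 * (J + i)) \<le> (1/2) ^ i"
          using exp_decay[of "J + i"] by linarith
      qed simp
      finally show "ennreal (a i) * emeasure sphere_measure (B i) \<le> ennreal (exp 8 * (4 * R\<^sup>2) * (1/2) ^ i)" .
    qed
    also have "(\<Sum>i. ennreal (exp 8 * (4 * R\<^sup>2) * (1/2) ^ i)) = ennreal (exp 8 * (4 * R\<^sup>2) * 2)"
      by (rule suminf_ennreal_eq) (use sums_mult[OF geometric_sums[of "1/2 :: real"], of "exp 8 * (4 * R\<^sup>2)"] in auto)
    also have "ennreal (exp (8 * real J) * (4 * pi)) + ennreal (exp 8 * (4 * R\<^sup>2) * 2) = ennreal K"
      unfolding K_def by (rule ennreal_plus[symmetric]) auto
    finally have le: "(\<integral>\<^sup>+x. ennreal (exp (8 * \<bar>pot w x\<bar>)) \<partial>sphere_measure) \<le> ennreal K"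
      by (simp add: add_left_mono)
    have int: "integrable sphere_measure (\<lambda>x. exp (8 * \<bar>pot w x\<bar>))"
      by (rule integrableI_nonneg) (use le in \<open>auto intro: le_less_trans\<close>)
    have "ennreal (\<integral>x. exp (8 * \<bar>pot w x\<bar>) \<partial>sphere_measure) \<le> ennreal K"
      using le by (subst nn_integral_eq_integral[OF int, symmetric]) auto
    then have "(\<integral>x. exp (8 * \<bar>pot w x\<bar>) \<partial>sphere_measure) \<le> K" using K by simp
    with int show ?thesis by simp
  qed
  with K show ?thesis by blast
qed

lemma exp_pot_integrable: "integrable sphere_measure (\<lambda>x. exp (8 * \<bar>pot w x\<bar>))"
  using exp_pot_bound[of "norm w"] by auto

lemma exp_pot_L2S: "L2S (\<lambda>x. exp (2 * pot w x))"
  unfolding L2S_def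
proof
  show "integrable sphere_measure (\<lambda>x. (exp (2 * pot w x))\<^sup>2)"
    by (rule Bochner_Integration.integrable_bound[OF exp_pot_integrable[of w]])
       (auto simp: exp_double[symmetric] intro!: AE_I2)
qed measurable

section \<open>Lipschitz bounds for the normalised exponential\<close>

definition avg :: "l2 \<Rightarrow> real" where
  "avg w = sfint (\<lambda>x. exp (2 * pot w x))"

text \<open>Jensen's inequality in the form exp s \<ge> 1 + s, whose linear term integrates to zero.
  It keeps the denominator in \<open>gibbs\<close> away from zero uniformly in
  \<open>w\<close>.\<close>

lemma avg_ge_1: "1 \<le> avg w"
proof -
  have "(\<integral>x. 1 + 2 * pot w x \<partial>sphere_measure) \<le> (\<integral>x. exp (2 * pot w x) \<partial>sphere_measure)"
    by (intro integral_mono L2S_integrable L2S_add L2S_const L2S_cmult pot_L2S exp_pot_L2S exp_ge_add_one_self)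
  also have "(\<integral>x. 1 + 2 * pot w x \<partial>sphere_measure) = 4 * pi"
    by (subst Bochner_Integration.integral_add)
       (auto simp: L2S_integrable pot_L2S pot_mean measure_sphere_measure_UNIV)
  finally show ?thesis by (simp add: avg_def sfint_def field_simps)
qed

definition gibbs :: "l2 \<Rightarrow> real^3 \<Rightarrow> real" where
  "gibbs w x = exp (2 * pot w x) / avg w - 1"

lemma gibbs_L2S: "L2S (gibbs w)"
  unfolding gibbs_def[abs_def] using L2S_diff[OF L2S_cmult[OF exp_pot_L2S, of "1 / avg w"] L2S_const[of 1]] by simp

lemma gibbs_mean: "(\<integral>x. gibbs w x \<partial>sphere_measure) = 0"
proof -
  have "(\<integral>x. gibbs w x \<partial>sphere_measure) = (\<integral>x. exp (2 * pot w x) \<partial>sphere_measure) / avg w - 4 * pi"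
    unfolding gibbs_def
    by (subst Bochner_Integration.integral_diff)
       (auto simp: L2S_integrable exp_pot_L2S measure_sphere_measure_UNIV)
  also have "(\<integral>x. exp (2 * pot w x) \<partial>sphere_measure) = 4 * pi * avg w"
    by (simp add: avg_def sfint_def)
  finally show ?thesis using avg_ge_1[of w] by simp
qed

lemma abs_exp_diff_le: "\<bar>exp a - exp b\<bar> \<le> \<bar>a - b\<bar> * (exp a + exp (b::real))"
proof -
  have *: "exp a - exp b \<le> (a - b) * exp a" if "b \<le> a" for a b :: real
  proof -
    have "1 + (b - a) \<le> exp (b - a)" by (rule exp_ge_add_one_self)
    then have "(1 + (b - a)) * exp a \<le> exp (b - a) * exp a" by (rule mult_right_mono) simp
    then show ?thesis by (simp add: exp_add[symmetric] algebra_simps)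
  qed
  show ?thesis
  proof (cases "b \<le> a")
    case True
    have "(a - b) * exp a \<le> (a - b) * (exp a + exp b)" using True by (intro mult_left_mono) auto
    then show ?thesis using *[OF True] True by simp
  next
    case False
    have "(b - a) * exp b \<le> (b - a) * (exp a + exp b)" using False by (intro mult_left_mono) auto
    then have "exp b - exp a \<le> (b - a) * (exp a + exp b)" using *[of a b] False by linarith
    then show ?thesis using False by simp
  qed
qed

text \<open>Origin of the exponent 8: the difference is at most 2 |d h| (p + q), and h^2 (p + q)^2
  is split by 2 x y \<le> x^2 + y^2 into h^4 and (p + q)^4, where p^4 = exp (8 |u|). Since also h^4
  \<le> exp (8 |h|), one exponential bound serves all terms. The factor \<open>d\<close> is kept
  apart to obtain an estimate that is linear in the distance.\<close>

lemma exp_diff_square_le: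
  fixes u v d h :: real
  assumes "u - v = d * h"
  shows "(exp (2 * u) - exp (2 * v))\<^sup>2 \<le> d\<^sup>2 * (2 * exp (8 * \<bar>h\<bar>) + 16 * (exp (8 * \<bar>u\<bar>) + exp (8 * \<bar>v\<bar>)))"
proof -
  define p q where "p = exp (2 * \<bar>u\<bar>)" and "q = exp (2 * \<bar>v\<bar>)"
  have pq: "0 < p" "0 < q" by (auto simp: p_def q_def)
  have "\<bar>exp (2 * u) - exp (2 * v)\<bar> \<le> \<bar>2 * u - 2 * v\<bar> * (exp (2 * u) + exp (2 * v))"
    by (rule abs_exp_diff_le)
  also have "\<dots> \<le> \<bar>2 * u - 2 * v\<bar> * (p + q)"
    unfolding p_def q_def by (intro mult_left_mono add_mono) auto
  also have "2 * u - 2 * v = 2 * (d * h)" using assms by linarith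
  also have "\<bar>2 * (d * h)\<bar> = 2 * \<bar>d * h\<bar>" by (simp add: abs_mult)
  finally have "(exp (2 * u) - exp (2 * v))\<^sup>2 \<le> (2 * \<bar>d * h\<bar> * (p + q))\<^sup>2"
    by (metis abs_ge_zero power2_abs power_mono)
  also have "\<dots> = d\<^sup>2 * (4 * (h\<^sup>2 * (p + q)\<^sup>2))" by (simp add: power_mult_distrib)
  also have "\<dots> \<le> d\<^sup>2 * (2 * exp (8 * \<bar>h\<bar>) + 16 * (exp (8 * \<bar>u\<bar>) + exp (8 * \<bar>v\<bar>)))"
  proof (rule mult_left_mono)
    have 1: "2 * (h\<^sup>2 * (p + q)\<^sup>2) \<le> (h\<^sup>2)\<^sup>2 + ((p + q)\<^sup>2)\<^sup>2"
      using sum_squares_bound[of "h\<^sup>2" "(p + q)\<^sup>2"] by simp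
    have 2: "(h\<^sup>2)\<^sup>2 \<le> exp (8 * \<bar>h\<bar>)"
    proof -
      have "\<bar>h\<bar> \<le> exp \<bar>h\<bar>" using exp_ge_add_one_self[of "\<bar>h\<bar>"] by linarith
      then have "\<bar>h\<bar> ^ 4 \<le> exp \<bar>h\<bar> ^ 4" by (intro power_mono) auto
      also have "exp \<bar>h\<bar> ^ 4 = exp (4 * \<bar>h\<bar>)" by (simp add: exp_of_nat_mult[symmetric])
      also have "\<dots> \<le> exp (8 * \<bar>h\<bar>)" by simp
      finally show ?thesis by (simp add: power_mult[symmetric])
    qed
    have 3: "((p + q)\<^sup>2)\<^sup>2 \<le> 8 * (p ^ 4 + q ^ 4)"
    proof -
      have a: "(p + q)\<^sup>2 \<le> 2 * (p\<^sup>2 + q\<^sup>2)"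
        using sum_squares_bound[of p q] by (simp add: power2_sum)
      have "((p + q)\<^sup>2)\<^sup>2 \<le> (2 * (p\<^sup>2 + q\<^sup>2))\<^sup>2" by (intro power_mono a) simp
      also have "\<dots> = 4 * ((p\<^sup>2)\<^sup>2 + (q\<^sup>2)\<^sup>2 + 2 * p\<^sup>2 * q\<^sup>2)" by (simp add: power2_eq_square algebra_simps)
      also have "\<dots> \<le> 8 * ((p\<^sup>2)\<^sup>2 + (q\<^sup>2)\<^sup>2)"
        using sum_squares_bound[of "p\<^sup>2" "q\<^sup>2"] by simp
      finally show ?thesis by (simp add: power_mult[symmetric])
    qed
    have 4: "p ^ 4 = exp (8 * \<bar>u\<bar>)" "q ^ 4 = exp (8 * \<bar>v\<bar>)"
      by (simp_all add: p_def q_def exp_of_nat_mult[symmetric])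
    show "4 * (h\<^sup>2 * (p + q)\<^sup>2) \<le> 2 * exp (8 * \<bar>h\<bar>) + 16 * (exp (8 * \<bar>u\<bar>) + exp (8 * \<bar>v\<bar>))"
      using 1 2 3 unfolding 4 by linarith
  qed simp
  finally show ?thesis .
qed

definition gam :: "l2 \<Rightarrow> l2" where
  "gam w = cf (gibbs w)"

text \<open>With d the distance of \<open>w\<close> and \<open>w'\<close>, the function
  \<open>h\<close> is the potential of a vector of norm 1, controlled by
  \<open>exp_pot_bound\<close> with radius 1; this takes the place of an embedding of H^1 into L^4.
  The exponentials then differ by O(d) in L^2, and so do the averages.\<close>

lemma gam_lipschitz:
  "\<exists>B\<ge>0. \<forall>w w'. norm w \<le> R \<longrightarrow> norm w' \<le> R \<longrightarrow> norm (gam w - gam w') \<le> B * norm (w - w')"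
proof -
  obtain K where K: "K \<ge> 0" "\<And>w. norm w \<le> R \<Longrightarrow> (\<integral>x. exp (8 * \<bar>pot w x\<bar>) \<partial>sphere_measure) \<le> K"
    using exp_pot_bound[of R] by blast
  obtain K1 where K1: "K1 \<ge> 0" "\<And>w. norm w \<le> 1 \<Longrightarrow> (\<integral>x. exp (8 * \<bar>pot w x\<bar>) \<partial>sphere_measure) \<le> K1"
    using exp_pot_bound[of 1] by blast
  define C where "C = 2 * K1 + 16 * (K + K)"
  have C: "0 \<le> C" using K K1 by (simp add: C_def)
  have "norm (gam w - gam w') \<le> sqrt (2 * C * (1 + K)) * norm (w - w')"
    if w: "norm w \<le> R" and w': "norm w' \<le> R" for w w'
  proof (cases "w = w'")
    case False
    define d where "d = norm (w - w')"
    have d: "0 < d" using False by (simp add: d_def)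
    define h where "h = pot ((1 / d) *\<^sub>R (w - w'))"
    have n1: "norm ((1 / d) *\<^sub>R (w - w')) \<le> 1" using d by (simp add: d_def)
    have h: "AE x in sphere_measure. pot w x - pot w' x = d * h x"
      using pot_diff_AE[of w w'] pot_scale_AE[of "1 / d" "w - w'"]
      by eventually_elim (use d in \<open>simp add: h_def\<close>)
    define e where "e = (\<lambda>x. exp (2 * pot w x) - exp (2 * pot w' x))"
    have eL: "L2S e" unfolding e_def by (intro L2S_diff exp_pot_L2S)
    have ee: "ipS e e \<le> d\<^sup>2 * C"
    proof -
      have "ipS e e \<le> (\<integral>x. d\<^sup>2 * (2 * exp (8 * \<bar>h x\<bar>) + 16 * (exp (8 * \<bar>pot w x\<bar>) + exp (8 * \<bar>pot w' x\<bar>))) \<partial>sphere_measure)"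
        unfolding ipS_self
      proof (rule integral_mono_AE)
        show "AE x in sphere_measure. (e x)\<^sup>2 \<le> d\<^sup>2 * (2 * exp (8 * \<bar>h x\<bar>) + 16 * (exp (8 * \<bar>pot w x\<bar>) + exp (8 * \<bar>pot w' x\<bar>)))"
          using h by eventually_elim (simp only: e_def exp_diff_square_le)
      qed (use eL in \<open>auto simp: L2S_def h_def exp_pot_integrable\<close>)
      also have "\<dots> = d\<^sup>2 * (2 * (\<integral>x. exp (8 * \<bar>h x\<bar>) \<partial>sphere_measure)
          + 16 * ((\<integral>x. exp (8 * \<bar>pot w x\<bar>) \<partial>sphere_measure) + (\<integral>x. exp (8 * \<bar>pot w' x\<bar>) \<partial>sphere_measure)))"
        by (simp add: h_def exp_pot_integrable)
      also have "\<dots> \<le> d\<^sup>2 * C"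
        unfolding C_def h_def
        by (intro mult_left_mono add_mono K(2) K1(2) w w' n1) auto
      finally show ?thesis .
    qed
    \<comment> \<open>Cauchy-Schwarz against the constant 1, whose squared norm is 4 \<pi>; a factor
      1 / (4 \<pi>) < 1 is left over.\<close>
    have avg_diff: "(avg w - avg w')\<^sup>2 \<le> d\<^sup>2 * C"
    proof -
      have "avg w - avg w' = ipS e (\<lambda>_. 1) / (4 * pi)"
        by (simp add: avg_def sfint_def e_def ipS_def L2S_integrable exp_pot_L2S diff_divide_distrib)
      then have "(avg w - avg w')\<^sup>2 = (ipS e (\<lambda>_. 1))\<^sup>2 / (4 * pi)\<^sup>2" by (simp add: power_divide)
      also have "\<dots> \<le> (ipS e e * (4 * pi)) / (4 * pi)\<^sup>2"
        using ipS_Cauchy_Schwarz[OF eL L2S_const[of 1]]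
        by (intro divide_right_mono) (auto simp: ipS_def measure_sphere_measure_UNIV)
      also have "\<dots> = ipS e e / (4 * pi)" by (simp add: power2_eq_square)
      also have "\<dots> \<le> ipS e e / 1"
        using pi_gt3 by (intro divide_left_mono ipS_self_nonneg) auto
      finally show ?thesis using ee by simp
    qed
    let ?g = "\<lambda>x. gibbs w x - gibbs w' x"
    have gL: "L2S ?g" by (intro L2S_diff gibbs_L2S)
    have exp4: "(\<integral>x. (exp (2 * pot w' x))\<^sup>2 \<partial>sphere_measure) \<le> K"
    proof -
      have "(\<integral>x. (exp (2 * pot w' x))\<^sup>2 \<partial>sphere_measure) \<le> (\<integral>x. exp (8 * \<bar>pot w' x\<bar>) \<partial>sphere_measure)"
        using exp_pot_L2S[of w'] by (intro integral_mono exp_pot_integrable) (auto simp: L2S_def exp_double[symmetric])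
      then show ?thesis using K(2)[OF w'] by linarith
    qed
    \<comment> \<open>The difference of the quotients is e / a + exp (2 pot w') (b - a) / (a b) with
      averages a, b \<ge> 1, so both denominators can be replaced by 1.\<close>
    have pw: "(?g x)\<^sup>2 \<le> 2 * (e x)\<^sup>2 + 2 * (avg w - avg w')\<^sup>2 * (exp (2 * pot w' x))\<^sup>2" for x
    proof -
      define a b where "a = avg w" and "b = avg w'"
      have ab: "1 \<le> a" "1 \<le> b" using avg_ge_1 by (auto simp: a_def b_def)
      have "?g x = e x / a + exp (2 * pot w' x) * ((b - a) / (a * b))"
        unfolding gibbs_def e_def a_def[symmetric] b_def[symmetric] using ab by (simp add: field_simps)
      then have "(?g x)\<^sup>2 \<le> 2 * (e x / a)\<^sup>2 + 2 * (exp (2 * pot w' x) * ((b - a) / (a * b)))\<^sup>2"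
        using sum_squares_bound[of "e x / a" "exp (2 * pot w' x) * ((b - a) / (a * b))"] by (simp add: power2_sum)
      also have "(e x / a)\<^sup>2 \<le> (e x)\<^sup>2"
      proof -
        have "(e x)\<^sup>2 / a\<^sup>2 \<le> (e x)\<^sup>2 / 1" using ab by (intro divide_left_mono) auto
        then show ?thesis by (simp add: power_divide)
      qed
      also have "(exp (2 * pot w' x) * ((b - a) / (a * b)))\<^sup>2 \<le> (exp (2 * pot w' x))\<^sup>2 * (a - b)\<^sup>2"
      proof -
        have "1 \<le> a * b" using ab by (metis mult_mono' mult_1 zero_le_one)
        then have "1 \<le> (a * b)\<^sup>2" by simp
        then have "(b - a)\<^sup>2 / (a * b)\<^sup>2 \<le> (b - a)\<^sup>2 / 1" by (intro divide_left_mono) auto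
        then have "((b - a) / (a * b))\<^sup>2 \<le> (a - b)\<^sup>2" by (simp only: power_divide power2_commute[of a b] div_by_1)
        then show ?thesis unfolding power_mult_distrib by (intro mult_left_mono) auto
      qed
      finally show ?thesis by (simp add: a_def b_def ac_simps)
    qed
    have "(norm (gam w - gam w'))\<^sup>2 = ipS ?g ?g"
      unfolding gam_def by (simp add: cf_diff[symmetric] gibbs_L2S norm_cf gL)
    also have "\<dots> \<le> (\<integral>x. 2 * (e x)\<^sup>2 + 2 * (avg w - avg w')\<^sup>2 * (exp (2 * pot w' x))\<^sup>2 \<partial>sphere_measure)"
      unfolding ipS_self using gL eL exp_pot_L2S[of w']
      by (intro integral_mono pw) (auto simp: L2S_def)
    also have "\<dots> = 2 * ipS e e + 2 * (avg w - avg w')\<^sup>2 * (\<integral>x. (exp (2 * pot w' x))\<^sup>2 \<partial>sphere_measure)"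
      unfolding ipS_self using eL exp_pot_L2S[of w'] by (simp add: L2S_def)
    also have "\<dots> \<le> 2 * (d\<^sup>2 * C) + 2 * (d\<^sup>2 * C) * K"
      using ee avg_diff exp4 C by (intro add_mono mult_mono mult_left_mono) auto
    also have "\<dots> = (sqrt (2 * C * (1 + K)) * d)\<^sup>2"
      using C K by (simp add: power_mult_distrib algebra_simps)
    finally have "norm (gam w - gam w') \<le> sqrt (2 * C * (1 + K)) * d"
    proof (rule power2_le_imp_le)
      have "0 \<le> 2 * C * (1 + K)" using C K(1) by simp
      then show "0 \<le> sqrt (2 * C * (1 + K)) * d" using d by simp
    qed
    then show ?thesis by (simp only: d_def)
  qed simp
  moreover have "0 \<le> sqrt (2 * C * (1 + K))" using C K(1) by simp
  ultimately show ?thesis by blast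
qed

lemma gam_coef_0: "l2_nth (gam w) 0 = 0"
proof -
  have "sqrt (4 * pi) * ipS (gibbs w) (Y 0) = 0"
    unfolding integral_eq_ipS_Y0[symmetric] by (rule gibbs_mean)
  then show ?thesis by (simp add: gam_def l2_nth_cf gibbs_L2S)
qed

section \<open>The evolution equation for the coefficients\<close>

lemma norm_vec_le_sum: "norm (x :: 'a::real_normed_vector ^ 'n::finite) \<le> (\<Sum>i\<in>UNIV. norm (x $ i))"
  unfolding norm_vec_def by (rule L2_set_le_sum) auto

lemma norm_vec_square: "(norm (x :: 'a::real_normed_vector ^ 'n::finite))\<^sup>2 = (\<Sum>i\<in>UNIV. (norm (x $ i))\<^sup>2)"
  by (simp add: norm_vec_def L2_set_def sum_nonneg)

definition mv :: "(nat \<Rightarrow> real) \<Rightarrow> l2 ^ 'n \<Rightarrow> l2 ^ 'n" where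
  "mv m W = (\<chi> i. mlt m (W $ i))"

lemma mv_nth [simp]: "mv m W $ i = mlt m (W $ i)"
  by (simp add: mv_def)

lemma mv_diff: "(\<And>k. \<bar>m k\<bar> \<le> 1) \<Longrightarrow> mv m (x - y) = mv m x - mv m y"
  by (simp add: vec_eq_iff mlt_diff)

lemma norm_mv_le:
  assumes "\<And>k. \<bar>m k\<bar> \<le> 1" shows "norm (mv m (W :: l2 ^ 'n::finite)) \<le> norm W"
proof (rule power2_le_imp_le)
  show "(norm (mv m W))\<^sup>2 \<le> (norm W)\<^sup>2"
    unfolding norm_vec_square by (intro sum_mono power_mono) (auto intro: norm_mlt_le assms)
qed simp

lemma continuous_on_mv:
  fixes x :: "real \<Rightarrow> l2 ^ 'n::finite"
  assumes "\<And>k. continuous_on S (\<lambda>t. m t k)" "\<And>t k. \<bar>m t k\<bar> \<le> 1" "continuous_on S x"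
  shows "continuous_on S (\<lambda>t. mv (m t) (x t))"
  unfolding mv_def
  by (intro continuous_on_vec_lambda continuous_on_mlt assms continuous_on_component)

definition Cs :: "real \<Rightarrow> nat \<Rightarrow> real" where "Cs t k = cos (t * sqrt (lam k))"
definition Sn :: "real \<Rightarrow> nat \<Rightarrow> real" where "Sn t k = sin (t * sqrt (lam k))"

lemma Cs_bound: "\<bar>Cs t k\<bar> \<le> 1" and Sn_bound: "\<bar>Sn t k\<bar> \<le> 1"
  by (simp_all add: Cs_def Sn_def)

lemma Cs_continuous: "continuous_on S (\<lambda>t. Cs t k)" and Sn_continuous: "continuous_on S (\<lambda>t. Sn t k)"
  unfolding Cs_def Sn_def by (intro continuous_intros)+

definition NN :: "real^'n^'n \<Rightarrow> real^'n \<Rightarrow> l2 ^ 'n \<Rightarrow> l2 ^ 'n::finite" where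
  "NN A M W = (\<chi> i. \<Sum>j\<in>UNIV. (A $ i $ j * M $ j) *\<^sub>R gam (W $ j))"

lemma NN_lipschitz:
  fixes A :: "real^'n^'n" and M :: "real^'n::finite"
  shows "\<exists>B\<ge>0. \<forall>W W'. norm W \<le> R \<longrightarrow> norm W' \<le> R \<longrightarrow> norm (NN A M W - NN A M W') \<le> B * norm (W - W')"
proof -
  obtain B where B: "B \<ge> 0"
    "\<And>w w'. norm w \<le> R \<Longrightarrow> norm w' \<le> R \<Longrightarrow> norm (gam w - gam w') \<le> B * norm (w - w')"
    using gam_lipschitz[of R] by blast
  define C where "C = (\<Sum>i\<in>UNIV. \<Sum>j\<in>UNIV. \<bar>A $ i $ j * M $ j\<bar> * B)"
  have "norm (NN A M W - NN A M W') \<le> C * norm (W - W')" if W: "norm W \<le> R" "norm W' \<le> R" for W W'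
  proof -
    have n: "norm (gam (W $ j) - gam (W' $ j)) \<le> B * norm (W - W')" for j
    proof -
      have "norm (gam (W $ j) - gam (W' $ j)) \<le> B * norm (W $ j - W' $ j)"
        using W Finite_Cartesian_Product.norm_nth_le[of W j] Finite_Cartesian_Product.norm_nth_le[of W' j] by (intro B(2)) auto
      also have "\<dots> \<le> B * norm (W - W')"
        using Finite_Cartesian_Product.norm_nth_le[of "W - W'" j] B(1) by (intro mult_left_mono) auto
      finally show ?thesis .
    qed
    have "norm (NN A M W - NN A M W') \<le> (\<Sum>i\<in>UNIV. norm ((NN A M W - NN A M W') $ i))"
      by (rule norm_vec_le_sum)
    also have "\<dots> = (\<Sum>i\<in>UNIV. norm (\<Sum>j\<in>UNIV. (A $ i $ j * M $ j) *\<^sub>R (gam (W $ j) - gam (W' $ j))))"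
      by (simp add: NN_def sum_subtractf scaleR_diff_right)
    also have "\<dots> \<le> (\<Sum>i\<in>UNIV. \<Sum>j\<in>UNIV. norm ((A $ i $ j * M $ j) *\<^sub>R (gam (W $ j) - gam (W' $ j))))"
      by (intro sum_mono norm_sum)
    also have "\<dots> \<le> (\<Sum>i\<in>UNIV. \<Sum>j\<in>UNIV. \<bar>A $ i $ j * M $ j\<bar> * (B * norm (W - W')))"
      unfolding norm_scaleR by (intro sum_mono mult_left_mono n) auto
    also have "\<dots> = C * norm (W - W')" by (simp add: C_def sum_distrib_right mult.assoc)
    finally show ?thesis .
  qed
  moreover have "0 \<le> C" unfolding C_def using B(1) by (intro sum_nonneg) auto
  ultimately show ?thesis by blast
qed

lemma NN_continuous:
  fixes A :: "real^'n^'n" and M :: "real^'n::finite"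
  shows "continuous_on UNIV (NN A M)"
proof (rule continuous_at_imp_continuous_on, rule ballI)
  fix W :: "l2 ^ 'n"
  obtain B where B: "B \<ge> 0" "\<And>V V'. norm V \<le> norm W + 1 \<Longrightarrow> norm V' \<le> norm W + 1
      \<Longrightarrow> norm (NN A M V - NN A M V') \<le> B * norm (V - V')"
    using NN_lipschitz[of "norm W + 1" A M] by blast
  have "continuous_on (ball 0 (norm W + 1)) (NN A M)"
    by (rule lipschitz_on_continuous_on[where L = B])
       (auto simp: lipschitz_on_def dist_norm intro!: B)
  then show "isCont (NN A M) W"
    by (rule continuous_on_interior) simp
qed

text \<open>Rotates back: with \<open>y\<close> the pair of variables described below, this recovers
  w, the argument of the nonlinearity.\<close>

definition osc :: "real \<Rightarrow> (l2 ^ 'n) \<times> (l2 ^ 'n) \<Rightarrow> l2 ^ 'n::finite" where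
  "osc t y = mv (Cs t) (fst y) + mv (Sn t) (snd y)"

text \<open>With \<open>w = sqrt (-\<Delta>) u\<close> and \<open>v = u\<^sub>t\<close>, undoing the free evolution gives the variables
  \<open>cos w - sin v\<close> and \<open>sin w + cos v\<close>, which are differentiable in time with the derivative
  \<open>Gv\<close> below; in them the wave equation is an ordinary differential equation in a Banach space.\<close>

definition Gv :: "real^'n^'n \<Rightarrow> real^'n \<Rightarrow> real \<Rightarrow> (l2 ^ 'n) \<times> (l2 ^ 'n) \<Rightarrow> (l2 ^ 'n) \<times> (l2 ^ 'n::finite)" where
  "Gv A M t y = (- mv (Sn t) (NN A M (osc t y)), mv (Cs t) (NN A M (osc t y)))"

lemma norm_osc_le: "norm (osc t y) \<le> 2 * norm y"
proof -
  have "norm (osc t y) \<le> norm (mv (Cs t) (fst y)) + norm (mv (Sn t) (snd y))"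
    unfolding osc_def by (rule norm_triangle_ineq)
  also have "\<dots> \<le> norm (fst y) + norm (snd y)"
    by (intro add_mono norm_mv_le Cs_bound Sn_bound)
  also have "\<dots> \<le> norm y + norm y"
    using norm_fst_le[of "fst y" "snd y"] norm_snd_le[of "snd y" "fst y"] by (intro add_mono) auto
  finally show ?thesis by simp
qed

lemma osc_diff: "osc t (y - z) = osc t y - osc t z"
  by (simp add: osc_def mv_diff Cs_bound Sn_bound)

lemma norm_rot_le: "norm (- mv (Sn t) x, mv (Cs t) x) \<le> 2 * norm x"
proof -
  have "norm (- mv (Sn t) x, mv (Cs t) x) \<le> norm (- mv (Sn t) x) + norm (mv (Cs t) x)"
    by (rule norm_Pair_le)
  also have "\<dots> \<le> norm x + norm x" unfolding norm_minus_cancel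
    by (intro add_mono norm_mv_le Cs_bound Sn_bound)
  finally show ?thesis by simp
qed

lemma osc_continuous: "continuous_on S y \<Longrightarrow> continuous_on S (\<lambda>t. osc t (y t))"
  unfolding osc_def
  by (intro continuous_intros continuous_on_mv Cs_continuous Sn_continuous Cs_bound Sn_bound)

lemma NN_osc_continuous: "continuous_on S y \<Longrightarrow> continuous_on S (\<lambda>t. NN A M (osc t (y t)))"
  by (rule continuous_on_compose2[OF NN_continuous osc_continuous]) auto

lemma Gv_continuous: "continuous_on S y \<Longrightarrow> continuous_on S (\<lambda>t. Gv A M t (y t))"
  unfolding Gv_def
  by (intro continuous_intros continuous_on_mv Cs_continuous Sn_continuous Cs_bound Sn_bound NN_osc_continuous)

lemma evolution_exists:
  fixes A :: "real^'n^'n" and M :: "real^'n::finite"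
  shows "\<exists>T>0. \<forall>y0. norm y0 \<le> r \<longrightarrow> (\<exists>y. continuous_on {0..T} y \<and>
     (\<forall>t\<in>{0..T}. y t = y0 + integral {0..t} (\<lambda>s. Gv A M s (y s))))"
proof (cases "0 \<le> r")
  \<comment> \<open>Negative radii occur because the final theorem chooses the lifespan as a
    function on all reals.\<close>
  case False
  then have "\<not> norm (y0 :: (l2 ^ 'n) \<times> (l2 ^ 'n)) \<le> r" for y0 using norm_ge_zero[of y0] by linarith
  then show ?thesis by (intro exI[of _ 1]) auto
next
  case True
  \<comment> \<open>The iteration stays in the unit ball around \<open>y0\<close>, so norms are at
    most r + 1, and \<open>osc\<close> at most doubles them.\<close>
  define R where "R = 2 * (r + 1)"
  obtain B where B: "B \<ge> 0" "\<And>V V'. norm V \<le> R \<Longrightarrow> norm V' \<le> R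
      \<Longrightarrow> norm (NN A M V - NN A M V') \<le> B * norm (V - V')"
    using NN_lipschitz[of R A M] by blast
  define K where "K = norm (NN A M 0) + B * R"
  have K: "0 \<le> K" using B True by (simp add: K_def R_def)
  \<comment> \<open>Staying in the unit ball requires 2 K T \<le> 1, contraction requires 4 B T < 1.
    The factor 2 is that of \<open>norm_rot_le\<close>, and 4 combines it with the 2 of
    \<open>norm_osc_le\<close>; the summand 1 makes the second inequality strict.\<close>
  define T where "T = 1 / (1 + 2 * K + 4 * B)"
  have den: "0 < 1 + 2 * K + 4 * B" using K B by simp
  have T: "0 < T" unfolding T_def using den by simp
  have "\<exists>y. continuous_on {0..T} y \<and> (\<forall>t\<in>{0..T}. y t = y0 + integral {0..t} (\<lambda>s. Gv A M s (y s)))"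
    if y0: "norm y0 \<le> r" for y0
  proof -
    have in_ball: "norm (osc t y) \<le> R" if "y \<in> cball y0 1" for t y
    proof -
      have "norm y \<le> norm y0 + norm (y - y0)" by (rule norm_triangle_sub)
      also have "\<dots> \<le> r + 1" using that y0 by (simp add: dist_norm norm_minus_commute)
      finally show ?thesis using norm_osc_le[of t y] by (simp add: R_def)
    qed
    have "\<exists>y. continuous_on {0..T} y \<and> (\<forall>t\<in>{0..T}. y t \<in> cball y0 1) \<and>
             (\<forall>t\<in>{0..T}. y t = y0 + integral {0..t} (\<lambda>s. Gv A M s (y s)))"
    proof (rule picard_lindeloef[where B = "2 * K" and L = "4 * B"])
      show "continuous_on {0..T} (\<lambda>s. Gv A M s (f s))" if "continuous_on {0..T} f" for f
        using that by (rule Gv_continuous)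
      fix t y assume y: "y \<in> cball y0 1"
      have "norm (NN A M (osc t y)) \<le> norm (NN A M 0) + norm (NN A M (osc t y) - NN A M 0)"
        by (rule norm_triangle_sub)
      also have "norm (NN A M (osc t y) - NN A M 0) \<le> B * norm (osc t y - 0)"
        by (rule B(2)) (use in_ball[OF y, of t] True in \<open>auto simp: R_def\<close>)
      also have "\<dots> \<le> B * R" using in_ball[OF y, of t] B(1) by (intro mult_left_mono) auto
      finally have "norm (NN A M (osc t y)) \<le> K" by (simp add: K_def)
      then show "norm (Gv A M t y) \<le> 2 * K"
        using norm_rot_le[of t "NN A M (osc t y)"] unfolding Gv_def by linarith
      fix z assume z: "z \<in> cball y0 1"
      have "norm (Gv A M t y - Gv A M t z)
          = norm (- mv (Sn t) (NN A M (osc t y) - NN A M (osc t z)), mv (Cs t) (NN A M (osc t y) - NN A M (osc t z)))"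
        by (simp add: Gv_def mv_diff Sn_bound Cs_bound)
      also have "\<dots> \<le> 2 * norm (NN A M (osc t y) - NN A M (osc t z))" by (rule norm_rot_le)
      also have "\<dots> \<le> 2 * (B * norm (osc t y - osc t z))"
        using in_ball[OF y, of t] in_ball[OF z, of t] by (intro mult_left_mono B(2)) auto
      also have "\<dots> \<le> 2 * (B * (2 * norm (y - z)))"
        unfolding osc_diff[symmetric] using B(1) by (intro mult_left_mono norm_osc_le) auto
      finally show "norm (Gv A M t y - Gv A M t z) \<le> 4 * B * norm (y - z)" by simp
    next
      show "T * (2 * K) \<le> 1" using den B(1) K by (simp add: T_def divide_simps)
      show "T * (4 * B) < 1" using den B(1) K by (simp add: T_def divide_simps)
    qed (use T B(1) in auto)
    then show ?thesis by blast
  qed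
  with T show ?thesis by blast
qed

section \<open>Translation between sequence norms and norms on the sphere\<close>

definition h1c :: "(real^3 \<Rightarrow> real) \<Rightarrow> l2" where
  "h1c u = Abs_l2 (\<lambda>k. sqrt (lam k) * ipS u (Y k))"

lemma h1c:
  assumes "H1S u"
  shows "l2_nth (h1c u) k = sqrt (lam k) * ipS u (Y k)" "(norm (h1c u))\<^sup>2 = h1sq u"
proof -
  have "summable (\<lambda>k. (sqrt (lam k) * ipS u (Y k))\<^sup>2)"
    using H1S_summable[OF assms] by (simp add: power_mult_distrib lam_nonneg)
  then have *: "l2_nth (h1c u) k = sqrt (lam k) * ipS u (Y k)" for k
    by (simp add: h1c_def l2_nth_Abs)
  then show "l2_nth (h1c u) k = sqrt (lam k) * ipS u (Y k)" .
  show "(norm (h1c u))\<^sup>2 = h1sq u"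
    unfolding norm_l2_square h1sq_eq[OF assms] by (simp add: * power_mult_distrib lam_nonneg)
qed

text \<open>Index 0 is left free: \<open>lam 0 = 0\<close>, so the seminorm does not see the mean.
  The statement thus applies to u itself and not only to its zero-mean part. The norm bound is an
  inequality since entries of \<open>w\<close> may sit at index 0 or at degenerate indices.\<close>

lemma H1S_from_coef:
  assumes f: "L2S f" and c: "\<And>k. k \<noteq> 0 \<Longrightarrow> ipS f (Y k) = iom k * l2_nth w k * nY k"
  shows "H1S f" "h1sq f \<le> (norm w)\<^sup>2"
proof -
  have le: "lam k * (ipS f (Y k))\<^sup>2 \<le> (l2_nth w k)\<^sup>2" for k
  proof (cases "k = 0")
    case False
    then have l: "0 < lam k" using lam_ge_2[of k] by simp
    have "lam k * (ipS f (Y k))\<^sup>2 = (l2_nth w k)\<^sup>2 * (nY k)\<^sup>2"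
      using l False by (simp add: c power_mult_distrib iom_square)
    then show ?thesis using nY_cases[of k] by auto
  qed (simp add: lam_0)
  have sm: "summable (\<lambda>k. lam k * (ipS f (Y k))\<^sup>2)"
    by (rule summable_comparison_test_ev[OF _ summable_l2[of w]])
       (auto simp: lam_nonneg abs_mult intro!: always_eventually le)
  show H: "H1S f" using f sm by (simp add: H1S_iff)
  show "h1sq f \<le> (norm w)\<^sup>2"
    unfolding h1sq_eq[OF H] norm_l2_square by (intro suminf_le le sm summable_l2)
qed

lemma L2_from_coef:
  assumes f: "L2S f" and c: "\<And>k. ipS f (Y k) = l2_nth w k * nY k"
  shows "(\<integral>x. (f x)\<^sup>2 \<partial>sphere_measure) \<le> (norm w)\<^sup>2"
proof -
  have cs: "(\<lambda>k. (ipS f (Y k))\<^sup>2) sums ipS f f"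
    using parseval[OF f f] by (simp add: power2_eq_square)
  have "ipS f f \<le> (norm w)\<^sup>2"
    unfolding sums_unique[OF cs] norm_l2_square
  proof (intro suminf_le summable_l2 sums_summable[OF cs])
    fix k show "(ipS f (Y k))\<^sup>2 \<le> (l2_nth w k)\<^sup>2" using nY_cases[of k] by (auto simp: c)
  qed
  then show ?thesis by (simp add: ipS_self)
qed

lemma H1vnorm_le:
  fixes f :: "real^3 \<Rightarrow> real^'n::finite" and w :: "l2 ^ 'n"
  assumes f: "\<And>i. L2S (\<lambda>x. f x $ i)"
    and c: "\<And>i k. k \<noteq> 0 \<Longrightarrow> ipS (\<lambda>x. f x $ i) (Y k) = iom k * l2_nth (w $ i) k * nY k"
  shows "H1vnorm f \<le> norm w"
proof -
  have "(\<Sum>i\<in>UNIV. h1sq (\<lambda>x. f x $ i)) \<le> (norm w)\<^sup>2"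
    unfolding norm_vec_square by (intro sum_mono H1S_from_coef(2) f c)
  then have "sqrt (\<Sum>i\<in>UNIV. h1sq (\<lambda>x. f x $ i)) \<le> sqrt ((norm w)\<^sup>2)" by (rule real_sqrt_le_mono)
  then show ?thesis by (simp add: H1vnorm_def)
qed

lemma L2vnorm_le:
  fixes f :: "real^3 \<Rightarrow> real^'n::finite" and w :: "l2 ^ 'n"
  assumes f: "\<And>i. L2S (\<lambda>x. f x $ i)"
    and c: "\<And>i k. ipS (\<lambda>x. f x $ i) (Y k) = l2_nth (w $ i) k * nY k"
  shows "L2vnorm f \<le> norm w"
proof -
  have "(\<Sum>i\<in>UNIV. \<integral>x. (f x $ i)\<^sup>2 \<partial>sphere_measure) \<le> (norm w)\<^sup>2"
    unfolding norm_vec_square by (intro sum_mono L2_from_coef f c)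
  then have "sqrt (\<Sum>i\<in>UNIV. \<integral>x. (f x $ i)\<^sup>2 \<partial>sphere_measure) \<le> sqrt ((norm w)\<^sup>2)" by (rule real_sqrt_le_mono)
  then show ?thesis by (simp add: L2vnorm_def)
qed

lemma h1sq_nonneg: "0 \<le> h1sq u"
  unfolding h1sq_def by (intro Bochner_Integration.integral_nonneg sum_nonneg) auto

lemma H1vnorm_nonneg: "0 \<le> H1vnorm u" and L2vnorm_nonneg: "0 \<le> L2vnorm u"
  by (simp_all add: H1vnorm_def L2vnorm_def sum_nonneg h1sq_nonneg)

lemma tendsto_zero_norm_bound:
  assumes "\<And>s. s \<in> S \<Longrightarrow> s \<noteq> t \<Longrightarrow> 0 \<le> f s \<and> f s \<le> norm (g s)" and "(g \<longlongrightarrow> 0) (at t within S)"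
  shows "(f \<longlongrightarrow> (0::real)) (at t within S)"
  by (rule Lim_null_comparison[OF _ tendsto_norm_zero[OF assms(2)]])
     (use assms(1) in \<open>auto simp: eventually_at_filter\<close>)

section \<open>The solution\<close>

lemma iom_0: "iom 0 = 0"
  by (simp add: iom_def)

lemma l2_nth_sum: "l2_nth (\<Sum>i\<in>I. f i) k = (\<Sum>i\<in>I. l2_nth (f i) k)"
  by (induction I rule: infinite_finite_induct) auto

lemma has_vector_derivative_slope:
  fixes f :: "real \<Rightarrow> 'a::real_normed_vector"
  assumes "(f has_vector_derivative d) (at t within S)"
  shows "((\<lambda>s. (f s - f t) /\<^sub>R (s - t) - d) \<longlongrightarrow> 0) (at t within S)"
proof -
  have lim: "((\<lambda>s. (1 / norm (s - t)) *\<^sub>R (f s - (f t + (s - t) *\<^sub>R d))) \<longlongrightarrow> 0) (at t within S)"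
    using assms unfolding has_vector_derivative_def has_derivative_within by simp
  show ?thesis
  proof (rule Lim_null_comparison[OF _ tendsto_norm_zero[OF lim]])
    have "norm ((f s - f t) /\<^sub>R (s - t) - d) \<le> norm ((1 / norm (s - t)) *\<^sub>R (f s - (f t + (s - t) *\<^sub>R d)))"
      if "s \<noteq> t" for s
    proof -
      have "(f s - f t) /\<^sub>R (s - t) - d = inverse (s - t) *\<^sub>R (f s - (f t + (s - t) *\<^sub>R d))"
      proof -
        have "d = inverse (s - t) *\<^sub>R ((s - t) *\<^sub>R d)" using that by simp
        then have "(f s - f t) /\<^sub>R (s - t) - d = (f s - f t) /\<^sub>R (s - t) - ((s - t) *\<^sub>R d) /\<^sub>R (s - t)" by simp
        then show ?thesis unfolding scaleR_diff_right[symmetric] by (simp only: diff_diff_eq)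
      qed
      then show ?thesis by (simp add: divide_inverse)
    qed
    then show "\<forall>\<^sub>F s in at t within S. norm ((f s - f t) /\<^sub>R (s - t) - d)
        \<le> norm ((1 / norm (s - t)) *\<^sub>R (f s - (f t + (s - t) *\<^sub>R d)))"
      by (auto simp: eventually_at_filter)
  qed
qed

text \<open>The setting is a continuous solution \<open>y\<close> of the integrated equation in
  sequence space; u and its time derivative v are recovered from it inside this locale.\<close>

locale wave_evolution =
  fixes A :: "real^'n^'n" and M :: "real^'n::finite" and T :: real
    and u0 u1 :: "real^3 \<Rightarrow> real^'n" and y :: "real \<Rightarrow> (l2 ^ 'n) \<times> (l2 ^ 'n)"
  assumes T: "0 < T"
    and u0: "\<And>i. H1S (\<lambda>x. u0 x $ i)" and u1: "\<And>i. L2S (\<lambda>x. u1 x $ i)"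
    and u1_mean: "\<And>i. (\<integral>x. u1 x $ i \<partial>sphere_measure) = 0"
    and y_cont: "continuous_on {0..T} y"
    and y_eq: "\<And>t. t \<in> {0..T} \<Longrightarrow> y t = (\<chi> i. h1c (\<lambda>x. u0 x $ i), \<chi> i. cf (\<lambda>x. u1 x $ i))
          + integral {0..t} (\<lambda>s. Gv A M s (y s))"
begin

definition "a i k = ipS (\<lambda>x. u0 x $ i) (Y k)"
definition "b i k = ipS (\<lambda>x. u1 x $ i) (Y k)"
definition "W t = osc t (y t)"
definition "F t = NN A M (W t)"
definition "V t = mv (Cs t) (snd (y t)) - mv (Sn t) (fst (y t))"
text \<open>\<open>p\<close> and \<open>q\<close> are the scalar forms of the two components of
  \<open>y\<close> (see \<open>y_coef\<close>): initial data plus the forcing, weighted with the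
  sine and cosine at the time s when it acts.\<close>

definition "p i k t = sqrt (lam k) * a i k - integral {0..t} (\<lambda>s. Sn s k * l2_nth (F s $ i) k)"
definition "q i k t = b i k + integral {0..t} (\<lambda>s. Cs s k * l2_nth (F s $ i) k)"
definition "m i = (\<integral>x. u0 x $ i \<partial>sphere_measure) / (4 * pi)"
text \<open>The mean of \<open>u0\<close> is inserted by hand, since \<open>pot\<close> has mean
  zero. That the equation demands the same mean is the case k = 0 of
  \<open>u_duhamel\<close>.\<close>

definition "u t x = (\<chi> i. m i + pot (W t $ i) x)"
definition "v t x = (\<chi> i. synth (V t $ i) x)"

lemma u0_L2S: "L2S (\<lambda>x. u0 x $ i)"
  using u0[of i] by (simp add: H1S_def)

lemma W_cont: "continuous_on {0..T} W"
  unfolding W_def[abs_def] by (rule osc_continuous[OF y_cont])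

lemma F_cont: "continuous_on {0..T} F"
  unfolding F_def[abs_def] W_def by (rule NN_osc_continuous[OF y_cont])

lemma V_cont: "continuous_on {0..T} V"
  unfolding V_def[abs_def]
  by (intro continuous_intros continuous_on_mv Cs_continuous Sn_continuous Cs_bound Sn_bound y_cont)

lemma F_coef_cont: "continuous_on {0..T} (\<lambda>t. l2_nth (F t $ i) k)"
  by (intro bounded_linear.continuous_on[OF bounded_linear_l2_nth] continuous_on_component F_cont)

lemma bounded_linear_coef: "bounded_linear (\<lambda>z :: l2 ^ 'n. l2_nth (z $ i) k)"
  by (rule bounded_linear_compose[OF bounded_linear_l2_nth bounded_linear_vec_nth])

lemma y_coef:
  assumes t: "t \<in> {0..T}"
  shows "l2_nth (fst (y t) $ i) k = p i k t" "l2_nth (snd (y t) $ i) k = q i k t"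
proof -
  have "continuous_on {0..t} (\<lambda>s. Gv A M s (y s))"
    using t by (intro continuous_on_subset[OF Gv_continuous[OF y_cont]]) auto
  then have int: "(\<lambda>s. Gv A M s (y s)) integrable_on {0..t}" by (rule integrable_continuous_real)
  have bl: "bounded_linear (\<lambda>z :: (l2 ^ 'n) \<times> (l2 ^ 'n). l2_nth (fst z $ i) k)"
    "bounded_linear (\<lambda>z :: (l2 ^ 'n) \<times> (l2 ^ 'n). l2_nth (snd z $ i) k)"
    by (rule bounded_linear_compose[OF bounded_linear_coef bounded_linear_fst],
        rule bounded_linear_compose[OF bounded_linear_coef bounded_linear_snd])
  have G: "l2_nth (fst (Gv A M s (y s)) $ i) k = - (Sn s k * l2_nth (F s $ i) k)"
    "l2_nth (snd (Gv A M s (y s)) $ i) k = Cs s k * l2_nth (F s $ i) k" for s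
    by (simp_all add: Gv_def F_def W_def Sn_bound Cs_bound)
  show "l2_nth (fst (y t) $ i) k = p i k t"
    using integral_linear[OF int bl(1)]
    by (subst y_eq[OF t]) (simp add: p_def o_def G h1c[OF u0] a_def)
  show "l2_nth (snd (y t) $ i) k = q i k t"
    using integral_linear[OF int bl(2)]
    by (subst y_eq[OF t]) (simp add: q_def o_def G l2_nth_cf u1 b_def)
qed

lemma W_coef: "t \<in> {0..T} \<Longrightarrow> l2_nth (W t $ i) k = Cs t k * p i k t + Sn t k * q i k t"
  by (simp add: W_def osc_def Cs_bound Sn_bound y_coef)

lemma V_coef: "t \<in> {0..T} \<Longrightarrow> l2_nth (V t $ i) k = Cs t k * q i k t - Sn t k * p i k t"
  by (simp add: V_def Cs_bound Sn_bound y_coef)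

lemma F_0: "l2_nth (F t $ i) 0 = 0"
  by (simp add: F_def NN_def l2_nth_sum gam_coef_0)

lemma b_0: "b i 0 = 0"
  using u1_mean[of i] by (simp add: integral_eq_ipS_Y0 b_def)

lemma V_0: "t \<in> {0..T} \<Longrightarrow> l2_nth (V t $ i) 0 = 0"
  by (simp add: V_coef Sn_def lam_0 q_def b_0 F_0)

lemma p_deriv:
  assumes t: "t \<in> {0..T}"
  shows "(p i k has_real_derivative - (Sn t k * l2_nth (F t $ i) k)) (at t within {0..T})"
    "(q i k has_real_derivative Cs t k * l2_nth (F t $ i) k) (at t within {0..T})"
proof -
  have S: "((\<lambda>t. integral {0..t} (\<lambda>s. Sn s k * l2_nth (F s $ i) k)) has_real_derivative Sn t k * l2_nth (F t $ i) k) (at t within {0..T})"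
    unfolding has_real_derivative_iff_has_vector_derivative
    by (rule integral_has_vector_derivative[OF _ t]) (intro continuous_intros Sn_continuous F_coef_cont)
  have C: "((\<lambda>t. integral {0..t} (\<lambda>s. Cs s k * l2_nth (F s $ i) k)) has_real_derivative Cs t k * l2_nth (F t $ i) k) (at t within {0..T})"
    unfolding has_real_derivative_iff_has_vector_derivative
    by (rule integral_has_vector_derivative[OF _ t]) (intro continuous_intros Cs_continuous F_coef_cont)
  show "(p i k has_real_derivative - (Sn t k * l2_nth (F t $ i) k)) (at t within {0..T})"
    unfolding p_def[abs_def] by (rule derivative_eq_intros S refl | simp)+
  show "(q i k has_real_derivative Cs t k * l2_nth (F t $ i) k) (at t within {0..T})"
    unfolding q_def[abs_def] by (rule derivative_eq_intros C refl | simp)+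
qed

text \<open>Variation of constants: the derivatives of \<open>p\<close> and \<open>q\<close>
  contribute - cos sin F + sin cos F = 0, so only the rotation is differentiated, and its factor
  sqrt (lam k) cancels against \<open>iom k\<close>.\<close>

lemma Q_deriv:
  assumes t: "t \<in> {0..T}" and k: "k \<noteq> 0"
  shows "((\<lambda>t. iom k * (Cs t k * p i k t + Sn t k * q i k t)) has_real_derivative
          Cs t k * q i k t - Sn t k * p i k t) (at t within {0..T})"
proof -
  define om where "om = sqrt (lam k)"
  have om: "om \<noteq> 0" using lam_ge_2[of k] k by (simp add: om_def)
  have io: "iom k = 1 / om" using k by (simp add: iom_def om_def)
  have c: "((\<lambda>t. Cs t k) has_real_derivative - (om * Sn t k)) (at t within {0..T})"
    unfolding Cs_def Sn_def om_def[symmetric] by (auto intro!: derivative_eq_intros)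
  have s: "((\<lambda>t. Sn t k) has_real_derivative om * Cs t k) (at t within {0..T})"
    unfolding Cs_def Sn_def om_def[symmetric] by (auto intro!: derivative_eq_intros)
  have "((\<lambda>t. iom k * (Cs t k * p i k t + Sn t k * q i k t)) has_real_derivative
      iom k * ((- (om * Sn t k) * p i k t + - (Sn t k * l2_nth (F t $ i) k) * Cs t k)
             + (om * Cs t k * q i k t + Cs t k * l2_nth (F t $ i) k * Sn t k))) (at t within {0..T})"
    by (intro DERIV_cmult DERIV_add DERIV_mult c s p_deriv t)
  moreover have "iom k * ((- (om * Sn t k) * p i k t + - (Sn t k * l2_nth (F t $ i) k) * Cs t k)
             + (om * Cs t k * q i k t + Cs t k * l2_nth (F t $ i) k * Sn t k))
      = Cs t k * q i k t - Sn t k * p i k t"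
    using om by (simp add: io field_simps)
  ultimately show ?thesis by (simp only:)
qed

text \<open>Derivatives of single coefficients do not give a derivative in L^2. Integrated in time
  they become an identity in \<open>l2 ^ 'n\<close>, and since \<open>V\<close> is continuous there,
  that identity can be differentiated in norm. At index 0 it holds because \<open>iom 0 = 0\<close>
  and by \<open>V_0\<close>.\<close>

lemma Q_integral:
  assumes t: "t \<in> {0..T}"
  shows "mv iom (W t) = mv iom (W 0) + integral {0..t} V"
proof -
  have sub: "{0..t} \<subseteq> {0..T}" using t by auto
  have int: "V integrable_on {0..t}"
    by (intro integrable_continuous_real continuous_on_subset[OF V_cont] sub)
  have "iom k * l2_nth (W t $ i) k = iom k * l2_nth (W 0 $ i) k + l2_nth (integral {0..t} V $ i) k" for i k
  proof -
    have "l2_nth (integral {0..t} V $ i) k = integral {0..t} (\<lambda>s. l2_nth (V s $ i) k)"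
      using integral_linear[OF int bounded_linear_coef] by (simp add: o_def)
    also have "\<dots> = iom k * l2_nth (W t $ i) k - iom k * l2_nth (W 0 $ i) k"
    proof (cases "k = 0")
      case True
      have "integral {0..t} (\<lambda>s. l2_nth (V s $ i) 0) = integral {0..t} (\<lambda>s. 0)"
        using sub by (intro Henstock_Kurzweil_Integration.integral_cong V_0) auto
      then show ?thesis using True by (simp add: iom_def)
    next
      case False
      let ?Q = "\<lambda>t. iom k * (Cs t k * p i k t + Sn t k * q i k t)"
      have "((\<lambda>s. Cs s k * q i k s - Sn s k * p i k s) has_integral ?Q t - ?Q 0) {0..t}"
      proof (rule fundamental_theorem_of_calculus)
        show "0 \<le> t" using t by simp
        fix s assume "s \<in> {0..t}"
        then have "s \<in> {0..T}" using sub by blast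
        from Q_deriv[OF this False]
        show "(?Q has_vector_derivative Cs s k * q i k s - Sn s k * p i k s) (at s within {0..t})"
          unfolding has_real_derivative_iff_has_vector_derivative
          using sub by (rule has_vector_derivative_within_subset)
      qed
      then have "integral {0..t} (\<lambda>s. Cs s k * q i k s - Sn s k * p i k s) = ?Q t - ?Q 0"
        by (rule integral_unique)
      moreover have "integral {0..t} (\<lambda>s. l2_nth (V s $ i) k) = integral {0..t} (\<lambda>s. Cs s k * q i k s - Sn s k * p i k s)"
        using sub by (intro Henstock_Kurzweil_Integration.integral_cong V_coef) auto
      ultimately show ?thesis using t T by (simp add: W_coef)
    qed
    finally show ?thesis by simp
  qed
  then have "l2_nth (mv iom (W t) $ i) k = l2_nth ((mv iom (W 0) + integral {0..t} V) $ i) k" for i k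
    by (simp add: iom_bound)
  then have "mv iom (W t) $ i = (mv iom (W 0) + integral {0..t} V) $ i" for i
    by (intro l2_eqI)
  then show ?thesis by (simp only: vec_eq_iff simp_thms)
qed

lemma Q_vector_derivative:
  assumes t: "t \<in> {0..T}"
  shows "((\<lambda>t. mv iom (W t)) has_vector_derivative V t) (at t within {0..T})"
proof -
  have "((\<lambda>t. mv iom (W 0) + integral {0..t} V) has_vector_derivative 0 + V t) (at t within {0..T})"
    by (intro has_vector_derivative_add has_vector_derivative_const integral_has_vector_derivative V_cont t)
  then have *: "((\<lambda>t. mv iom (W 0) + integral {0..t} V) has_vector_derivative V t) (at t within {0..T})" by simp
  show ?thesis
    by (rule has_vector_derivative_transform[OF t _ *]) (rule Q_integral)
qed

lemma u_L2S: "L2S (\<lambda>x. u t x $ i)"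
  by (simp add: u_def L2S_add L2S_const pot_L2S)

lemma v_L2S: "L2S (\<lambda>x. v t x $ i)"
  by (simp add: v_def synth)

lemma v_coef: "ipS (\<lambda>x. v t x $ i) (Y k) = l2_nth (V t $ i) k * nY k"
  by (simp add: v_def synth)

lemma const_coef: "ipS (\<lambda>_. c) (Y k) = (if k = 0 then c * sqrt (4 * pi) else 0)"
proof -
  have "ipS (\<lambda>_. c) (Y k) = ipS (\<lambda>x. (c * sqrt (4 * pi)) * Y 0 x) (Y k)" by (simp add: Y_0)
  also have "\<dots> = c * sqrt (4 * pi) * ipS (Y 0) (Y k)" by (rule ipS_cmult_left)
  also have "\<dots> = (if k = 0 then c * sqrt (4 * pi) else 0)"
  proof -
    have "nY 0 = 1" using nY_cases[of 0] Y_0[of 0] by auto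
    then show ?thesis by (simp add: Y_orth)
  qed
  finally show ?thesis .
qed

lemma u_coef: "ipS (\<lambda>x. u t x $ i) (Y k) = (if k = 0 then a i 0 else iom k * l2_nth (W t $ i) k * nY k)"
proof -
  have "ipS (\<lambda>x. u t x $ i) (Y k) = ipS (\<lambda>_. m i) (Y k) + ipS (pot (W t $ i)) (Y k)"
    by (simp add: u_def ipS_add_left L2S_const pot_L2S Y_L2S)
  moreover have "m i * sqrt (4 * pi) = a i 0"
  proof -
    define s where "s = sqrt (4 * pi)"
    have s: "s * s = 4 * pi" "s \<noteq> 0" by (simp_all add: s_def)
    have "m i = s * a i 0 / (s * s)"
      unfolding s(1) by (simp only: m_def integral_eq_ipS_Y0 a_def s_def)
    then have "m i * s = a i 0" using s(2) by simp
    then show ?thesis by (simp only: s_def)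
  qed
  ultimately show ?thesis by (auto simp: const_coef pot_coef iom_def)
qed

lemma u_H1S: "H1S (\<lambda>x. u t x $ i)"
  by (rule H1S_from_coef(1)[OF u_L2S, where w = "W t $ i"]) (simp add: u_coef)

lemma u_mean: "(\<integral>x. u t x $ i \<partial>sphere_measure) = (\<integral>x. u0 x $ i \<partial>sphere_measure)"
  unfolding integral_eq_ipS_Y0 by (simp add: u_coef a_def)

lemma u_exp: "exp (2 * u t x $ j) = exp (2 * m j) * exp (2 * pot (W t $ j) x)"
  by (simp add: u_def exp_add[symmetric] algebra_simps)

lemma u_exp_integrable: "integrable sphere_measure (\<lambda>x. exp (2 * u t x $ j))"
  unfolding u_exp by (intro integrable_mult_right L2S_integrable exp_pot_L2S)

text \<open>The factor \<open>exp (2 * m j)\<close> produced by the mean cancels in the quotient, so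
  the nonlinearity depends on \<open>W\<close> alone.\<close>

lemma NL_u: "NL A M (u t) i = (\<lambda>x. \<Sum>j\<in>UNIV. (A $ i $ j * M $ j) * gibbs (W t $ j) x)"
proof -
  have "sfint (\<lambda>x. exp (2 * u t x $ j)) = exp (2 * m j) * avg (W t $ j)" for j
    unfolding u_exp by (simp add: avg_def sfint_def)
  then show ?thesis unfolding NL_def[abs_def] u_exp by (simp add: gibbs_def)
qed

lemma NL_L2S: "L2S (NL A M (u t) i)"
  unfolding NL_u by (intro L2S_lincomb gibbs_L2S)

lemma NL_coef: "ipS (NL A M (u t) i) (Y k) = l2_nth (F t $ i) k"
  unfolding NL_u
  by (simp add: ipS_lincomb_left gibbs_L2S Y_L2S F_def NN_def l2_nth_sum gam_def l2_nth_cf)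

text \<open>The addition theorem splits sin ((t - s) sqrt (lam k)) into the sine and cosine weights
  in \<open>p\<close> and \<open>q\<close>. At k = 0 the forcing and the initial velocity vanish,
  and the constant mode stays at \<open>a i 0\<close>.\<close>

lemma u_duhamel:
  assumes t: "t \<in> {0..T}"
  shows "ipS (\<lambda>x. u t x $ i) (Y k) = cosw t (lam k) * a i k + sinw t (lam k) * b i k
     + integral {0..t} (\<lambda>s. sinw (t - s) (lam k) * l2_nth (F s $ i) k)"
proof (cases "k = 0")
  case True
  then show ?thesis by (simp add: u_coef lam_0 cosw_def b_0 F_0)
next
  case False
  define om where "om = sqrt (lam k)"
  have l: "lam k \<noteq> 0" and om: "om \<noteq> 0" using lam_ge_2[of k] False by (auto simp: om_def)
  have io: "iom k = 1 / om" using False by (simp add: iom_def om_def)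
  have sub: "{0..t} \<subseteq> {0..T}" using t by auto
  define f where "f = (\<lambda>s. l2_nth (F s $ i) k)"
  have fc: "continuous_on {0..t} f" unfolding f_def by (rule continuous_on_subset[OF F_coef_cont sub])
  \<comment> \<open>The forcing and the data are coefficients of actual functions, so they absorb
    the factor \<open>nY k\<close> brought in by \<open>u_coef\<close>.\<close>
  have nf: "nY k * f s = f s" for s
    unfolding f_def NL_coef[symmetric] using ipS_Y_nY[of "NL A M (u s) i" k] by (simp add: mult.commute)
  have na: "a i k * nY k = a i k" "b i k * nY k = b i k" by (simp_all add: a_def b_def ipS_Y_nY)
  have iS: "(\<lambda>s. Sn s k * f s) integrable_on {0..t}" "(\<lambda>s. Cs s k * f s) integrable_on {0..t}"
    by (intro integrable_continuous_real continuous_intros Sn_continuous Cs_continuous fc)+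
  have nI: "integral {0..t} (\<lambda>s. g s * f s) * nY k = integral {0..t} (\<lambda>s. g s * f s)" for g
  proof -
    have "integral {0..t} (\<lambda>s. g s * f s) * nY k = integral {0..t} (\<lambda>s. (g s * f s) * nY k)"
      by (rule integral_mult_left[symmetric])
    also have "(\<lambda>s. (g s * f s) * nY k) = (\<lambda>s. g s * (nY k * f s))" by (simp only: ac_simps)
    also have "\<dots> = (\<lambda>s. g s * f s)" by (simp only: nf)
    finally show ?thesis .
  qed
  have si: "sinw (t - s) (lam k) = (Sn t k * Cs s k - Cs t k * Sn s k) / om" for s
    using l by (simp add: sinw_def Sn_def Cs_def om_def left_diff_distrib sin_diff)
  have "integral {0..t} (\<lambda>s. sinw (t - s) (lam k) * f s)
      = integral {0..t} (\<lambda>s. (Sn t k / om) * (Cs s k * f s) - (Cs t k / om) * (Sn s k * f s))"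
    by (rule Henstock_Kurzweil_Integration.integral_cong) (simp add: si diff_divide_distrib algebra_simps)
  also have "\<dots> = (Sn t k / om) * integral {0..t} (\<lambda>s. Cs s k * f s) - (Cs t k / om) * integral {0..t} (\<lambda>s. Sn s k * f s)"
    unfolding Henstock_Kurzweil_Integration.integral_mult_right[symmetric]
    by (intro Henstock_Kurzweil_Integration.integral_diff integrable_on_mult_right iS)
  finally have D: "integral {0..t} (\<lambda>s. sinw (t - s) (lam k) * f s)
      = (Sn t k / om) * integral {0..t} (\<lambda>s. Cs s k * f s) - (Cs t k / om) * integral {0..t} (\<lambda>s. Sn s k * f s)" .
  have pn: "p i k t * nY k = om * a i k - integral {0..t} (\<lambda>s. Sn s k * f s)"
  proof -
    have "p i k t * nY k = om * (a i k * nY k) - integral {0..t} (\<lambda>s. Sn s k * f s) * nY k"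
      by (simp only: p_def f_def om_def left_diff_distrib mult.assoc)
    then show ?thesis by (simp only: na nI)
  qed
  have qn: "q i k t * nY k = b i k + integral {0..t} (\<lambda>s. Cs s k * f s)"
  proof -
    have "q i k t * nY k = b i k * nY k + integral {0..t} (\<lambda>s. Cs s k * f s) * nY k"
      by (simp only: q_def f_def distrib_right)
    then show ?thesis by (simp only: na nI)
  qed
  have "ipS (\<lambda>x. u t x $ i) (Y k) = (1 / om) * (Cs t k * (p i k t * nY k) + Sn t k * (q i k t * nY k))"
    using False by (simp add: u_coef W_coef[OF t] io algebra_simps)
  also have "\<dots> = Cs t k * a i k + (Sn t k / om) * b i k
     + ((Sn t k / om) * integral {0..t} (\<lambda>s. Cs s k * f s) - (Cs t k / om) * integral {0..t} (\<lambda>s. Sn s k * f s))"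
    unfolding pn qn using om by (simp add: field_simps)
  also have "Cs t k = cosw t (lam k)" by (simp add: Cs_def cosw_def)
  also have "Sn t k / om = sinw t (lam k)" using l by (simp add: Sn_def sinw_def om_def)
  finally show ?thesis using D unfolding f_def by (simp add: Cs_def cosw_def Sn_def sinw_def om_def l)
qed

lemma u_duhamel_eigenS:
  assumes t: "t \<in> {0..T}" and Z: "eigenS l Z"
  shows "set_integrable lborel {0..t} (\<lambda>\<tau>. sinw (t - \<tau>) l * ipS (NL A M (u \<tau>) i) Z)" (is ?int)
    and "ipS (\<lambda>x. u t x $ i) Z = cosw t l * ipS (\<lambda>x. u0 x $ i) Z + sinw t l * ipS (\<lambda>x. u1 x $ i) Z
          + (LINT \<tau>:{0..t}|lborel. sinw (t - \<tau>) l * ipS (NL A M (u \<tau>) i) Z)"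
proof -
  have sub: "{0..t} \<subseteq> {0..T}" using t by auto
  let ?K = "{k. lam k = l}"
  have NLZ: "ipS (NL A M (u \<tau>) i) Z = (\<Sum>k\<in>?K. l2_nth (F \<tau> $ i) k * ipS Z (Y k))" for \<tau>
    by (simp add: ipS_eigenS[OF Z NL_L2S] NL_coef)
  have sc: "continuous_on {0..t} (\<lambda>\<tau>. sinw (t - \<tau>) l)"
    unfolding sinw_def by (cases "l = 0") (auto intro!: continuous_intros)
  have fc: "continuous_on {0..t} (\<lambda>\<tau>. l2_nth (F \<tau> $ i) k)" for k
    by (rule continuous_on_subset[OF F_coef_cont sub])
  show int: ?int
    unfolding NLZ by (intro borel_integrable_atLeastAtMost' continuous_intros sc fc)
  have "(LINT \<tau>:{0..t}|lborel. sinw (t - \<tau>) l * ipS (NL A M (u \<tau>) i) Z)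
      = integral {0..t} (\<lambda>\<tau>. sinw (t - \<tau>) l * ipS (NL A M (u \<tau>) i) Z)"
    by (rule set_borel_integral_eq_integral(2)[OF int])
  also have "\<dots> = integral {0..t} (\<lambda>\<tau>. \<Sum>k\<in>?K. (sinw (t - \<tau>) l * l2_nth (F \<tau> $ i) k) * ipS Z (Y k))"
    unfolding NLZ by (simp add: sum_distrib_left mult.assoc)
  also have "\<dots> = (\<Sum>k\<in>?K. integral {0..t} (\<lambda>\<tau>. (sinw (t - \<tau>) l * l2_nth (F \<tau> $ i) k) * ipS Z (Y k)))"
    by (intro Henstock_Kurzweil_Integration.integral_sum finite_lam integrable_continuous_real continuous_intros sc fc)
  also have "\<dots> = (\<Sum>k\<in>?K. integral {0..t} (\<lambda>\<tau>. sinw (t - \<tau>) l * l2_nth (F \<tau> $ i) k) * ipS Z (Y k))"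
    by (intro sum.cong refl integral_mult_left)
  finally have I: "(LINT \<tau>:{0..t}|lborel. sinw (t - \<tau>) l * ipS (NL A M (u \<tau>) i) Z)
      = (\<Sum>k\<in>?K. integral {0..t} (\<lambda>\<tau>. sinw (t - \<tau>) l * l2_nth (F \<tau> $ i) k) * ipS Z (Y k))" .
  have "ipS (\<lambda>x. u t x $ i) Z = (\<Sum>k\<in>?K. (cosw t l * a i k + sinw t l * b i k
     + integral {0..t} (\<lambda>s. sinw (t - s) l * l2_nth (F s $ i) k)) * ipS Z (Y k))"
    unfolding ipS_eigenS[OF Z u_L2S] by (intro sum.cong refl) (auto simp: u_duhamel[OF t])
  also have "\<dots> = cosw t l * (\<Sum>k\<in>?K. a i k * ipS Z (Y k)) + sinw t l * (\<Sum>k\<in>?K. b i k * ipS Z (Y k))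
     + (\<Sum>k\<in>?K. integral {0..t} (\<lambda>\<tau>. sinw (t - \<tau>) l * l2_nth (F \<tau> $ i) k) * ipS Z (Y k))"
    by (simp add: distrib_right sum.distrib sum_distrib_left mult.assoc)
  finally show "ipS (\<lambda>x. u t x $ i) Z = cosw t l * ipS (\<lambda>x. u0 x $ i) Z + sinw t l * ipS (\<lambda>x. u1 x $ i) Z
          + (LINT \<tau>:{0..t}|lborel. sinw (t - \<tau>) l * ipS (NL A M (u \<tau>) i) Z)"
    unfolding I by (simp add: ipS_eigenS[OF Z u0_L2S] ipS_eigenS[OF Z u1] a_def b_def)
qed

lemma u_tendsto:
  assumes t: "t \<in> {0..T}"
  shows "((\<lambda>s. H1vnorm (\<lambda>x. u s x - u t x)) \<longlongrightarrow> 0) (at t within {0..T})"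
proof (rule tendsto_zero_norm_bound)
  show "((\<lambda>s. W s - W t) \<longlongrightarrow> 0) (at t within {0..T})"
    using W_cont t by (auto simp: continuous_on_def intro: LIM_zero)
  fix s
  have "H1vnorm (\<lambda>x. u s x - u t x) \<le> norm (W s - W t)"
    by (rule H1vnorm_le)
       (simp_all add: L2S_diff u_L2S ipS_diff_left Y_L2S u_coef algebra_simps)
  then show "0 \<le> H1vnorm (\<lambda>x. u s x - u t x) \<and> H1vnorm (\<lambda>x. u s x - u t x) \<le> norm (W s - W t)"
    by (simp add: H1vnorm_nonneg)
qed

lemma v_tendsto:
  assumes t: "t \<in> {0..T}"
  shows "((\<lambda>s. L2vnorm (\<lambda>x. v s x - v t x)) \<longlongrightarrow> 0) (at t within {0..T})"
proof (rule tendsto_zero_norm_bound)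
  show "((\<lambda>s. V s - V t) \<longlongrightarrow> 0) (at t within {0..T})"
    using V_cont t by (auto simp: continuous_on_def intro: LIM_zero)
  fix s
  have "L2vnorm (\<lambda>x. v s x - v t x) \<le> norm (V s - V t)"
    by (rule L2vnorm_le)
       (simp_all add: L2S_diff v_L2S ipS_diff_left Y_L2S v_coef algebra_simps)
  then show "0 \<le> L2vnorm (\<lambda>x. v s x - v t x) \<and> L2vnorm (\<lambda>x. v s x - v t x) \<le> norm (V s - V t)"
    by (simp add: L2vnorm_nonneg)
qed

text \<open>The coefficients of the difference quotient minus \<open>v t\<close> are those of the
  slope of \<open>mv iom (W s)\<close> minus \<open>V t\<close>, the constant modes cancelling, so
  convergence is that of \<open>Q_vector_derivative\<close>.\<close>

lemma u_deriv:
  assumes t: "t \<in> {0..T}"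
  shows "((\<lambda>s. L2vnorm (\<lambda>x. (u s x - u t x) /\<^sub>R (s - t) - v t x)) \<longlongrightarrow> 0) (at t within {0..T})"
proof (rule tendsto_zero_norm_bound)
  let ?w = "\<lambda>s. (mv iom (W s) - mv iom (W t)) /\<^sub>R (s - t) - V t"
  show "(?w \<longlongrightarrow> 0) (at t within {0..T})"
    by (rule has_vector_derivative_slope[OF Q_vector_derivative[OF t]])
  fix s
  have eq: "(\<lambda>x. ((u s x - u t x) /\<^sub>R (s - t) - v t x) $ i)
      = (\<lambda>x. inverse (s - t) * (u s x $ i - u t x $ i) - v t x $ i)" for i by simp
  have "L2vnorm (\<lambda>x. (u s x - u t x) /\<^sub>R (s - t) - v t x) \<le> norm (?w s)"
  proof (rule L2vnorm_le)
    show "L2S (\<lambda>x. ((u s x - u t x) /\<^sub>R (s - t) - v t x) $ i)" for i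
      unfolding eq by (intro L2S_diff L2S_cmult u_L2S v_L2S)
    show "ipS (\<lambda>x. ((u s x - u t x) /\<^sub>R (s - t) - v t x) $ i) (Y k) = l2_nth (?w s $ i) k * nY k" for i k
    proof -
      have "ipS (\<lambda>x. inverse (s - t) * (u s x $ i - u t x $ i) - v t x $ i) (Y k)
          = ipS (\<lambda>x. inverse (s - t) * (u s x $ i - u t x $ i)) (Y k) - ipS (\<lambda>x. v t x $ i) (Y k)"
        by (intro ipS_diff_left L2S_cmult L2S_diff u_L2S v_L2S Y_L2S)
      also have "ipS (\<lambda>x. inverse (s - t) * (u s x $ i - u t x $ i)) (Y k)
          = inverse (s - t) * (ipS (\<lambda>x. u s x $ i) (Y k) - ipS (\<lambda>x. u t x $ i) (Y k))"
        unfolding ipS_cmult_left by (simp only: ipS_diff_left[OF u_L2S u_L2S Y_L2S])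
      finally have h: "ipS (\<lambda>x. inverse (s - t) * (u s x $ i - u t x $ i) - v t x $ i) (Y k)
          = inverse (s - t) * (ipS (\<lambda>x. u s x $ i) (Y k) - ipS (\<lambda>x. u t x $ i) (Y k)) - ipS (\<lambda>x. v t x $ i) (Y k)" .
      show ?thesis unfolding eq h
        by (simp add: u_coef v_coef iom_bound iom_0 algebra_simps)
    qed
  qed
  then show "0 \<le> L2vnorm (\<lambda>x. (u s x - u t x) /\<^sub>R (s - t) - v t x)
      \<and> L2vnorm (\<lambda>x. (u s x - u t x) /\<^sub>R (s - t) - v t x) \<le> norm (?w s)"
    by (simp add: L2vnorm_nonneg)
qed

lemma vec_AE_eqI:
  fixes f g :: "real^3 \<Rightarrow> real^'n"
  assumes "\<And>i. AE x in sphere_measure. f x $ i = g x $ i"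
  shows "AE x in sphere_measure. f x = g x"
proof -
  have "AE x in sphere_measure. \<forall>i\<in>UNIV. f x $ i = g x $ i"
    by (rule AE_finite_allI) (use assms in auto)
  then show ?thesis by eventually_elim (simp add: vec_eq_iff)
qed

lemma u_initial: "AE x in sphere_measure. u 0 x = u0 x"
proof (rule vec_AE_eqI)
  fix i
  have "ipS (\<lambda>x. u 0 x $ i) (Y k) = a i k" for k
    using u_duhamel[of 0 i k] T by (simp add: cosw_def sinw_def)
  then show "AE x in sphere_measure. u 0 x $ i = u0 x $ i"
    by (intro L2S_eqI_AE u_L2S u0_L2S) (simp add: a_def)
qed

lemma v_initial: "AE x in sphere_measure. v 0 x = u1 x"
proof (rule vec_AE_eqI)
  fix i
  have "ipS (\<lambda>x. v 0 x $ i) (Y k) = ipS (\<lambda>x. u1 x $ i) (Y k)" for k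
    using T by (simp add: v_coef V_coef Cs_def Sn_def q_def b_def ipS_Y_nY)
  then show "AE x in sphere_measure. v 0 x $ i = u1 x $ i"
    by (intro L2S_eqI_AE v_L2S u1)
qed

lemma u_is_solution: "is_solution A M T u0 u1 u"
  unfolding is_solution_def
proof (intro conjI ballI allI impI exI[of _ v])
qed (use u_H1S u_tendsto v_L2S v_tendsto u_deriv v_initial u_initial u_exp_integrable NL_L2S
       u_duhamel_eigenS in auto)

end

text \<open>By Parseval the two components of the initial state have exactly the norms of the data;
  their sum is the radius that is fed into the choice of the lifespan.\<close>

lemma norm_initial_le:
  fixes u0 u1 :: "real^3 \<Rightarrow> real^'n::finite"
  assumes u0: "\<And>i. H1S (\<lambda>x. u0 x $ i)" and u1: "\<And>i. L2S (\<lambda>x. u1 x $ i)"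
  shows "norm (\<chi> i. h1c (\<lambda>x. u0 x $ i), \<chi> i. cf (\<lambda>x. u1 x $ i)) \<le> H1vnorm u0 + L2vnorm u1"
proof -
  have "norm (\<chi> i. h1c (\<lambda>x. u0 x $ i)) = H1vnorm u0"
    by (simp add: norm_vec_def L2_set_def H1vnorm_def h1c(2)[OF u0])
  moreover have "norm (\<chi> i. cf (\<lambda>x. u1 x $ i)) = L2vnorm u1"
    by (simp add: norm_vec_def L2_set_def L2vnorm_def norm_cf[OF u1] ipS_self)
  ultimately show ?thesis
    using norm_Pair_le[of "\<chi> i. h1c (\<lambda>x. u0 x $ i)" "\<chi> i. cf (\<lambda>x. u1 x $ i)"] by simp
qed

theorem theorem1p4:
  fixes A :: "real^'n^'n" and M :: "real^'n::finite"
  assumes "transpose A = A"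
  shows "\<exists>Tf :: real \<Rightarrow> real \<Rightarrow> real. \<forall>u0 u1 :: real^3 \<Rightarrow> real^'n.
     (\<forall>i. H1S (\<lambda>x. u0 x $ i)) \<and> (\<forall>i. L2S (\<lambda>x. u1 x $ i)) \<and>
     (\<forall>i. integral\<^sup>L sphere_measure (\<lambda>x. u1 x $ i) = 0) \<longrightarrow>
     Tf (H1vnorm u0) (L2vnorm u1) > 0 \<and>
     (\<exists>u. is_solution A M (Tf (H1vnorm u0) (L2vnorm u1)) u0 u1 u \<and>
          (\<forall>t\<in>{0..Tf (H1vnorm u0) (L2vnorm u1)}. \<forall>i.
             integral\<^sup>L sphere_measure (\<lambda>x. u t x $ i)
             = integral\<^sup>L sphere_measure (\<lambda>x. u0 x $ i)))"
proof -
  \<comment> \<open>The time is chosen for every radius before any data are fixed; this is what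
    makes it a function of the two norms once \<open>A\<close> and \<open>M\<close> are
    given.\<close>
  have "\<forall>r. \<exists>T. 0 < T \<and> (\<forall>y0. norm y0 \<le> r \<longrightarrow> (\<exists>y. continuous_on {0..T} y \<and>
     (\<forall>t\<in>{0..T}. y t = y0 + integral {0..t} (\<lambda>s. Gv A M s (y s)))))"
    using evolution_exists[of _ A M] by simp
  from choice[OF this] obtain \<tau> where \<tau>: "\<forall>r. 0 < \<tau> r \<and> (\<forall>y0. norm y0 \<le> r \<longrightarrow>
     (\<exists>y. continuous_on {0..\<tau> r} y \<and>
       (\<forall>t\<in>{0..\<tau> r}. y t = y0 + integral {0..t} (\<lambda>s. Gv A M s (y s)))))"
    by (rule exE)
  have \<tau>_pos: "0 < \<tau> r" for r using \<tau> by simp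
  show ?thesis
  proof (intro exI[of _ "\<lambda>r s. \<tau> (r + s)"] allI impI conjI)
    fix u0 u1 :: "real^3 \<Rightarrow> real^'n"
    assume H: "(\<forall>i. H1S (\<lambda>x. u0 x $ i)) \<and> (\<forall>i. L2S (\<lambda>x. u1 x $ i)) \<and>
     (\<forall>i. integral\<^sup>L sphere_measure (\<lambda>x. u1 x $ i) = 0)"
    show "0 < \<tau> (H1vnorm u0 + L2vnorm u1)" by (rule \<tau>_pos)
    obtain y where y: "continuous_on {0..\<tau> (H1vnorm u0 + L2vnorm u1)} y"
      "\<And>t. t \<in> {0..\<tau> (H1vnorm u0 + L2vnorm u1)} \<Longrightarrow>
        y t = (\<chi> i. h1c (\<lambda>x. u0 x $ i), \<chi> i. cf (\<lambda>x. u1 x $ i)) + integral {0..t} (\<lambda>s. Gv A M s (y s))"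
      using conjunct2[OF spec[OF \<tau>], rule_format, OF norm_initial_le, of u0 u1] H by auto
    interpret wave_evolution A M "\<tau> (H1vnorm u0 + L2vnorm u1)" u0 u1 y
      by unfold_locales (use H y \<tau>_pos in auto)
    show "\<exists>u. is_solution A M (\<tau> (H1vnorm u0 + L2vnorm u1)) u0 u1 u \<and>
          (\<forall>t\<in>{0..\<tau> (H1vnorm u0 + L2vnorm u1)}. \<forall>i.
             integral\<^sup>L sphere_measure (\<lambda>x. u t x $ i)
             = integral\<^sup>L sphere_measure (\<lambda>x. u0 x $ i))"
      using u_is_solution u_mean by blast
  qed
qed

end
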